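(* Let $\rho$ be a Riemannian metric on the 2-torus $\mathbb{T}^2$ whose geodesic flow has a first integral $F_4$ that is a homogeneous polynomial of degree $4$ in the momenta, written in normalized semi-geodesic coordinates $(t,x)$. Assume $\Omega_e=\mathbb{T}^2$, i.e. assume that for all $(t,x)$ the polynomial $\hat G_4$ has $4$ distinct roots, of which two are (non-real) complex conjugate, $s_{1,2}=\alpha\pm i\beta$, and two, $s_3,s_4$, are real. Assume also that the imaginary part of the Riemann invariants $r_{1,2}$ does not vanish. Then the real eigenvalues $\lambda_{3}=gs_3$ and $\lambda_4=gs_4$ are necessarily genuinely nonlinear, i.e. $\frac{\partial\lambda_3}{\partial r_3}\neq0$ and $\frac{\partial\lambda_4}{\partial r_4}\ne 0$, and therefore the corresponding Riemann invariants $r_3,r_4$ are constants. In particular all the coefficients $a_i$ must be constant, and so the metric $\rho$ is flat.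
   Context: All objects are smooth. $\mathbb{T}^2=\mathbb{R}^2/\Gamma$, $\Gamma$ a lattice; $H:T^*\mathbb{T}^2\to\mathbb{R}$ is half the squared norm of the momentum. A first integral is a function $F$ on $T^*\mathbb{T}^2$ with $\{F,H\}=0$. Normalized semi-geodesic coordinates (standing assumption; it is known that they exist): using a regular Liouville torus $L$ of the geodesic flow (a common level set of $F_4$ and $H$ on which $dF_4,dH$ are independent) that projects diffeomorphically onto $\mathbb{T}^2$, one has global coordinates $(t,x)$ on the covering plane, with conjugate momenta $(p_1,p_2)$, such that the curves $\{t=\text{const}\}$ are the geodesics of $L$ and $ds^2=g^2(t,x)\,dt^2+dx^2$, $g>0$, $H=\tfrac12(p_1^2/g^2+p_2^2)$. The integral is $F_4=\sum_{k=0}^4 a_k(t,x)\frac{p_1^{4-k}}{g^{4-k}}p_2^k$, normalized so that $a_3\equiv g$, $a_4\equiv 1$. With $U=(a_0,a_1,a_2,a_3)^T$, the condition $\{F_4,H\}=0$ becomes a quasi-linear system $U_t+A(U)U_x=0$. $\hat F_4(s)=\sum_{k=0}^4a_ks^k$ and $\hat G_4(s)=\frac{g^4}{p_1^4}\,L_vF_4$ with $s=\frac{p_2}{p_1/g}$, where $v=-p_2\frac{\partial}{\partial(p_1/g)}+\frac{p_1}{g}\frac{\partial}{\partial p_2}$ (derivative along the circular fibre of $\{H=1/2\}$). If $s_1,\dots,s_4$ are the roots of $\hat G_4$, the eigenvalues of $A(U)$ are $\lambda_i=gs_i$, and the system takes the Riemann-invariant form $(r_i)_t+\lambda_i(r_i)_x=0$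 with $$r_i=\frac{\hat F_4(s_i)}{(1+s_i^2)^2}.$$ $\Omega_e$ denotes the region of $\mathbb{T}^2$ where the eigenvalues are distinct and two of them are non-real complex conjugates. When the roots are distinct, $r_1,\dots,r_4$ serve as (complex) local coordinates in the space of field variables $(a_0,a_1,a_2,a_3)$ (with $g=a_3$, $a_4=1$), and $\partial\lambda_i/\partial r_i$ is taken in these coordinates; $\lambda_i$ is called genuinely nonlinear if $\partial\lambda_i/\partial r_i\neq0$. *)

theory Defs
  imports "HOL-Analysis.Analysis"
begin

section \<open>Smooth maps\<close>

text \<open>\<open>Ck_on k f S\<close> is meant for open \<open>S\<close>: \<open>f\<close> is of class \<open>C\<^sup>k\<close> there.\<close>

primrec Ck_on :: "nat \<Rightarrow> ('a::euclidean_space \<Rightarrow> 'b::real_normed_vector) \<Rightarrow> 'a set \<Rightarrow> bool" where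
  "Ck_on 0 f S \<longleftrightarrow> continuous_on S f"
| "Ck_on (Suc k) f S \<longleftrightarrow> (\<forall>x\<in>S. f differentiable (at x)) \<and>
     (\<forall>v. Ck_on k (\<lambda>x. frechet_derivative f (at x) v) S)"

definition smooth_on :: "'a::euclidean_space set \<Rightarrow> ('a \<Rightarrow> 'b::real_normed_vector) \<Rightarrow> bool" where
  "smooth_on S f \<longleftrightarrow> (\<forall>k. Ck_on k f S)"


section \<open>Metrics, Hamiltonians and first integrals on the torus\<close>

text \<open>
  The torus is the quotient of the plane \<open>real^2\<close> by a lattice \<open>\<Gamma>\<close>; objects on the torus and on
  its cotangent bundle are \<open>\<Gamma>\<close>-periodic objects on the plane and on \<open>real^2 \<times> real^2\<close>
  (position, momentum).
\<close>

definition plane_lattice :: "(real^2) set \<Rightarrow> bool" where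
  "plane_lattice \<Gamma> \<longleftrightarrow> (\<exists>u v. u \<noteq> v \<and> independent {u, v} \<and>
     \<Gamma> = {of_int m *\<^sub>R u + of_int n *\<^sub>R v | m n. True})"

definition periodic :: "(real^2) set \<Rightarrow> (real^2 \<Rightarrow> 'b) \<Rightarrow> bool" where
  "periodic \<Gamma> f \<longleftrightarrow> (\<forall>\<gamma>\<in>\<Gamma>. \<forall>y. f (y + \<gamma>) = f y)"

definition torus_metric :: "(real^2) set \<Rightarrow> (real^2 \<Rightarrow> real^2^2) \<Rightarrow> bool" where
  "torus_metric \<Gamma> \<rho> \<longleftrightarrow> smooth_on UNIV \<rho> \<and> periodic \<Gamma> \<rho> \<and>
     (\<forall>y. transpose (\<rho> y) = \<rho> y) \<and> (\<forall>y v. v \<noteq> 0 \<longrightarrow> v \<bullet> (\<rho> y *v v) > 0)"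

definition metric_inner :: "(real^2 \<Rightarrow> real^2^2) \<Rightarrow> real^2 \<Rightarrow> real^2 \<Rightarrow> real^2 \<Rightarrow> real" where
  "metric_inner \<rho> y v w = v \<bullet> (\<rho> y *v w)"

text \<open>Flatness: the metric is locally isometric to the Euclidean plane.\<close>

definition flat_metric :: "(real^2 \<Rightarrow> real^2^2) \<Rightarrow> bool" where
  "flat_metric \<rho> \<longleftrightarrow> (\<forall>y. \<exists>N (\<psi> :: real^2 \<Rightarrow> real^2). open N \<and> y \<in> N \<and> smooth_on N \<psi> \<and> inj_on \<psi> N \<and>
     (\<forall>z\<in>N. \<forall>v w. metric_inner \<rho> z v w =
        frechet_derivative \<psi> (at z) v \<bullet> frechet_derivative \<psi> (at z) w))"

definition geodesic_hamiltonian :: "(real^2 \<Rightarrow> real^2^2) \<Rightarrow> (real^2) \<times> (real^2) \<Rightarrow> real" where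
  "geodesic_hamiltonian \<rho> = (\<lambda>(y, p). (p \<bullet> (matrix_inv (\<rho> y) *v p)) / 2)"

definition d_pos :: "((real^2) \<times> (real^2) \<Rightarrow> real) \<Rightarrow> (real^2) \<times> (real^2) \<Rightarrow> 2 \<Rightarrow> real" where
  "d_pos f w i = frechet_derivative f (at w) (axis i 1, 0)"

definition d_mom :: "((real^2) \<times> (real^2) \<Rightarrow> real) \<Rightarrow> (real^2) \<times> (real^2) \<Rightarrow> 2 \<Rightarrow> real" where
  "d_mom f w i = frechet_derivative f (at w) (0, axis i 1)"

definition poisson_bracket ::
  "((real^2) \<times> (real^2) \<Rightarrow> real) \<Rightarrow> ((real^2) \<times> (real^2) \<Rightarrow> real) \<Rightarrow> (real^2) \<times> (real^2) \<Rightarrow> real" where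
  "poisson_bracket f h w = (\<Sum>i\<in>UNIV. d_pos f w i * d_mom h w i - d_mom f w i * d_pos h w i)"

definition quartic_in_momenta ::
  "(real^2) set \<Rightarrow> ((real^2) \<times> (real^2) \<Rightarrow> real) \<Rightarrow> bool" where
  "quartic_in_momenta \<Gamma> F \<longleftrightarrow> (\<exists>c :: nat \<Rightarrow> real^2 \<Rightarrow> real.
     (\<forall>k\<le>4. smooth_on UNIV (c k) \<and> periodic \<Gamma> (c k)) \<and>
     (\<forall>y p. F (y, p) = (\<Sum>k\<le>4. c k y * (p $ 1) ^ (4 - k) * (p $ 2) ^ k)))"

definition quartic_first_integral ::
  "(real^2) set \<Rightarrow> (real^2 \<Rightarrow> real^2^2) \<Rightarrow> ((real^2) \<times> (real^2) \<Rightarrow> real) \<Rightarrow> bool" where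
  "quartic_first_integral \<Gamma> \<rho> F \<longleftrightarrow> quartic_in_momenta \<Gamma> F \<and>
     (\<forall>w. poisson_bracket F (geodesic_hamiltonian \<rho>) w = 0)"

text \<open>
  A regular Liouville torus projecting diffeomorphically onto the base, lifted to the covering:
  the graph of a smooth \<open>\<Gamma>\<close>-periodic covector field.  It is a connected component of a common
  level set and not the whole of it, since \<open>F\<close> and \<open>H\<close> are both even in the momenta.
\<close>

definition regular_liouville_torus ::
  "(real^2) set \<Rightarrow> (real^2 \<Rightarrow> real^2^2) \<Rightarrow> ((real^2) \<times> (real^2) \<Rightarrow> real) \<Rightarrow> ((real^2) \<times> (real^2)) set \<Rightarrow> bool" where
  "regular_liouville_torus \<Gamma> \<rho> F L \<longleftrightarrow>
     (let H = geodesic_hamiltonian \<rho> in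
       (\<exists>c h. L \<in> components {w. F w = c \<and> H w = h}) \<and>
       (\<forall>w\<in>L. \<forall>a b :: real.
          (\<forall>v. a * frechet_derivative F (at w) v + b * frechet_derivative H (at w) v = 0)
            \<longrightarrow> a = 0 \<and> b = 0) \<and>
       (\<exists>\<sigma> :: real^2 \<Rightarrow> real^2. smooth_on UNIV \<sigma> \<and> periodic \<Gamma> \<sigma> \<and> L = range (\<lambda>y. (y, \<sigma> y))))"

definition hamiltonian_trajectory ::
  "((real^2) \<times> (real^2) \<Rightarrow> real) \<Rightarrow> (real \<Rightarrow> (real^2) \<times> (real^2)) \<Rightarrow> bool" where
  "hamiltonian_trajectory H c \<longleftrightarrow> (\<forall>\<tau>.
     (c has_vector_derivative (\<chi> i. d_mom H (c \<tau>) i, \<chi> i. - d_pos H (c \<tau>) i)) (at \<tau>))"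

text \<open>The geodesics of \<open>L\<close>, as unparametrized curves in the covering plane.\<close>

definition geodesics_of ::
  "(real^2 \<Rightarrow> real^2^2) \<Rightarrow> ((real^2) \<times> (real^2)) set \<Rightarrow> (real^2) set set" where
  "geodesics_of \<rho> L = {range (fst \<circ> c) | c.
     hamiltonian_trajectory (geodesic_hamiltonian \<rho>) c \<and> range c \<subseteq> L}"


section \<open>Normalized semi-geodesic coordinates\<close>

text \<open>
  \<open>\<Phi>\<close> sends the coordinates \<open>(t, x)\<close> to a point of the covering plane.  The momenta conjugate
  to \<open>(t, x)\<close> of a covector \<open>p\<close> at \<open>\<Phi> (t, x)\<close> are \<open>p \<bullet> \<partial>\<^sub>t\<Phi>\<close> and \<open>p \<bullet> \<partial>\<^sub>x\<Phi>\<close>.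
\<close>

definition d_t :: "(real \<times> real \<Rightarrow> 'b::real_normed_vector) \<Rightarrow> real \<times> real \<Rightarrow> 'b" where
  "d_t f z = frechet_derivative f (at z) (1, 0)"

definition d_x :: "(real \<times> real \<Rightarrow> 'b::real_normed_vector) \<Rightarrow> real \<times> real \<Rightarrow> 'b" where
  "d_x f z = frechet_derivative f (at z) (0, 1)"

definition semi_geodesic_coordinates ::
  "(real^2 \<Rightarrow> real^2^2) \<Rightarrow> ((real^2) \<times> (real^2)) set \<Rightarrow>
   (real \<times> real \<Rightarrow> real^2) \<Rightarrow> (real \<times> real \<Rightarrow> real) \<Rightarrow> bool" where
  "semi_geodesic_coordinates \<rho> L \<Phi> g \<longleftrightarrow>
     bij \<Phi> \<and> smooth_on UNIV \<Phi> \<and> smooth_on UNIV (inv \<Phi>) \<and>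
     smooth_on UNIV g \<and> (\<forall>z. g z > 0) \<and>
     (\<forall>z. metric_inner \<rho> (\<Phi> z) (d_t \<Phi> z) (d_t \<Phi> z) = (g z)\<^sup>2 \<and>
          metric_inner \<rho> (\<Phi> z) (d_t \<Phi> z) (d_x \<Phi> z) = 0 \<and>
          metric_inner \<rho> (\<Phi> z) (d_x \<Phi> z) (d_x \<Phi> z) = 1) \<and>
     range (\<lambda>t. \<Phi> ` ({t} \<times> UNIV)) = geodesics_of \<rho> L"

text \<open>\<open>a k z\<close> is the coefficient \<open>a\<^sub>k\<close> of the integral at \<open>z = (t, x)\<close>.\<close>

definition normalized_coefficients ::
  "((real^2) \<times> (real^2) \<Rightarrow> real) \<Rightarrow> (real \<times> real \<Rightarrow> real^2) \<Rightarrow> (real \<times> real \<Rightarrow> real) \<Rightarrow>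
   (nat \<Rightarrow> real \<times> real \<Rightarrow> real) \<Rightarrow> bool" where
  "normalized_coefficients F \<Phi> g a \<longleftrightarrow>
     (\<forall>k\<le>4. smooth_on UNIV (a k)) \<and>
     (\<forall>z p. F (\<Phi> z, p) =
        (\<Sum>k\<le>4. a k z * (p \<bullet> d_t \<Phi> z) ^ (4 - k) / g z ^ (4 - k) * (p \<bullet> d_x \<Phi> z) ^ k)) \<and>
     (\<forall>z. a 3 z = g z \<and> a 4 z = 1)"


section \<open>Riemann invariants\<close>

text \<open>
  The field variables are complexified.  The index type \<open>4\<close> is the integers modulo 4: a vector
  \<open>U\<close> of field variables has components \<open>U $ k\<close> = \<open>a\<^sub>k\<close> for \<open>k = 0, 1, 2, 3\<close>, while roots,
  eigenvalues and Riemann invariants are labelled by \<open>1, 2, 3, 4\<close> (the label \<open>4\<close> being the same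
  element as \<open>0\<close>).
\<close>

definition field_vars :: "(nat \<Rightarrow> real \<times> real \<Rightarrow> real) \<Rightarrow> real \<times> real \<Rightarrow> complex^4" where
  "field_vars a z = (\<chi> k. complex_of_real
     (if k = 0 then a 0 z else if k = 1 then a 1 z else if k = 2 then a 2 z else a 3 z))"

definition coefficient :: "complex^4 \<Rightarrow> nat \<Rightarrow> complex" where
  "coefficient U k = (if k = 4 then 1 else U $ of_nat k)"

text \<open>\<open>F\<^sub>4\<close> on a fibre, as a function of \<open>q = p\<^sub>1 / g\<close> and \<open>p = p\<^sub>2\<close>, and its derivative along \<open>v\<close>.\<close>

definition fibre_quartic :: "complex^4 \<Rightarrow> complex \<Rightarrow> complex \<Rightarrow> complex" where
  "fibre_quartic U q p = (\<Sum>k\<le>4. coefficient U k * q ^ (4 - k) * p ^ k)"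

definition fibre_derivative :: "complex^4 \<Rightarrow> complex \<Rightarrow> complex \<Rightarrow> complex" where
  "fibre_derivative U q p =
     - p * deriv (\<lambda>q'. fibre_quartic U q' p) q + q * deriv (\<lambda>p'. fibre_quartic U q p') p"

definition F_hat :: "complex^4 \<Rightarrow> complex \<Rightarrow> complex" where
  "F_hat U s = (\<Sum>k\<le>4. coefficient U k * s ^ k)"

text \<open>
  The derivative along \<open>v\<close> is homogeneous of degree 4 in \<open>(q, p)\<close>, so dividing it by \<open>q\<^sup>4\<close>
  amounts to evaluating it at \<open>q = 1\<close>, \<open>p = s\<close>.
\<close>

definition G_hat :: "complex^4 \<Rightarrow> complex \<Rightarrow> complex" where
  "G_hat U s = fibre_derivative U 1 s"

text \<open>\<open>s\<close> lists the roots of \<open>G_hat U\<close>, which are four distinct numbers.\<close>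

definition distinct_roots :: "complex^4 \<Rightarrow> complex^4 \<Rightarrow> bool" where
  "distinct_roots U s \<longleftrightarrow> inj (($) s) \<and> range (($) s) = {\<zeta>. G_hat U \<zeta> = 0}"

definition eigenvalue :: "complex^4 \<Rightarrow> complex \<Rightarrow> complex" where
  "eigenvalue U \<zeta> = U $ 3 * \<zeta>"

definition riemann_invariant :: "complex^4 \<Rightarrow> complex \<Rightarrow> complex" where
  "riemann_invariant U \<zeta> = F_hat U \<zeta> / (1 + \<zeta>\<^sup>2)\<^sup>2"

definition riemann_map :: "(complex^4 \<Rightarrow> complex^4) \<Rightarrow> complex^4 \<Rightarrow> complex^4" where
  "riemann_map S U = (\<chi> i. riemann_invariant U (S U $ i))"

text \<open>
  Near \<open>U\<^sub>0\<close> the roots, labelled there by \<open>s\<^sub>0\<close>, are continued to branches \<open>S\<close> on \<open>N\<close>; the Riemann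
  invariants \<open>R\<close> form a coordinate system on \<open>N\<close> with inverse \<open>V\<close>.
\<close>

definition riemann_coordinates ::
  "complex^4 \<Rightarrow> complex^4 \<Rightarrow> (complex^4) set \<Rightarrow> (complex^4 \<Rightarrow> complex^4) \<Rightarrow>
   (complex^4 \<Rightarrow> complex^4) \<Rightarrow> bool" where
  "riemann_coordinates U\<^sub>0 s\<^sub>0 N S V \<longleftrightarrow>
     open N \<and> U\<^sub>0 \<in> N \<and> continuous_on N S \<and> S U\<^sub>0 = s\<^sub>0 \<and> (\<forall>U\<in>N. distinct_roots U (S U)) \<and>
     (let R = riemann_map S in
        open (R ` N) \<and> homeomorphism N (R ` N) R V \<and>
        R differentiable_on N \<and> V differentiable_on (R ` N))"

text \<open>
  The partial derivative of the \<open>i\<close>-th eigenvalue with respect to the \<open>i\<close>-th Riemann invariant,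
  the other Riemann invariants being kept fixed.  Its value does not depend on the choice of
  \<open>N\<close>, \<open>S\<close>, \<open>V\<close>.
\<close>

definition has_riemann_derivative :: "complex^4 \<Rightarrow> complex^4 \<Rightarrow> 4 \<Rightarrow> complex \<Rightarrow> bool" where
  "has_riemann_derivative U\<^sub>0 s\<^sub>0 i D \<longleftrightarrow> (\<exists>N S V. riemann_coordinates U\<^sub>0 s\<^sub>0 N S V \<and>
     ((\<lambda>\<tau>. let U = V (riemann_map S U\<^sub>0 + axis i \<tau>) in eigenvalue U (S U $ i))
        has_field_derivative D) (at 0))"

definition genuinely_nonlinear :: "complex^4 \<Rightarrow> complex^4 \<Rightarrow> 4 \<Rightarrow> bool" where
  "genuinely_nonlinear U\<^sub>0 s\<^sub>0 i \<longleftrightarrow> (\<exists>D. has_riemann_derivative U\<^sub>0 s\<^sub>0 i D \<and> D \<noteq> 0)"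

end

theory Submission
  imports Defs "HOL-Computational_Algebra.Fundamental_Theorem_Algebra"
begin

text \<open>
  Differentiating the integral on a fibre turns \<open>{F, H} = 0\<close> into
  \<open>\<partial>\<^sub>t f + g s \<partial>\<^sub>x f + g\<^sub>x G = 0\<close>, an identity of polynomials in \<open>s\<close>, where \<open>f = F_hat\<close> and \<open>G = G_hat\<close>.

  If a real eigenvalue were linearly degenerate, then in coordinates of the fibre where its root is
  at infinity the quartic would be even, with nonreal roots \<open>\<plusminus>i\<beta>\<close>, and \<open>r\<^sub>1 = r\<^sub>2\<close> would be real.

  For a real root put \<open>\<eta> = G'(s) (\<partial>\<^sub>x r)\<^sup>2\<close>. It does not depend on the coordinates, so it lives on the
  torus, and along its characteristic it satisfies \<open>D \<eta> = c \<eta> \<partial>\<^sub>x r\<close> with \<open>c\<close> nowhere zero by genuine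
  nonlinearity. At a maximum of \<open>\<eta>\<^sup>2\<close> the left side vanishes, hence \<open>\<eta> = 0\<close> and \<open>r\<close> is constant;
  no blow-up argument along characteristics is needed.

  For the nonreal roots, \<open>\<partial>\<^sub>t r = - \<lambda> \<partial>\<^sub>x r\<close> with \<open>Im \<lambda> \<noteq> 0\<close>, so the Jacobian of \<open>r\<close> as a map to the
  complex plane has constant sign; its integral over the torus is zero, so \<open>r\<close> is constant. The
  cubic \<open>\<partial>\<^sub>x f\<close> then has four roots, whence all coefficients are constant.
\<close>

section \<open>Calculus of smooth maps\<close>

text \<open>The obstacle is that (t, x) are coordinates of the covering plane only. A lattice
  translation turns the coordinate frame by an orthogonal map, so neither the \<open>a k\<close> nor
  the roots are periodic, and compactness can be used only for quantities free of the frame. A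
  critical value r of the integral on the unit circle is one; so are its second derivative G'(s)/(1
  + s^2) there and |grad r|^2, which equals (1 + s^2)(d_x r)^2 because d_t r = - g s d_x r. Their
  product is \<eta>, and in its derivative along the characteristic both the second derivatives of r
  and the terms with g_x drop out. A translation could still permute the roots. It does not: by
  Rolle r_3 and r_4 never coincide, so their order is fixed, and Im r_1 keeps its sign. Thus the
  condition on Im r enters three times: against linear degeneracy, in the labelling of the nonreal
  roots, and to keep the roots away from \<plusminus>i.\<close>

lemma Ck_on_SucI:
  assumes "\<And>x. (f has_derivative f' x) (at x)" "\<And>v. Ck_on k (\<lambda>x. f' x v) UNIV"
  shows "Ck_on (Suc k) f UNIV"
proof -
  have "frechet_derivative f (at x) = f' x" for x
    using frechet_derivative_at[OF assms(1)] by simp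
  then show ?thesis
    using assms by (auto simp: differentiable_def)
qed

lemma Ck_on_SucD:
  assumes "Ck_on (Suc k) f UNIV"
  shows "(f has_derivative frechet_derivative f (at x)) (at x)"
    and "Ck_on k (\<lambda>x. frechet_derivative f (at x) v) UNIV"
  using assms by (auto simp: frechet_derivative_works[symmetric])

lemma Ck_on_Suc_imp: "Ck_on (Suc k) f UNIV \<Longrightarrow> Ck_on k f UNIV"
proof (induction k arbitrary: f)
  case 0
  then show ?case
    by (auto intro!: continuous_at_imp_continuous_on differentiable_imp_continuous_within)
next
  case (Suc k)
  have "\<forall>v. Ck_on k (\<lambda>x. frechet_derivative f (at x) v) UNIV"
    using Suc.IH Suc.prems[unfolded Ck_on.simps(2)[of "Suc k"]] by blast
  with Suc.prems show ?case by simp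
qed

lemma Ck_on_const: "Ck_on k (\<lambda>x. c) UNIV"
proof (induction k arbitrary: c)
  case (Suc k)
  show ?case by (rule Ck_on_SucI[of _ "\<lambda>x v. 0"]) (auto intro: Suc)
qed simp

lemma Ck_on_bounded_linear: "bounded_linear f \<Longrightarrow> Ck_on k f UNIV"
proof (cases k)
  case (Suc n)
  assume "bounded_linear f"
  then show ?thesis
    unfolding Suc by (intro Ck_on_SucI[of _ "\<lambda>x. f"]) (auto intro: Ck_on_const bounded_linear_imp_has_derivative)
qed (simp add: linear_continuous_on)

lemma Ck_on_bounded_linear_compose:
  assumes L: "bounded_linear L" and f: "Ck_on k f UNIV"
  shows "Ck_on k (\<lambda>x. L (f x)) UNIV"
  using f
proof (induction k arbitrary: f)
  case 0
  then show ?case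
    by (simp add: bounded_linear.continuous_on[OF L])
next
  case (Suc k)
  show ?case
    by (rule Ck_on_SucI[of _ "\<lambda>x v. L (frechet_derivative f (at x) v)"])
      (intro bounded_linear.has_derivative[OF L] Ck_on_SucD[OF Suc.prems] Suc.IH)+
qed

lemma Ck_on_add:
  "Ck_on k f UNIV \<Longrightarrow> Ck_on k g UNIV \<Longrightarrow> Ck_on k (\<lambda>x. f x + g x) UNIV"
proof (induction k arbitrary: f g)
  case (Suc k)
  show ?case
    by (rule Ck_on_SucI[of _ "\<lambda>x v. frechet_derivative f (at x) v + frechet_derivative g (at x) v"])
      (intro has_derivative_add Ck_on_SucD[OF Suc.prems(1)] Ck_on_SucD[OF Suc.prems(2)] Suc.IH)+
qed (auto intro: continuous_intros)

lemma Ck_on_bounded_bilinear: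
  assumes B: "bounded_bilinear B"
  shows "Ck_on k f UNIV \<Longrightarrow> Ck_on k g UNIV \<Longrightarrow> Ck_on k (\<lambda>x. B (f x) (g x)) UNIV"
proof (induction k arbitrary: f g)
  case 0
  then show ?case by (simp add: bounded_bilinear.continuous_on[OF B])
next
  case (Suc k)
  show ?case
    by (rule Ck_on_SucI[of _ "\<lambda>x v. B (f x) (frechet_derivative g (at x) v) + B (frechet_derivative f (at x) v) (g x)"])
      (intro bounded_bilinear.FDERIV[OF B] Ck_on_add Suc.IH
        Ck_on_Suc_imp[OF Suc.prems(1)] Ck_on_Suc_imp[OF Suc.prems(2)]
        Ck_on_SucD[OF Suc.prems(1)] Ck_on_SucD[OF Suc.prems(2)])+
qed

lemma Ck_on_inverse:
  fixes f :: "'a::euclidean_space \<Rightarrow> 'b::real_normed_field"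
  assumes nz: "\<And>x. f x \<noteq> 0"
  shows "Ck_on k f UNIV \<Longrightarrow> Ck_on k (\<lambda>x. inverse (f x)) UNIV"
proof (induction k)
  case 0
  then show ?case by (simp add: nz continuous_on_inverse)
next
  case (Suc k)
  have "Ck_on k (\<lambda>x. inverse (f x)) UNIV"
    using Suc.IH Ck_on_Suc_imp[OF Suc.prems] by blast
  then have "Ck_on k (\<lambda>x. - (inverse (f x) * frechet_derivative f (at x) v * inverse (f x))) UNIV" for v
    using Ck_on_SucD(2)[OF Suc.prems, of v]
    by (intro Ck_on_bounded_linear_compose[OF bounded_linear_minus[OF bounded_linear_ident]]
        Ck_on_bounded_bilinear[OF bounded_bilinear_mult])
  then show ?case
    by (intro Ck_on_SucI[of "\<lambda>x. inverse (f x)" "\<lambda>x v. - (inverse (f x) * frechet_derivative f (at x) v * inverse (f x))"]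
         Deriv.has_derivative_inverse nz Ck_on_SucD(1)[OF Suc.prems])
qed

lemma Ck_on_sum:
  "(\<And>i. i \<in> I \<Longrightarrow> Ck_on k (f i) UNIV) \<Longrightarrow> Ck_on k (\<lambda>x. \<Sum>i\<in>I. f i x) UNIV"
  by (induction I rule: infinite_finite_induct) (auto intro: Ck_on_const Ck_on_add)

lemma Ck_on_compose:
  fixes f :: "'b::euclidean_space \<Rightarrow> 'c::real_normed_vector" and g :: "'a::euclidean_space \<Rightarrow> 'b"
  shows "Ck_on k f UNIV \<Longrightarrow> Ck_on k g UNIV \<Longrightarrow> Ck_on k (\<lambda>x. f (g x)) UNIV"
proof (induction k arbitrary: f)
  case 0
  then show ?case
    using continuous_on_compose2[of UNIV f UNIV g] by simp
next
  case (Suc k)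
  \<comment> \<open>\<open>Ck_on\<close> controls derivatives in fixed directions only, while the
    direction Dg(x) v moves with x; expanding it in the basis leaves fixed directions with scalar
    coefficients.\<close>
  let ?D = "\<lambda>x v. \<Sum>b\<in>Basis. (frechet_derivative g (at x) v \<bullet> b) *\<^sub>R frechet_derivative f (at (g x)) b"
  have f: "(f has_derivative frechet_derivative f (at y)) (at y)" for y
    by (rule Ck_on_SucD[OF Suc.prems(1)])
  have D: "frechet_derivative f (at (g x)) (frechet_derivative g (at x) v) = ?D x v" for x v
  proof -
    have l: "linear (frechet_derivative f (at (g x)))"
      using f has_derivative_linear by blast
    show ?thesis
      by (subst euclidean_representation[symmetric, of "frechet_derivative g (at x) v"])
        (simp only: linear_sum[OF l] linear_scale[OF l])
  qed
  have g: "Ck_on k g UNIV" by (rule Ck_on_Suc_imp[OF Suc.prems(2)])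
  have "Ck_on k (\<lambda>x. frechet_derivative f (at (g x)) b) UNIV" for b
    by (rule Suc.IH[OF Ck_on_SucD(2)[OF Suc.prems(1)] g])
  moreover have "Ck_on k (\<lambda>x. frechet_derivative g (at x) v \<bullet> b) UNIV" for b v
    by (rule Ck_on_bounded_linear_compose[OF bounded_linear_inner_left Ck_on_SucD(2)[OF Suc.prems(2)]])
  ultimately have "Ck_on k (\<lambda>x. ?D x v) UNIV" for v
    by (intro Ck_on_sum Ck_on_bounded_bilinear[OF bounded_bilinear_scaleR])
  moreover have "((\<lambda>x. f (g x)) has_derivative ?D x) (at x)" for x
    using has_derivative_compose[OF Ck_on_SucD(1)[OF Suc.prems(2)] f, of x]
    by (simp add: D[abs_def])
  ultimately show ?case
    by (rule Ck_on_SucI[rotated])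
qed

lemma Ck_on_mult:
  fixes f g :: "_ \<Rightarrow> 'b::real_normed_algebra"
  shows "Ck_on k f UNIV \<Longrightarrow> Ck_on k g UNIV \<Longrightarrow> Ck_on k (\<lambda>x. f x * g x) UNIV"
  by (rule Ck_on_bounded_bilinear[OF bounded_bilinear_mult])

lemma Ck_on_diff:
  assumes "Ck_on k f UNIV" "Ck_on k g UNIV"
  shows "Ck_on k (\<lambda>x. f x - g x) UNIV"
  using Ck_on_add[OF assms(1) Ck_on_bounded_linear_compose[OF bounded_linear_minus[OF bounded_linear_ident] assms(2)]]
  by simp

lemma Ck_on_power:
  fixes f :: "_ \<Rightarrow> 'b::real_normed_algebra_1"
  shows "Ck_on k f UNIV \<Longrightarrow> Ck_on k (\<lambda>x. f x ^ n) UNIV"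
  by (induction n) (auto intro: Ck_on_const Ck_on_mult)

lemma Ck_on_divide:
  fixes f g :: "_ \<Rightarrow> 'b::real_normed_field"
  assumes "Ck_on k f UNIV" "Ck_on k g UNIV" "\<And>x. g x \<noteq> 0"
  shows "Ck_on k (\<lambda>x. f x / g x) UNIV"
  using assms by (simp add: divide_inverse Ck_on_mult Ck_on_inverse)

named_theorems smooth_intros

lemma smooth_on_const [smooth_intros]: "smooth_on UNIV (\<lambda>x. c)"
  by (simp add: smooth_on_def Ck_on_const)

lemma smooth_on_linear: "bounded_linear f \<Longrightarrow> smooth_on UNIV f"
  by (simp add: smooth_on_def Ck_on_bounded_linear)

lemma smooth_on_add [smooth_intros]:
  "smooth_on UNIV f \<Longrightarrow> smooth_on UNIV g \<Longrightarrow> smooth_on UNIV (\<lambda>x. f x + g x)"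
  by (simp add: smooth_on_def Ck_on_add)

lemma smooth_on_bounded_linear:
  "bounded_linear L \<Longrightarrow> smooth_on UNIV f \<Longrightarrow> smooth_on UNIV (\<lambda>x. L (f x))"
  by (simp add: smooth_on_def Ck_on_bounded_linear_compose)

lemmas smooth_on_minus [smooth_intros] =
  smooth_on_bounded_linear[OF bounded_linear_minus[OF bounded_linear_ident]]
lemmas smooth_on_of_real [smooth_intros] = smooth_on_bounded_linear[OF bounded_linear_of_real]

lemma smooth_on_diff [smooth_intros]:
  assumes "smooth_on UNIV f" "smooth_on UNIV g"
  shows "smooth_on UNIV (\<lambda>x. f x - g x)"
  using smooth_on_add[OF assms(1) smooth_on_minus[OF assms(2)]] by simp

lemma smooth_on_mult [smooth_intros]:
  fixes f g :: "_ \<Rightarrow> 'b::real_normed_algebra"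
  shows "smooth_on UNIV f \<Longrightarrow> smooth_on UNIV g \<Longrightarrow> smooth_on UNIV (\<lambda>x. f x * g x)"
  by (simp add: smooth_on_def Ck_on_bounded_bilinear[OF bounded_bilinear_mult])

lemma smooth_on_inner [smooth_intros]:
  "smooth_on UNIV f \<Longrightarrow> smooth_on UNIV g \<Longrightarrow> smooth_on UNIV (\<lambda>x. f x \<bullet> g x)"
  by (simp add: smooth_on_def Ck_on_bounded_bilinear[OF bounded_bilinear_inner])

lemma smooth_on_power [smooth_intros]:
  fixes f :: "_ \<Rightarrow> 'b::real_normed_algebra_1"
  shows "smooth_on UNIV f \<Longrightarrow> smooth_on UNIV (\<lambda>x. f x ^ n)"
  by (induction n) (auto intro: smooth_intros)

lemma smooth_on_sum [smooth_intros]: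
  "(\<And>i. i \<in> I \<Longrightarrow> smooth_on UNIV (f i)) \<Longrightarrow> smooth_on UNIV (\<lambda>x. \<Sum>i\<in>I. f i x)"
  by (simp add: smooth_on_def Ck_on_sum)

lemma smooth_on_divide [smooth_intros]:
  fixes f g :: "_ \<Rightarrow> 'b::real_normed_field"
  assumes "smooth_on UNIV f" "smooth_on UNIV g" "\<And>x. g x \<noteq> 0"
  shows "smooth_on UNIV (\<lambda>x. f x / g x)"
  using assms by (auto simp: smooth_on_def divide_inverse
      intro!: Ck_on_bounded_bilinear[OF bounded_bilinear_mult] Ck_on_inverse)

lemma smooth_on_compose:
  assumes "smooth_on UNIV f" "smooth_on UNIV g"
  shows "smooth_on UNIV (\<lambda>x. f (g x))"
  using assms by (simp add: smooth_on_def Ck_on_compose)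

lemma smooth_on_frechet [smooth_intros]:
  "smooth_on UNIV f \<Longrightarrow> smooth_on UNIV (\<lambda>x. frechet_derivative f (at x) v)"
  unfolding smooth_on_def using Ck_on_SucD(2) by blast

lemma smooth_on_has_derivative:
  "smooth_on UNIV f \<Longrightarrow> (f has_derivative frechet_derivative f (at x)) (at x)"
  unfolding smooth_on_def using Ck_on_SucD(1) by blast

lemma smooth_on_imp_Ck_on: "smooth_on S f \<Longrightarrow> Ck_on k f S"
  by (simp add: smooth_on_def)

lemma smooth_on_imp_continuous_on: "smooth_on UNIV f \<Longrightarrow> continuous_on S f"
  unfolding smooth_on_def using Ck_on.simps(1) continuous_on_subset by blast

lemma frechet_derivative_eqI:
  "(f has_derivative f') (at x) \<Longrightarrow> frechet_derivative f (at x) = f'"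
  using frechet_derivative_at by metis

lemma frechet_derivative_bounded_linear:
  assumes "bounded_linear L" "smooth_on UNIV f"
  shows "frechet_derivative (\<lambda>x. L (f x)) (at x) v = L (frechet_derivative f (at x) v)"
  using frechet_derivative_eqI[OF bounded_linear.has_derivative[OF assms(1)
        smooth_on_has_derivative[OF assms(2)]]] by simp

section \<open>Symmetry of second derivatives\<close>

lemma second_difference_mean_value:
  fixes f :: "'a::euclidean_space \<Rightarrow> real"
  assumes f: "smooth_on UNIV f" and h: "0 < h"
  obtains s t where "0 < s" "s < h" "0 < t" "t < h"
    "f (x + h *\<^sub>R v + h *\<^sub>R w) - f (x + h *\<^sub>R v) - f (x + h *\<^sub>R w) + f x =
      h * h * frechet_derivative (\<lambda>y. frechet_derivative f (at y) v) (at (x + s *\<^sub>R v + t *\<^sub>R w)) w"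
proof -
  let ?f = "\<lambda>y. frechet_derivative f (at y) v"
  have line: "((\<lambda>s. F (y + s *\<^sub>R e)) has_real_derivative frechet_derivative F (at (y + s *\<^sub>R e)) e) (at s)"
    if "smooth_on UNIV F" for F :: "'a \<Rightarrow> real" and y e s
  proof -
    have "((\<lambda>s. F (y + s *\<^sub>R e)) has_derivative (\<lambda>k. frechet_derivative F (at (y + s *\<^sub>R e)) (k *\<^sub>R e))) (at s)"
      by (rule has_derivative_compose[OF _ smooth_on_has_derivative[OF that]])
        (auto intro!: derivative_eq_intros)
    moreover have "frechet_derivative F (at (y + s *\<^sub>R e)) (k *\<^sub>R e) =
        frechet_derivative F (at (y + s *\<^sub>R e)) e * k" for k
      using has_derivative_linear[OF smooth_on_has_derivative[OF that]]
      by (simp add: linear_scale)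
    ultimately show ?thesis by (simp add: has_field_derivative_def)
  qed
  \<comment> \<open>Mean value theorem in the direction v for the w-increment of f; a second one, in
    the direction w, follows.\<close>
  have "\<exists>s. 0 < s \<and> s < h \<and>
      (f (x + h *\<^sub>R w + h *\<^sub>R v) - f (x + h *\<^sub>R v)) - (f (x + h *\<^sub>R w + 0 *\<^sub>R v) - f (x + 0 *\<^sub>R v)) =
      (h - 0) * (?f (x + h *\<^sub>R w + s *\<^sub>R v) - ?f (x + s *\<^sub>R v))"
    by (rule MVT2[OF h]) (intro DERIV_diff line[OF f])
  then obtain s where s: "0 < s" "s < h" and 1:
      "f (x + h *\<^sub>R w + h *\<^sub>R v) - f (x + h *\<^sub>R v) - (f (x + h *\<^sub>R w) - f x) =
       h * (?f (x + h *\<^sub>R w + s *\<^sub>R v) - ?f (x + s *\<^sub>R v))" by auto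
  have "\<exists>t. 0 < t \<and> t < h \<and> ?f (x + s *\<^sub>R v + h *\<^sub>R w) - ?f (x + s *\<^sub>R v + 0 *\<^sub>R w) =
      (h - 0) * frechet_derivative ?f (at (x + s *\<^sub>R v + t *\<^sub>R w)) w"
    by (rule MVT2[OF h]) (intro line smooth_on_frechet f)
  then obtain t where "0 < t" "t < h" and 2: "?f (x + s *\<^sub>R v + h *\<^sub>R w) - ?f (x + s *\<^sub>R v) =
      h * frechet_derivative ?f (at (x + s *\<^sub>R v + t *\<^sub>R w)) w" by auto
  then show thesis
    using s 1 by (intro that[of s t]) (auto simp: algebra_simps)
qed

text \<open>The second difference over the parallelogram spanned by h v and h w is symmetric in v
  and w, and it is h^2 times either mixed derivative at some nearby point. By continuity a small h
  contradicts unequal values at x.\<close>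

lemma second_derivative_symmetric_real:
  fixes f :: "'a::euclidean_space \<Rightarrow> real"
  assumes f: "smooth_on UNIV f"
  shows "frechet_derivative (\<lambda>y. frechet_derivative f (at y) v) (at x) w =
    frechet_derivative (\<lambda>y. frechet_derivative f (at y) w) (at x) v" (is "?A x = ?B x")
proof (rule ccontr)
  assume ne: "?A x \<noteq> ?B x"
  define e where "e = \<bar>?A x - ?B x\<bar> / 2"
  have e: "e > 0" using ne by (simp add: e_def)
  have cont: "continuous_on UNIV ?A" "continuous_on UNIV ?B"
    by (intro smooth_on_imp_continuous_on smooth_on_frechet f)+
  obtain d1 where d1: "d1 > 0" "\<And>y. dist y x < d1 \<Longrightarrow> dist (?A y) (?A x) < e"
    using cont(1) e unfolding continuous_on_iff by blast
  obtain d2 where d2: "d2 > 0" "\<And>y. dist y x < d2 \<Longrightarrow> dist (?B y) (?B x) < e"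
    using cont(2) e unfolding continuous_on_iff by blast
  define d where "d = min d1 d2"
  \<comment> \<open>Every point x + s a + t b with 0 < s, t < h and a, b the two vectors in either
    order lies within d of x; the summand 1 avoids a zero denominator.\<close>
  define h where "h = d / (2 * (norm v + norm w + 1))"
  have pos: "norm v + norm w + 1 > 0"
    using norm_ge_zero[of v] norm_ge_zero[of w] by linarith
  have h: "h > 0" using d1(1) d2(1) pos by (simp add: h_def d_def)
  have near: "dist (x + s *\<^sub>R a + t *\<^sub>R b) x < d"
    if "0 < s" "s < h" "0 < t" "t < h" "norm a + norm b = norm v + norm w" for s t a b
  proof -
    have "dist (x + s *\<^sub>R a + t *\<^sub>R b) x = norm (s *\<^sub>R a + t *\<^sub>R b)"
      by (simp add: dist_norm)
    also have "\<dots> \<le> s * norm a + t * norm b"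
      using norm_triangle_ineq[of "s *\<^sub>R a" "t *\<^sub>R b"] that by simp
    also have "\<dots> \<le> h * norm a + h * norm b"
      using that by (intro add_mono mult_right_mono) auto
    also have "\<dots> = h * (norm v + norm w)"
      by (metis that(5) distrib_left)
    also have "\<dots> < h * (2 * (norm v + norm w + 1))"
      using h pos by (intro mult_strict_left_mono) auto
    also have "\<dots> = d" using pos by (simp add: h_def)
    finally show ?thesis .
  qed
  obtain s t where 1: "0 < s" "s < h" "0 < t" "t < h"
    "f (x + h *\<^sub>R v + h *\<^sub>R w) - f (x + h *\<^sub>R v) - f (x + h *\<^sub>R w) + f x = h * h * ?A (x + s *\<^sub>R v + t *\<^sub>R w)"
    using second_difference_mean_value[OF f h] by blast
  obtain s' t' where 2: "0 < s'" "s' < h" "0 < t'" "t' < h"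
    "f (x + h *\<^sub>R w + h *\<^sub>R v) - f (x + h *\<^sub>R w) - f (x + h *\<^sub>R v) + f x = h * h * ?B (x + s' *\<^sub>R w + t' *\<^sub>R v)"
    using second_difference_mean_value[OF f h] by blast
  have "h * h * ?A (x + s *\<^sub>R v + t *\<^sub>R w) = h * h * ?B (x + s' *\<^sub>R w + t' *\<^sub>R v)"
    using 1(5) 2(5) by (simp add: algebra_simps)
  then have "?A (x + s *\<^sub>R v + t *\<^sub>R w) = ?B (x + s' *\<^sub>R w + t' *\<^sub>R v)"
    using h by simp
  moreover have "dist (?A (x + s *\<^sub>R v + t *\<^sub>R w)) (?A x) < e"
    using near[of s t v w] 1 by (intro d1) (auto simp: d_def)
  moreover have "dist (?B (x + s' *\<^sub>R w + t' *\<^sub>R v)) (?B x) < e"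
    using near[of s' t' w v] 2 by (intro d2) (auto simp: d_def)
  ultimately show False
    unfolding e_def dist_real_def by argo
qed

lemma second_derivative_symmetric:
  fixes f :: "'a::euclidean_space \<Rightarrow> 'b::euclidean_space"
  assumes f: "smooth_on UNIV f"
  shows "frechet_derivative (\<lambda>y. frechet_derivative f (at y) v) (at x) w =
    frechet_derivative (\<lambda>y. frechet_derivative f (at y) w) (at x) v"
proof (rule euclidean_eqI)
  fix b :: 'b
  have *: "frechet_derivative (\<lambda>y. frechet_derivative f (at y) v) (at x) w \<bullet> b =
    frechet_derivative (\<lambda>y. frechet_derivative (\<lambda>z. f z \<bullet> b) (at y) v) (at x) w" for v w
    by (simp add: frechet_derivative_bounded_linear[OF bounded_linear_inner_left] f smooth_on_frechet)
  show "frechet_derivative (\<lambda>y. frechet_derivative f (at y) v) (at x) w \<bullet> b =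
    frechet_derivative (\<lambda>y. frechet_derivative f (at y) w) (at x) v \<bullet> b"
    unfolding * by (intro second_derivative_symmetric_real smooth_intros f)
qed

section \<open>Periodic functions\<close>

text \<open>A dimension count, serving for lattice bases and for orthonormal frames alike.\<close>

lemma plane_lattice_span:
  assumes "independent {u, v :: real^2}" "u \<noteq> v"
  obtains \<alpha> \<beta> where "y = \<alpha> *\<^sub>R u + \<beta> *\<^sub>R v"
proof -
  have "card {u, v} = DIM(real^2)"
    using assms(2) by simp
  then have "span {u, v} = UNIV"
    using card_ge_dim_independent[of "{u, v}" UNIV] assms(1) by (auto simp: dim_UNIV)
  then have "y \<in> span {u, v}" by simp
  then obtain \<alpha> where "y - \<alpha> *\<^sub>R u \<in> span {v}"
    by (auto simp: span_breakdown_eq)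
  then obtain \<beta> where "y - \<alpha> *\<^sub>R u = \<beta> *\<^sub>R v"
    by (auto simp: span_singleton)
  then show thesis
    by (intro that[of \<alpha> \<beta>]) (simp add: algebra_simps)
qed

lemma periodic_attains_max:
  fixes f :: "real^2 \<Rightarrow> real"
  assumes "plane_lattice \<Gamma>" "periodic \<Gamma> f" "continuous_on UNIV f"
  obtains y\<^sub>0 where "\<And>y. f y \<le> f y\<^sub>0"
proof -
  obtain u v where uv: "u \<noteq> v" "independent {u, v}"
    and \<Gamma>: "\<Gamma> = {of_int m *\<^sub>R u + of_int n *\<^sub>R v | m n. True}"
    using assms(1) unfolding plane_lattice_def by blast
  define K where "K = (\<lambda>(\<alpha>, \<beta>). \<alpha> *\<^sub>R u + \<beta> *\<^sub>R v) ` ({0..1::real} \<times> {0..1::real})"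
  have "compact K"
    unfolding K_def case_prod_unfold
    by (intro compact_continuous_image compact_Times continuous_intros) auto
  moreover have "K \<noteq> {}" by (simp add: K_def)
  ultimately obtain y\<^sub>0 where y\<^sub>0: "\<And>y. y \<in> K \<Longrightarrow> f y \<le> f y\<^sub>0"
    using continuous_attains_sup[of K f] continuous_on_subset[OF assms(3)] by blast
  have "f y \<le> f y\<^sub>0" for y
  proof -
    obtain \<alpha> \<beta> where y: "y = \<alpha> *\<^sub>R u + \<beta> *\<^sub>R v"
      using plane_lattice_span[OF uv(2,1)] by blast
    \<comment> \<open>The fractional parts lie in the compact cell; the floors form the lattice
      vector that is removed.\<close>
    define k where "k = frac \<alpha> *\<^sub>R u + frac \<beta> *\<^sub>R v"
    have "k \<in> K"
      unfolding K_def k_def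
      by (rule image_eqI[of _ _ "(frac \<alpha>, frac \<beta>)"]) (auto simp: frac_lt_1 less_imp_le)
    moreover have "y = k + (of_int \<lfloor>\<alpha>\<rfloor> *\<^sub>R u + of_int \<lfloor>\<beta>\<rfloor> *\<^sub>R v)"
      by (simp add: y k_def frac_def algebra_simps)
    then have "f y = f k"
      using assms(2) unfolding periodic_def \<Gamma> by blast
    ultimately show ?thesis using y\<^sub>0 by simp
  qed
  then show thesis by (rule that)
qed

lemma continuous_nonzero_same_sign:
  fixes f :: "'a::real_normed_vector \<Rightarrow> real"
  assumes "continuous_on UNIV f" "\<And>x. f x \<noteq> 0"
  shows "(\<forall>x. f x > 0) \<or> (\<forall>x. f x < 0)"
proof (rule ccontr)
  assume "\<not> ?thesis"
  then obtain x y where "f x \<le> 0" "f y \<ge> 0" by (auto simp: not_less)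
  moreover have "connected (range f)"
    using assms(1) by (intro connected_continuous_image) auto
  ultimately have "0 \<in> range f"
    by (meson connected_iff_interval rangeI)
  then show False using assms(2) by (metis rangeE)
qed

section \<open>The Jacobian of a periodic map has mean zero\<close>

lemma d_t_has_vector_derivative:
  assumes "smooth_on UNIV f"
  shows "((\<lambda>\<sigma>. f (\<sigma>, \<tau>)) has_vector_derivative d_t f (\<sigma>, \<tau>)) (at \<sigma> within S)"
proof -
  have "((\<lambda>\<sigma>. f (\<sigma>, \<tau>)) has_derivative (\<lambda>k. frechet_derivative f (at (\<sigma>, \<tau>)) (k, 0))) (at \<sigma> within S)"
    by (rule has_derivative_compose[OF _ smooth_on_has_derivative[OF assms]])
      (auto intro!: derivative_eq_intros)
  moreover have "(\<lambda>k. frechet_derivative f (at (\<sigma>, \<tau>)) (k, 0)) =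
      (\<lambda>k. k *\<^sub>R frechet_derivative f (at (\<sigma>, \<tau>)) (1, 0))"
    by (simp add: linear_scale[OF has_derivative_linear[OF smooth_on_has_derivative[OF assms]], symmetric])
  ultimately show ?thesis
    unfolding has_vector_derivative_def d_t_def by (simp only:)
qed

lemma d_x_has_vector_derivative:
  assumes "smooth_on UNIV f"
  shows "((\<lambda>\<tau>. f (\<sigma>, \<tau>)) has_vector_derivative d_x f (\<sigma>, \<tau>)) (at \<tau> within S)"
proof -
  have "((\<lambda>\<tau>. f (\<sigma>, \<tau>)) has_derivative (\<lambda>k. frechet_derivative f (at (\<sigma>, \<tau>)) (0, k))) (at \<tau> within S)"
    by (rule has_derivative_compose[OF _ smooth_on_has_derivative[OF assms]])
      (auto intro!: derivative_eq_intros)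
  moreover have "(\<lambda>k. frechet_derivative f (at (\<sigma>, \<tau>)) (0, k)) =
      (\<lambda>k. k *\<^sub>R frechet_derivative f (at (\<sigma>, \<tau>)) (0, 1))"
    by (simp add: linear_scale[OF has_derivative_linear[OF smooth_on_has_derivative[OF assms]], symmetric])
  ultimately show ?thesis
    unfolding has_vector_derivative_def d_x_def by (simp only:)
qed

lemma smooth_on_d_t [smooth_intros]: "smooth_on UNIV f \<Longrightarrow> smooth_on UNIV (d_t f)"
  unfolding d_t_def[abs_def] by (rule smooth_on_frechet)

lemma smooth_on_d_x [smooth_intros]: "smooth_on UNIV f \<Longrightarrow> smooth_on UNIV (d_x f)"
  unfolding d_x_def[abs_def] by (rule smooth_on_frechet)

lemma d_t_d_x_commute:
  fixes f :: "real \<times> real \<Rightarrow> 'b::euclidean_space"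
  assumes "smooth_on UNIV f"
  shows "d_t (d_x f) z = d_x (d_t f) z"
  unfolding d_t_def[abs_def] d_x_def[abs_def] by (rule second_derivative_symmetric[OF assms])

text \<open>The form du \<and> dv is d(u dv). One-dimensional integrals suffice: the integral
  I(\<tau>) of u v_\<sigma> over a period in \<sigma> has as derivative minus the integral of the
  Jacobian, so I is monotone. Being periodic, it is constant, and a continuous nonnegative function
  with integral zero vanishes.\<close>

lemma periodic_Jacobian_zero_real:
  fixes u v :: "real \<times> real \<Rightarrow> real"
  assumes u: "smooth_on UNIV u" and v: "smooth_on UNIV v"
    and pu: "\<And>\<sigma> \<tau>. u (\<sigma> + 1, \<tau>) = u (\<sigma>, \<tau>)" "\<And>\<sigma> \<tau>. u (\<sigma>, \<tau> + 1) = u (\<sigma>, \<tau>)"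
    and pv: "\<And>\<sigma> \<tau>. v (\<sigma> + 1, \<tau>) = v (\<sigma>, \<tau>)" "\<And>\<sigma> \<tau>. v (\<sigma>, \<tau> + 1) = v (\<sigma>, \<tau>)"
    and nonneg: "\<And>z. 0 \<le> d_t u z * d_x v z - d_x u z * d_t v z"
  shows "d_t u z * d_x v z - d_x u z * d_t v z = 0"
proof -
  obtain c \<tau>\<^sub>0 where z: "z = (c, \<tau>\<^sub>0)" by fastforce
  let ?J = "\<lambda>z. d_t u z * d_x v z - d_x u z * d_t v z"
  \<comment> \<open>The period interval starts at the first coordinate c of z, so that z itself is
    reached at the end.\<close>
  define I where "I \<tau> = integral {c..c+1} (\<lambda>\<sigma>. u (\<sigma>, \<tau>) * d_t v (\<sigma>, \<tau>))" for \<tau>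
  have cont: "continuous_on S (\<lambda>\<sigma>. f (\<sigma>, \<tau>))" if "smooth_on UNIV f" for f :: "real \<times> real \<Rightarrow> real" and S \<tau>
    by (rule continuous_on_compose2[OF smooth_on_imp_continuous_on[OF that, of UNIV]])
      (auto intro: continuous_intros)
  have pdv: "d_x v (\<sigma> + 1, \<tau>) = d_x v (\<sigma>, \<tau>)" "d_t v (\<sigma>, \<tau> + 1) = d_t v (\<sigma>, \<tau>)" for \<sigma> \<tau>
  proof -
    have "((\<lambda>\<tau>. v (\<sigma>, \<tau>)) has_vector_derivative d_x v (\<sigma> + 1, \<tau>)) (at \<tau>)"
      using d_x_has_vector_derivative[OF v, of "\<sigma> + 1"] by (simp add: pv)
    then show "d_x v (\<sigma> + 1, \<tau>) = d_x v (\<sigma>, \<tau>)"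
      using d_x_has_vector_derivative[OF v] vector_derivative_unique_at by blast
    have "((\<lambda>\<sigma>. v (\<sigma>, \<tau>)) has_vector_derivative d_t v (\<sigma>, \<tau> + 1)) (at \<sigma>)"
      using d_t_has_vector_derivative[OF v, of "\<tau> + 1"] by (simp add: pv)
    then show "d_t v (\<sigma>, \<tau> + 1) = d_t v (\<sigma>, \<tau>)"
      using d_t_has_vector_derivative[OF v] vector_derivative_unique_at by blast
  qed
  have parts: "integral {c..c+1} (\<lambda>\<sigma>. u (\<sigma>, \<tau>) * d_x (d_t v) (\<sigma>, \<tau>)) =
      - integral {c..c+1} (\<lambda>\<sigma>. d_t u (\<sigma>, \<tau>) * d_x v (\<sigma>, \<tau>))" for \<tau>
  proof -
    have "((\<lambda>\<sigma>. u (\<sigma>, \<tau>) * d_t (d_x v) (\<sigma>, \<tau>) + d_t u (\<sigma>, \<tau>) * d_x v (\<sigma>, \<tau>)) has_integral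
        u (c + 1, \<tau>) * d_x v (c + 1, \<tau>) - u (c, \<tau>) * d_x v (c, \<tau>)) {c..c+1}"
      by (intro fundamental_theorem_of_calculus has_vector_derivative_mult d_t_has_vector_derivative
          smooth_intros u v) auto
    then have "integral {c..c+1} (\<lambda>\<sigma>. u (\<sigma>, \<tau>) * d_t (d_x v) (\<sigma>, \<tau>) + d_t u (\<sigma>, \<tau>) * d_x v (\<sigma>, \<tau>)) = 0"
      by (simp add: pu pdv integral_unique)
    moreover have "(\<lambda>\<sigma>. u (\<sigma>, \<tau>) * d_t (d_x v) (\<sigma>, \<tau>)) integrable_on {c..c+1}"
      "(\<lambda>\<sigma>. d_t u (\<sigma>, \<tau>) * d_x v (\<sigma>, \<tau>)) integrable_on {c..c+1}"
      by (intro integrable_continuous_real continuous_on_mult cont smooth_intros u v)+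
    ultimately show ?thesis
      by (simp add: integral_add d_t_d_x_commute[OF v] eq_neg_iff_add_eq_0)
  qed
  have I': "(I has_real_derivative - integral {c..c+1} (\<lambda>\<sigma>. ?J (\<sigma>, \<tau>))) (at \<tau>)" for \<tau>
  proof -
    have "((\<lambda>\<tau>. integral (cbox c (c+1)) (\<lambda>\<sigma>. u (\<sigma>, \<tau>) * d_t v (\<sigma>, \<tau>))) has_vector_derivative
        integral (cbox c (c+1)) (\<lambda>\<sigma>. u (\<sigma>, \<tau>) * d_x (d_t v) (\<sigma>, \<tau>) + d_x u (\<sigma>, \<tau>) * d_t v (\<sigma>, \<tau>))) (at \<tau> within UNIV)"
    proof (rule leibniz_rule_vector_derivative)
      show "((\<lambda>\<tau>. u (\<sigma>, \<tau>) * d_t v (\<sigma>, \<tau>)) has_vector_derivative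
          u (\<sigma>, \<tau>) * d_x (d_t v) (\<sigma>, \<tau>) + d_x u (\<sigma>, \<tau>) * d_t v (\<sigma>, \<tau>)) (at \<tau> within UNIV)" for \<sigma> \<tau>
        by (intro has_vector_derivative_mult d_x_has_vector_derivative smooth_intros u v)
      show "(\<lambda>\<sigma>. u (\<sigma>, \<tau>) * d_t v (\<sigma>, \<tau>)) integrable_on cbox c (c + 1)" for \<tau>
        unfolding box_real by (intro integrable_continuous_real continuous_on_mult cont smooth_intros u v)
      have "continuous_on (UNIV \<times> cbox c (c+1)) ((\<lambda>z. u z * d_x (d_t v) z + d_x u z * d_t v z) \<circ> prod.swap)"
        by (intro continuous_on_compose continuous_on_swap smooth_on_imp_continuous_on smooth_intros u v)
      then show "continuous_on (UNIV \<times> cbox c (c+1))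
          (\<lambda>(\<tau>, \<sigma>). u (\<sigma>, \<tau>) * d_x (d_t v) (\<sigma>, \<tau>) + d_x u (\<sigma>, \<tau>) * d_t v (\<sigma>, \<tau>))"
        by (simp add: o_def case_prod_unfold prod.swap_def)
    qed auto
    moreover have "integral {c..c+1} (\<lambda>\<sigma>. u (\<sigma>, \<tau>) * d_x (d_t v) (\<sigma>, \<tau>) + d_x u (\<sigma>, \<tau>) * d_t v (\<sigma>, \<tau>)) =
        integral {c..c+1} (\<lambda>\<sigma>. u (\<sigma>, \<tau>) * d_x (d_t v) (\<sigma>, \<tau>)) + integral {c..c+1} (\<lambda>\<sigma>. d_x u (\<sigma>, \<tau>) * d_t v (\<sigma>, \<tau>))"
      by (intro integral_add integrable_continuous_real continuous_on_mult cont smooth_intros u v)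
    moreover have "integral {c..c+1} (\<lambda>\<sigma>. ?J (\<sigma>, \<tau>)) =
        integral {c..c+1} (\<lambda>\<sigma>. d_t u (\<sigma>, \<tau>) * d_x v (\<sigma>, \<tau>)) - integral {c..c+1} (\<lambda>\<sigma>. d_x u (\<sigma>, \<tau>) * d_t v (\<sigma>, \<tau>))"
      by (intro integral_diff integrable_continuous_real continuous_on_mult cont smooth_intros u v)
    ultimately show ?thesis
      by (simp add: parts I_def[abs_def] has_real_derivative_iff_has_vector_derivative)
  qed
  have mono: "I t \<le> I s" if "s \<le> t" for s t
  proof (rule DERIV_nonpos_imp_nonincreasing[OF that])
    fix \<tau>
    have "integral {c..c+1} (\<lambda>\<sigma>. ?J (\<sigma>, \<tau>)) \<ge> 0"
      by (intro integral_nonneg nonneg integrable_continuous_real continuous_on_mult continuous_on_diff cont smooth_intros u v)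
    then show "\<exists>y. (I has_real_derivative y) (at \<tau>) \<and> y \<le> 0"
      by (intro exI[of _ "- integral {c..c+1} (\<lambda>\<sigma>. ?J (\<sigma>, \<tau>))"] conjI I') simp
  qed
  have per: "I (\<tau> + 1) = I \<tau>" for \<tau>
    by (simp add: I_def pu pdv)
  \<comment> \<open>Monotonicity and the period 1 squeeze I to a constant near this point, which
    kills its derivative there.\<close>
  have "I \<tau>\<^sub>0 = I y" if "\<bar>\<tau>\<^sub>0 - y\<bar> < 1" for y
    using mono[of \<tau>\<^sub>0 y] mono[of y \<tau>\<^sub>0] mono[of y "\<tau>\<^sub>0 + 1"] mono[of "\<tau>\<^sub>0" "y + 1"] per[of \<tau>\<^sub>0] per[of y] that
    by (cases "y \<le> \<tau>\<^sub>0") auto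
  then have "- integral {c..c+1} (\<lambda>\<sigma>. ?J (\<sigma>, \<tau>\<^sub>0)) = 0"
    by (intro DERIV_local_const[OF I' zero_less_one]) auto
  then have "integral {c..c+1} (\<lambda>\<sigma>. ?J (\<sigma>, \<tau>\<^sub>0)) = 0" by simp
  moreover have "continuous_on {c..c+1} (\<lambda>\<sigma>. ?J (\<sigma>, \<tau>\<^sub>0))"
    by (intro continuous_on_mult continuous_on_diff cont smooth_intros u v)
  ultimately have "\<forall>\<sigma>\<in>{c..c+1}. ?J (\<sigma>, \<tau>\<^sub>0) = 0"
    using integral_eq_0_iff[of c "c+1" "\<lambda>\<sigma>. ?J (\<sigma>, \<tau>\<^sub>0)"] nonneg by auto
  then show ?thesis by (simp add: z)
qed

lemma Re_Im_d:
  assumes "smooth_on UNIV r"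
  shows "d_t (\<lambda>z. Re (r z)) z = Re (d_t r z)" "d_t (\<lambda>z. Im (r z)) z = Im (d_t r z)"
    "d_x (\<lambda>z. Re (r z)) z = Re (d_x r z)" "d_x (\<lambda>z. Im (r z)) z = Im (d_x r z)"
  by (simp_all add: d_t_def d_x_def assms
      frechet_derivative_bounded_linear[OF bounded_linear_Re] frechet_derivative_bounded_linear[OF bounded_linear_Im])

text \<open>Im (cnj r_t * r_x) is the Jacobian of (Re r, Im r); exchanging the two parts reverses
  its sign, which covers the nonpositive case.\<close>

lemma periodic_Jacobian_zero:
  fixes r :: "real \<times> real \<Rightarrow> complex"
  assumes r: "smooth_on UNIV r"
    and per: "\<And>\<sigma> \<tau>. r (\<sigma> + 1, \<tau>) = r (\<sigma>, \<tau>)" "\<And>\<sigma> \<tau>. r (\<sigma>, \<tau> + 1) = r (\<sigma>, \<tau>)"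
    and sign: "(\<forall>z. 0 \<le> Im (cnj (d_t r z) * d_x r z)) \<or> (\<forall>z. Im (cnj (d_t r z) * d_x r z) \<le> 0)"
  shows "Im (cnj (d_t r z) * d_x r z) = 0"
proof -
  have u: "smooth_on UNIV (\<lambda>z. Re (r z))" and v: "smooth_on UNIV (\<lambda>z. Im (r z))"
    by (intro smooth_on_bounded_linear[OF bounded_linear_Re] smooth_on_bounded_linear[OF bounded_linear_Im] r)+
  from sign show ?thesis
  proof
    assume "\<forall>z. 0 \<le> Im (cnj (d_t r z) * d_x r z)"
    then have *: "0 \<le> Im (cnj (d_t r z) * d_x r z)" for z by blast
    have "d_t (\<lambda>z. Re (r z)) z * d_x (\<lambda>z. Im (r z)) z - d_x (\<lambda>z. Re (r z)) z * d_t (\<lambda>z. Im (r z)) z = 0"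
      by (rule periodic_Jacobian_zero_real[OF u v]) (use * in \<open>simp_all add: per Re_Im_d[OF r] mult.commute algebra_simps\<close>)
    then show ?thesis by (simp add: Re_Im_d[OF r] algebra_simps)
  next
    assume "\<forall>z. Im (cnj (d_t r z) * d_x r z) \<le> 0"
    then have *: "Im (cnj (d_t r z) * d_x r z) \<le> 0" for z by blast
    have "d_t (\<lambda>z. Im (r z)) z * d_x (\<lambda>z. Re (r z)) z - d_x (\<lambda>z. Im (r z)) z * d_t (\<lambda>z. Re (r z)) z = 0"
      by (rule periodic_Jacobian_zero_real[OF v u]) (use * in \<open>simp_all add: per Re_Im_d[OF r] mult.commute algebra_simps\<close>)
    then show ?thesis by (simp add: Re_Im_d[OF r] algebra_simps)
  qed
qed

section \<open>The fibre quartic and its critical points\<close>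

text \<open>
  \<open>F_lin\<close> and \<open>G_lin\<close> are the parts of \<open>F_hat\<close> and \<open>G_hat\<close> linear in the field variables; as \<open>a\<^sub>4 = 1\<close>
  is fixed, they are also their variations. Primes denote derivatives in \<open>s\<close>.
\<close>

definition F_lin :: "complex^4 \<Rightarrow> complex \<Rightarrow> complex" where
  "F_lin W s = W $ 0 + W $ 1 * s + W $ 2 * s ^ 2 + W $ 3 * s ^ 3"

definition F_lin' :: "complex^4 \<Rightarrow> complex \<Rightarrow> complex" where
  "F_lin' W s = W $ 1 + 2 * W $ 2 * s + 3 * W $ 3 * s ^ 2"

definition G_lin :: "complex^4 \<Rightarrow> complex \<Rightarrow> complex" where
  "G_lin W s = (1 + s\<^sup>2) * F_lin' W s - 4 * s * F_lin W s"

definition G_lin' :: "complex^4 \<Rightarrow> complex \<Rightarrow> complex" where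
  "G_lin' W s = - 4 * W $ 3 * s ^ 3 - 6 * W $ 2 * s ^ 2 + 6 * (W $ 3 - W $ 1) * s + (2 * W $ 2 - 4 * W $ 0)"

definition G_hat' :: "complex^4 \<Rightarrow> complex \<Rightarrow> complex" where
  "G_hat' U s = G_lin' U s + 12 * s ^ 2"

definition G_hat'' :: "complex^4 \<Rightarrow> complex \<Rightarrow> complex" where
  "G_hat'' U s = - 12 * U $ 3 * s ^ 2 - 12 * U $ 2 * s + 6 * (U $ 3 - U $ 1) + 24 * s"

lemma sum_atMost_4: "(\<Sum>k\<le>4. f k) = f 0 + f 1 + f 2 + f 3 + f (4::nat)"
  by (simp add: eval_nat_numeral)

lemma coefficient_simps [simp]:
  "coefficient U 0 = U $ 0" "coefficient U (Suc 0) = U $ 1" "coefficient U 2 = U $ 2"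
  "coefficient U 3 = U $ 3" "coefficient U 4 = 1"
  by (simp_all add: coefficient_def)

lemma fibre_quartic_eq:
  "fibre_quartic U q p = U $ 0 * q ^ 4 + U $ 1 * q ^ 3 * p + U $ 2 * q ^ 2 * p ^ 2 + U $ 3 * q * p ^ 3 + p ^ 4"
  by (simp add: fibre_quartic_def sum_atMost_4)

lemma fibre_derivative_eq:
  "fibre_derivative U q p =
    - p * (4 * U $ 0 * q ^ 3 + 3 * U $ 1 * q ^ 2 * p + 2 * U $ 2 * q * p ^ 2 + U $ 3 * p ^ 3) +
    q * (U $ 1 * q ^ 3 + 2 * U $ 2 * q ^ 2 * p + 3 * U $ 3 * q * p ^ 2 + 4 * p ^ 3)"
proof -
  have "((\<lambda>q. fibre_quartic U q p) has_field_derivative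
      4 * U $ 0 * q ^ 3 + 3 * U $ 1 * q ^ 2 * p + 2 * U $ 2 * q * p ^ 2 + U $ 3 * p ^ 3) (at q)"
    unfolding fibre_quartic_eq by (auto intro!: derivative_eq_intros)
  moreover have "((\<lambda>p. fibre_quartic U q p) has_field_derivative
      U $ 1 * q ^ 3 + 2 * U $ 2 * q ^ 2 * p + 3 * U $ 3 * q * p ^ 2 + 4 * p ^ 3) (at p)"
    unfolding fibre_quartic_eq by (auto intro!: derivative_eq_intros)
  ultimately show ?thesis
    by (simp add: fibre_derivative_def DERIV_imp_deriv)
qed

lemma F_hat_eq: "F_hat U s = F_lin U s + s ^ 4"
  by (simp add: F_hat_def F_lin_def sum_atMost_4)

lemma G_hat_eq: "G_hat U s = G_lin U s + 4 * s ^ 3"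
  by (simp add: G_hat_def fibre_derivative_eq G_lin_def F_lin_def F_lin'_def algebra_simps power2_eq_square power3_eq_cube power4_eq_xxxx)

lemma G_hat_expand:
  "G_hat U s = - U $ 3 * s ^ 4 + (4 - 2 * U $ 2) * s ^ 3 + 3 * (U $ 3 - U $ 1) * s ^ 2 + (2 * U $ 2 - 4 * U $ 0) * s + U $ 1"
  by (simp add: G_hat_eq G_lin_def F_lin_def F_lin'_def algebra_simps power2_eq_square power3_eq_cube power4_eq_xxxx)

lemma DERIV_G_hat: "(G_hat U has_field_derivative G_hat' U s) (at s)"
  unfolding G_hat_expand[abs_def] G_hat'_def G_lin'_def
  by (auto intro!: derivative_eq_intros simp: algebra_simps)

text \<open>A cubic with more roots than its degree allows. Every comparison at the four roots rests
  on it: Vieta's formulas, injectivity of the differential of the Riemann map, and constancy of the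
  coefficients.\<close>

lemma cubic_zero:
  fixes c :: "nat \<Rightarrow> 'a::idom"
  assumes "card S = 4" "\<And>\<zeta>. \<zeta> \<in> S \<Longrightarrow> c 0 + c 1 * \<zeta> + c 2 * \<zeta> ^ 2 + c 3 * \<zeta> ^ 3 = 0"
  shows "c 0 = 0 \<and> c 1 = 0 \<and> c 2 = 0 \<and> c 3 = 0"
proof -
  let ?p = "[:c 0, c 1, c 2, c 3:]"
  have "?p = 0"
  proof (rule ccontr)
    assume "?p \<noteq> 0"
    then have "card {\<zeta>. poly ?p \<zeta> = 0} \<le> degree ?p" "finite {\<zeta>. poly ?p \<zeta> = 0}"
      using card_poly_roots_bound poly_roots_finite by blast+
    moreover have "S \<subseteq> {\<zeta>. poly ?p \<zeta> = 0}"
      using assms(2) by (auto simp: power2_eq_square power3_eq_cube algebra_simps)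
    ultimately have "card S \<le> degree ?p"
      using card_mono by (meson le_trans)
    moreover have "degree ?p \<le> 3" by simp
    ultimately show False using assms(1) by simp
  qed
  then show ?thesis by simp
qed

lemma F_lin_eq_zero_imp:
  assumes "card S = 4" "\<And>\<zeta>. \<zeta> \<in> S \<Longrightarrow> F_lin W \<zeta> = 0"
  shows "W = 0"
proof -
  have "W $ of_nat 0 = 0 \<and> W $ of_nat 1 = 0 \<and> W $ of_nat 2 = 0 \<and> W $ of_nat 3 = 0"
    by (rule cubic_zero[OF assms(1)]) (use assms(2) in \<open>simp add: F_lin_def\<close>)
  moreover have "W $ 4 = W $ 0" by (rule arg_cong[of _ _ "($) W"]) simp
  ultimately show ?thesis
    by (simp add: vec_eq_iff forall_4)
qed

lemma distinct_roots_card: "distinct_roots U s \<Longrightarrow> card (range (($) s)) = 4"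
  using card_image[of "($) s" UNIV] unfolding distinct_roots_def by (simp del: card_image)

lemma distinct_roots_range: "range (($) (s :: 'a^4)) = {s $ 1, s $ 2, s $ 3, s $ 4}"
  by (auto simp: UNIV_4)

lemma distinct_roots_neq:
  "distinct_roots U s \<Longrightarrow> i \<noteq> j \<Longrightarrow> s $ i \<noteq> s $ j"
  by (auto simp: distinct_roots_def inj_on_def)

lemma distinct_roots_G_hat:
  "distinct_roots U s \<Longrightarrow> G_hat U \<zeta> = 0 \<longleftrightarrow> \<zeta> = s $ 1 \<or> \<zeta> = s $ 2 \<or> \<zeta> = s $ 3 \<or> \<zeta> = s $ 4"
  using distinct_roots_range[of s] by (auto simp: distinct_roots_def)

lemma distinct_roots_root: "distinct_roots U s \<Longrightarrow> G_hat U (s $ i) = 0"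
  unfolding distinct_roots_def by blast

text \<open>G_hat plus U_3 times the product of the linear factors has no quartic term and vanishes
  at four points. There is no division by U_3, because \<open>distinct_roots_U3\<close> is itself
  deduced from this factorization.\<close>

lemma Vieta:
  assumes "distinct_roots U s" and "{a, b, c, d} = range (($) s)"
  shows "4 - 2 * U $ 2 = U $ 3 * (a + b + c + d)"
    "3 * (U $ 3 - U $ 1) = - U $ 3 * (a * b + a * c + a * d + b * c + b * d + c * d)"
    "2 * U $ 2 - 4 * U $ 0 = U $ 3 * (a * b * c + a * b * d + a * c * d + b * c * d)"
    "U $ 1 = - U $ 3 * (a * b * c * d)"
proof -
  define k where "k n = (if n = 0 then U $ 1 + U $ 3 * (a * b * c * d)
    else if n = 1 then 2 * U $ 2 - 4 * U $ 0 - U $ 3 * (a * b * c + a * b * d + a * c * d + b * c * d)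
    else if n = 2 then 3 * (U $ 3 - U $ 1) + U $ 3 * (a * b + a * c + a * d + b * c + b * d + c * d)
    else 4 - 2 * U $ 2 - U $ 3 * (a + b + c + d))" for n :: nat
  have split: "k 0 + k 1 * \<zeta> + k 2 * \<zeta> ^ 2 + k 3 * \<zeta> ^ 3 =
      G_hat U \<zeta> + U $ 3 * ((\<zeta> - a) * (\<zeta> - b) * (\<zeta> - c) * (\<zeta> - d))" for \<zeta>
    by (simp add: k_def G_hat_expand) algebra
  have "k 0 = 0 \<and> k 1 = 0 \<and> k 2 = 0 \<and> k 3 = 0"
  proof (rule cubic_zero[OF distinct_roots_card[OF assms(1)]])
    fix \<zeta> assume \<zeta>: "\<zeta> \<in> range (($) s)"
    then have "\<zeta> \<in> {a, b, c, d}" using assms(2) by simp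
    moreover have "G_hat U \<zeta> = 0" using \<zeta> assms(1) by (auto simp: distinct_roots_def)
    ultimately show "k 0 + k 1 * \<zeta> + k 2 * \<zeta> ^ 2 + k 3 * \<zeta> ^ 3 = 0"
      unfolding split by auto
  qed
  then show "4 - 2 * U $ 2 = U $ 3 * (a + b + c + d)"
    "3 * (U $ 3 - U $ 1) = - U $ 3 * (a * b + a * c + a * d + b * c + b * d + c * d)"
    "2 * U $ 2 - 4 * U $ 0 = U $ 3 * (a * b * c + a * b * d + a * c * d + b * c * d)"
    "U $ 1 = - U $ 3 * (a * b * c * d)"
    by (simp_all add: k_def eq_neg_iff_add_eq_0)
qed

lemma G_hat_factor:
  assumes "distinct_roots U s" and "{a, b, c, d} = range (($) s)"
  shows "G_hat U \<zeta> = - U $ 3 * ((\<zeta> - a) * (\<zeta> - b) * (\<zeta> - c) * (\<zeta> - d))"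
  using Vieta[OF assms] unfolding G_hat_expand by algebra

text \<open>In the second formula 1 + a^2 = (1 + a b) + a (a - b), and likewise for c and d; the
  three second summands cancel against - 6 a G'. Divided by the differences of roots, the rest is
  the sum of (1 + a b)/(a - b) over the other roots, that is, of their slopes once a is rotated to
  infinity.\<close>

lemma G_hat'_root:
  assumes "distinct_roots U s" and "{a, b, c, d} = range (($) s)"
  shows "G_hat' U a = - U $ 3 * ((a - b) * (a - c) * (a - d))"
    and "(1 + a\<^sup>2) * G_hat'' U a - 6 * a * G_hat' U a =
      - 2 * U $ 3 * ((1 + a * b) * (a - c) * (a - d) + (1 + a * c) * (a - b) * (a - d) + (1 + a * d) * (a - b) * (a - c))"
proof -
  have 1: "G_hat' U a = - 4 * U $ 3 * a ^ 3 + 3 * (4 - 2 * U $ 2) * a ^ 2 + 2 * (3 * (U $ 3 - U $ 1)) * a + (2 * U $ 2 - 4 * U $ 0)"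
    unfolding G_hat'_def G_lin'_def by algebra
  show "G_hat' U a = - U $ 3 * ((a - b) * (a - c) * (a - d))"
    unfolding 1 Vieta(1-3)[OF assms] by algebra
  have 2: "G_hat'' U a = - 12 * U $ 3 * a ^ 2 + 6 * (4 - 2 * U $ 2) * a + 2 * (3 * (U $ 3 - U $ 1))"
    unfolding G_hat''_def by algebra
  show "(1 + a\<^sup>2) * G_hat'' U a - 6 * a * G_hat' U a =
      - 2 * U $ 3 * ((1 + a * b) * (a - c) * (a - d) + (1 + a * c) * (a - b) * (a - d) + (1 + a * d) * (a - b) * (a - c))"
    unfolding 1 2 Vieta(1-3)[OF assms] by algebra
qed

lemma distinct_roots_U3: "distinct_roots U s \<Longrightarrow> U $ 3 \<noteq> 0"
proof
  assume s: "distinct_roots U s" and "U $ 3 = 0"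
  then have "G_hat U \<zeta> = 0" for \<zeta>
    by (subst G_hat_factor[OF s distinct_roots_range[symmetric]]) simp
  then have "range (($) s) = UNIV" using s by (auto simp: distinct_roots_def)
  moreover have "finite (range (($) s))" by simp
  ultimately show False by (metis infinite_UNIV_char_0)
qed

lemma G_hat'_nonzero:
  assumes "distinct_roots U s"
  shows "G_hat' U (s $ i) \<noteq> 0"
proof -
  have *: "G_hat' U a \<noteq> 0" if "{a, b, c, d} = range (($) s)" for a b c d
  proof -
    have "card {a, b, c, d} = 4" using distinct_roots_card[OF assms] that by simp
    then have "a \<noteq> b \<and> a \<noteq> c \<and> a \<noteq> d"
      by (auto simp: card_insert_if split: if_splits)
    then show ?thesis
      using G_hat'_root(1)[OF assms that] distinct_roots_U3[OF assms] by simp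
  qed
  have "i = 1 \<or> i = 2 \<or> i = 3 \<or> i = 4" by (rule exhaust_4)
  then show ?thesis
    using *[of "s $ 1" "s $ 2" "s $ 3" "s $ 4"] *[of "s $ 2" "s $ 1" "s $ 3" "s $ 4"]
      *[of "s $ 3" "s $ 1" "s $ 2" "s $ 4"] *[of "s $ 4" "s $ 1" "s $ 2" "s $ 3"]
    unfolding distinct_roots_range by (metis insert_commute)
qed

text \<open>
  The fibre is rotated so that the direction \<open>(1, a)\<close> becomes an axis; there \<open>n / d\<close> is the slope.
  A critical point in the direction of each axis kills the odd coefficients of the quartic.
\<close>

lemma F_hat_along_rotation:
  "(1 + a\<^sup>2) ^ 4 * F_hat U \<zeta> = fibre_quartic U ((1 + a * \<zeta>) + (a - \<zeta>) * a) ((1 + a * \<zeta>) * a - (a - \<zeta>))"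
  unfolding F_hat_eq F_lin_def fibre_quartic_eq by algebra

lemma fibre_quartic_even:
  assumes "G_hat U a = 0" "G_hat U b = 0" "1 + a * b = 0"
  shows "fibre_quartic U (n - d * a) (n * a + d) = fibre_quartic U (n + d * a) (n * a - d)"
proof -
  \<comment> \<open>The odd coefficients are values of G in the two axis directions: b = -1/a is the
    slope orthogonal to a, and the factor a^4 comes from homogeneity.\<close>
  have "fibre_quartic U (n - d * a) (n * a + d) - fibre_quartic U (n + d * a) (n * a - d) =
      2 * n ^ 3 * d * G_hat U a - 2 * n * d ^ 3 * (a ^ 4 * G_hat U b)"
    using assms(3) unfolding fibre_quartic_eq G_hat_expand by algebra
  then show ?thesis using assms by simp
qed

text \<open>The slopes (1 + a \<zeta>)/(a - \<zeta>) put a at infinity. Degeneracy makes the slopes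
  of b, c, d sum to zero, and the zero mean of G over the circle then makes their product zero. Only
  b can have slope 0, since a root orthogonal to the real a is real; so c and d have opposite
  slopes, and the quartic, now even, does not distinguish them.\<close>

lemma riemann_invariant_eq_if_linearly_degenerate:
  assumes s: "distinct_roots U s" and roots: "{a, b, c, d} = range (($) s)"
    and a: "a \<in> \<real>" and cd: "c \<notin> \<real>" "d \<notin> \<real>"
    and deg: "(1 + a\<^sup>2) * G_hat'' U a - 6 * a * G_hat' U a = 0"
  shows "riemann_invariant U c = riemann_invariant U d"
proof -
  have card: "card {a, b, c, d} = 4" using distinct_roots_card[OF s] roots by simp
  have U3: "U $ 3 \<noteq> 0" by (rule distinct_roots_U3[OF s])
  have nonreal: "1 + a * \<zeta> \<noteq> 0" if "\<zeta> \<notin> \<real>" for \<zeta>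
  proof
    assume "1 + a * \<zeta> = 0"
    then have "a * \<zeta> = - 1" by (simp add: eq_neg_iff_add_eq_0 add.commute)
    moreover from this have "a \<noteq> 0" by auto
    ultimately have "\<zeta> = - 1 / a" by (simp add: field_simps)
    then show False using a that by (metis Reals_1 Reals_divide Reals_minus)
  qed
  have sum0: "(1 + a * b) * (a - c) * (a - d) + (1 + a * c) * (a - b) * (a - d) + (1 + a * d) * (a - b) * (a - c) = 0"
    using deg U3 unfolding G_hat'_root(2)[OF s roots] by simp
  \<comment> \<open>G is a derivative along the circle, so its mean over the circle is zero; the
    means of q^4, q^2 p^2 and p^4 are in the ratio 3 : 1 : 3.\<close>
  have "U $ 3 * (3 + (a * b + a * c + a * d + b * c + b * d + c * d) + 3 * (a * b * c * d)) = 0"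
    using Vieta(2,4)[OF s roots] by algebra
  then have "3 + (a * b + a * c + a * d + b * c + b * d + c * d) + 3 * (a * b * c * d) = 0"
    using U3 by simp
  then have "(1 + a * b) * ((1 + a * c) * (1 + a * d)) = 0"
    using sum0 by algebra
  then have b: "1 + a * b = 0" using nonreal cd by simp
  have "(a - b) * ((1 + a * c) * (a - d) + (1 + a * d) * (a - c)) = 0"
    using sum0 b by algebra
  moreover have neq: "a - b \<noteq> 0" "a - c \<noteq> 0" "a - d \<noteq> 0"
    using card by (auto simp: card_insert_if split: if_splits)
  ultimately have "(1 + a * c) * (a - d) + (1 + a * d) * (a - c) = 0" by simp
  \<comment> \<open>Opposite slopes: the pair (1 + a d, a - d) will be \<kappa> times (1 + a c, - (a
    - c)).\<close>
  moreover define \<kappa> where "\<kappa> = - (a - d) / (a - c)"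
  have ac: "\<kappa> * (a - c) = - (a - d)" using neq by (simp add: \<kappa>_def)
  ultimately have "(1 + a * d) * (a - c) = (\<kappa> * (1 + a * c)) * (a - c)"
    by algebra
  then have \<kappa>1: "1 + a * d = \<kappa> * (1 + a * c)"
    using neq(2) mult_right_cancel by blast
  have \<kappa>2: "a - d = - \<kappa> * (a - c)" using ac by simp
  have \<kappa>3: "\<kappa> \<noteq> 0" using neq by (simp add: \<kappa>_def)
  note \<kappa> = \<kappa>1 \<kappa>2 \<kappa>3
  have a1: "1 + a\<^sup>2 \<noteq> 0"
  proof -
    obtain x where "a = complex_of_real x" using a by (auto elim: Reals_cases)
    then have "1 + a\<^sup>2 = complex_of_real (1 + x\<^sup>2)" by simp
    then show ?thesis by (metis add_pos_nonneg less_numeral_extra(3) of_real_eq_0_iff zero_le_power2 zero_less_one)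
  qed
  have "(1 + a\<^sup>2) ^ 4 * F_hat U d =
      fibre_quartic U (\<kappa> * ((1 + a * c) - (a - c) * a)) (\<kappa> * ((1 + a * c) * a + (a - c)))"
    unfolding F_hat_along_rotation \<kappa>(1,2) by (simp add: algebra_simps)
  also have "\<dots> = \<kappa> ^ 4 * fibre_quartic U ((1 + a * c) - (a - c) * a) ((1 + a * c) * a + (a - c))"
    unfolding fibre_quartic_eq by algebra
  also have "\<dots> = \<kappa> ^ 4 * ((1 + a\<^sup>2) ^ 4 * F_hat U c)"
    unfolding F_hat_along_rotation
    using fibre_quartic_even[of U a b "1 + a * c" "a - c"] b s roots by (auto simp: distinct_roots_def)
  finally have F: "F_hat U d = \<kappa> ^ 4 * F_hat U c" using a1 by simp
  have "(1 + a\<^sup>2) * (1 + d\<^sup>2) = (1 + a * d)\<^sup>2 + (a - d)\<^sup>2" by algebra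
  also have "\<dots> = (1 + a\<^sup>2) * (\<kappa>\<^sup>2 * (1 + c\<^sup>2))" unfolding \<kappa> by algebra
  finally have "1 + d\<^sup>2 = \<kappa>\<^sup>2 * (1 + c\<^sup>2)" using a1 by simp
  then have "riemann_invariant U d = \<kappa> ^ 4 * F_hat U c / (\<kappa> ^ 4 * (1 + c\<^sup>2)\<^sup>2)"
    unfolding riemann_invariant_def F by (simp add: power_mult_distrib flip: power_mult)
  also have "\<dots> = riemann_invariant U c" unfolding riemann_invariant_def using \<kappa>(3) by simp
  finally show ?thesis ..
qed

lemma riemann_invariant_cnj:
  assumes "\<And>k. U $ k \<in> \<real>"
  shows "riemann_invariant U (cnj \<zeta>) = cnj (riemann_invariant U \<zeta>)"
  using assms by (simp add: riemann_invariant_def F_hat_eq F_lin_def Reals_cnj_iff)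

text \<open>On the real line r' = G/(1 + u^2)^3, so equal values at the two real critical points
  would produce a third one between them. This is what forbids a lattice translation to exchange the
  labels 3 and 4.\<close>

lemma real_riemann_invariants_distinct:
  assumes s: "distinct_roots U s" and U: "\<And>k. U $ k \<in> \<real>"
    and "s $ 3 \<in> \<real>" "s $ 4 \<in> \<real>" "s $ 1 \<notin> \<real>" "s $ 2 \<notin> \<real>"
  shows "riemann_invariant U (s $ 3) \<noteq> riemann_invariant U (s $ 4)"
proof -
  define A where "A k = Re (U $ k)" for k
  have A: "U $ k = complex_of_real (A k)" for k
    using U by (simp add: A_def of_real_Re)
  define x y where "x = Re (s $ 3)" and "y = Re (s $ 4)"
  have xy: "s $ 3 = complex_of_real x" "s $ 4 = complex_of_real y"
    using assms(3,4) by (simp_all add: x_def y_def of_real_Re)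
  have "x \<noteq> y" using distinct_roots_neq[OF s, of 3 4] xy by auto
  define R where "R u = (A 0 + A 1 * u + A 2 * u ^ 2 + A 3 * u ^ 3 + u ^ 4) / (1 + u\<^sup>2)\<^sup>2" for u
  define G where "G u = - A 3 * u ^ 4 + (4 - 2 * A 2) * u ^ 3 + 3 * (A 3 - A 1) * u ^ 2 + (2 * A 2 - 4 * A 0) * u + A 1" for u
  have R: "riemann_invariant U (complex_of_real u) = complex_of_real (R u)" for u
    by (simp add: riemann_invariant_def F_hat_eq F_lin_def A R_def)
  have G: "G_hat U (complex_of_real u) = complex_of_real (G u)" for u
    by (simp add: G_hat_expand A G_def)
  have pos: "1 + u\<^sup>2 \<noteq> 0" for u :: real
    using zero_le_power2[of u] by linarith
  have R': "(R has_real_derivative G u / (1 + u\<^sup>2) ^ 3) (at u)" for u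
  proof -
    let ?P = "A 0 + A 1 * u + A 2 * u ^ 2 + A 3 * u ^ 3 + u ^ 4"
    let ?P' = "A 1 + 2 * A 2 * u + 3 * A 3 * u ^ 2 + 4 * u ^ 3"
    have "(R has_real_derivative (?P' * (1 + u\<^sup>2)\<^sup>2 - ?P * (2 * (1 + u\<^sup>2) * (2 * u))) / ((1 + u\<^sup>2)\<^sup>2 * (1 + u\<^sup>2)\<^sup>2)) (at u)"
      unfolding R_def[abs_def] using pos[of u]
      by (auto intro!: derivative_eq_intros simp: algebra_simps)
    moreover have "?P' * (1 + u\<^sup>2)\<^sup>2 - ?P * (2 * (1 + u\<^sup>2) * (2 * u)) = (1 + u\<^sup>2) * G u"
      unfolding G_def by algebra
    moreover have "(1 + u\<^sup>2)\<^sup>2 * (1 + u\<^sup>2)\<^sup>2 = (1 + u\<^sup>2) * (1 + u\<^sup>2) ^ 3"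
      by algebra
    ultimately show ?thesis
      using pos[of u] by simp
  qed
  have no: "G u \<noteq> 0" if "u \<noteq> x" "u \<noteq> y" for u
  proof
    assume "G u = 0"
    then have "G_hat U (complex_of_real u) = 0" using G by simp
    moreover have "complex_of_real u \<in> \<real>" by (rule Reals_of_real)
    ultimately show False
      unfolding distinct_roots_G_hat[OF s] using assms(5,6) that xy by (auto simp del: Reals_of_real)
  qed
  have "R u \<noteq> R v" if uv: "u < v" "{u, v} = {x, y}" for u v
  proof
    assume "R u = R v"
    moreover have "continuous_on {u..v} R"
      using R' by (meson DERIV_isCont continuous_at_imp_continuous_on)
    moreover have "R differentiable (at w)" for w
      using R' real_differentiable_def by blast
    ultimately obtain w where "u < w" "w < v" "(R has_real_derivative 0) (at w)"
      using Rolle[OF uv(1), of R] by blast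
    then have "G w / (1 + w\<^sup>2) ^ 3 = 0" using R' DERIV_unique by blast
    then have "G w = 0" using pos[of w] by simp
    moreover have "w \<noteq> x" "w \<noteq> y"
      using \<open>u < w\<close> \<open>w < v\<close> uv(2) by (auto simp: doubleton_eq_iff)
    ultimately show False using no by blast
  qed
  from this[of x y] this[of y x] have "R x \<noteq> R y"
    using \<open>x \<noteq> y\<close> by (cases "x < y") (auto simp: insert_commute)
  then show ?thesis by (simp add: xy R)
qed

section \<open>Orthogonal changes of the fibre coordinates\<close>

definition fibre_q :: "complex^4 \<Rightarrow> complex \<Rightarrow> complex \<Rightarrow> complex" where
  "fibre_q U q p = 4 * U $ 0 * q ^ 3 + 3 * U $ 1 * q ^ 2 * p + 2 * U $ 2 * q * p ^ 2 + U $ 3 * p ^ 3"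

definition fibre_p :: "complex^4 \<Rightarrow> complex \<Rightarrow> complex \<Rightarrow> complex" where
  "fibre_p U q p = U $ 1 * q ^ 3 + 2 * U $ 2 * q ^ 2 * p + 3 * U $ 3 * q * p ^ 2 + 4 * p ^ 3"

lemma fibre_derivative_eq': "fibre_derivative U q p = - p * fibre_q U q p + q * fibre_p U q p"
  by (simp add: fibre_derivative_eq fibre_q_def fibre_p_def)

lemma DERIV_fibre_quartic:
  assumes "(X has_field_derivative X') (at \<zeta>)" "(Y has_field_derivative Y') (at \<zeta>)"
  shows "((\<lambda>\<zeta>. fibre_quartic U (X \<zeta>) (Y \<zeta>)) has_field_derivative
    X' * fibre_q U (X \<zeta>) (Y \<zeta>) + Y' * fibre_p U (X \<zeta>) (Y \<zeta>)) (at \<zeta>)"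
  unfolding fibre_quartic_eq fibre_q_def fibre_p_def
  by (rule derivative_eq_intros assms refl)+ (simp add: algebra_simps power3_eq_cube power2_eq_square)

lemma fibre_derivative_homogeneous:
  "m \<noteq> 0 \<Longrightarrow> fibre_derivative U m n = m ^ 4 * G_hat U (n / m)"
  unfolding fibre_derivative_eq G_hat_expand
  by (simp add: field_simps power2_eq_square power3_eq_cube power4_eq_xxxx)

lemma fibre_quartic_homogeneous:
  "m \<noteq> 0 \<Longrightarrow> fibre_quartic U m n = m ^ 4 * F_hat U (n / m)"
  unfolding fibre_quartic_eq F_hat_eq F_lin_def
  by (simp add: field_simps power2_eq_square power3_eq_cube power4_eq_xxxx)

lemma quartic_form_zero:
  fixes c0 :: complex
  assumes "\<And>q p :: real. c0 * complex_of_real q ^ 4 + c1 * complex_of_real q ^ 3 * complex_of_real p +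
      c2 * complex_of_real q ^ 2 * complex_of_real p ^ 2 + c3 * complex_of_real q * complex_of_real p ^ 3 +
      c4 * complex_of_real p ^ 4 = 0"
  shows "c0 = 0 \<and> c1 = 0 \<and> c2 = 0 \<and> c3 = 0 \<and> c4 = 0"
proof -
  have 0: "c0 = 0" "c4 = 0" using assms[of 1 0] assms[of 0 1] by simp_all
  have 1: "c1 + c2 + c3 = 0" "- c1 + c2 - c3 = 0" "2 * c1 + 4 * c2 + 8 * c3 = 0"
    using assms[of 1 1] assms[of 1 "-1"] assms[of 1 2] by (simp_all add: 0 algebra_simps)
  from 1(1,2) have "c2 = 0" by algebra
  moreover from this 1(1,3) have "6 * c3 = 0" by algebra
  ultimately show ?thesis using 0 1(1) by simp
qed

text \<open>Covectors give the change of frame at real arguments only, but nonreal roots call for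
  complex ones. Both sides are quartic forms, so agreement at real points forces equal
  coefficients.\<close>

lemma fibre_quartic_complexify:
  assumes "\<And>q p :: real. fibre_quartic U' (of_real q) (of_real p) =
    fibre_quartic U (a * of_real q + b * of_real p) (c * of_real q + d * of_real p)"
  shows "fibre_quartic U' q p = fibre_quartic U (a * q + b * p) (c * q + d * p)"
proof -
  define w0 where "w0 = U' $ 0 - (U $ 0 * a ^ 4 + U $ 1 * a ^ 3 * c + U $ 2 * a ^ 2 * c ^ 2 + U $ 3 * a * c ^ 3 + c ^ 4)"
  define w1 where "w1 = U' $ 1 - (U $ 0 * (4 * a ^ 3 * b) + U $ 1 * (a ^ 3 * d + 3 * a ^ 2 * b * c) +
      U $ 2 * (2 * a ^ 2 * c * d + 2 * a * b * c ^ 2) + U $ 3 * (3 * a * c ^ 2 * d + b * c ^ 3) + 4 * c ^ 3 * d)"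
  define w2 where "w2 = U' $ 2 - (U $ 0 * (6 * a ^ 2 * b ^ 2) + U $ 1 * (3 * a ^ 2 * b * d + 3 * a * b ^ 2 * c) +
      U $ 2 * (a ^ 2 * d ^ 2 + 4 * a * b * c * d + b ^ 2 * c ^ 2) + U $ 3 * (3 * a * c * d ^ 2 + 3 * b * c ^ 2 * d) + 6 * c ^ 2 * d ^ 2)"
  define w3 where "w3 = U' $ 3 - (U $ 0 * (4 * a * b ^ 3) + U $ 1 * (3 * a * b ^ 2 * d + b ^ 3 * c) +
      U $ 2 * (2 * a * b * d ^ 2 + 2 * b ^ 2 * c * d) + U $ 3 * (a * d ^ 3 + 3 * b * c * d ^ 2) + 4 * c * d ^ 3)"
  define w4 where "w4 = 1 - (U $ 0 * b ^ 4 + U $ 1 * b ^ 3 * d + U $ 2 * b ^ 2 * d ^ 2 + U $ 3 * b * d ^ 3 + d ^ 4)"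
  have split: "fibre_quartic U' q p - fibre_quartic U (a * q + b * p) (c * q + d * p) =
      w0 * q ^ 4 + w1 * q ^ 3 * p + w2 * q ^ 2 * p ^ 2 + w3 * q * p ^ 3 + w4 * p ^ 4" for q p
    unfolding w0_def w1_def w2_def w3_def w4_def fibre_quartic_eq by algebra
  have "w0 = 0 \<and> w1 = 0 \<and> w2 = 0 \<and> w3 = 0 \<and> w4 = 0"
    by (rule quartic_form_zero) (simp flip: split add: assms)
  then show ?thesis using split[of q p] by simp
qed

text \<open>
  The orthogonal map is the change between two orthonormal frames of one cotangent plane, and
  \<open>G_hat' U s / (1 + s\<^sup>2)\<close> is the second derivative of the integral along the unit circle.
\<close>

lemma critical_point_transfer:
  fixes \<alpha> \<gamma> \<epsilon> :: real
  assumes circ: "\<alpha>\<^sup>2 + \<gamma>\<^sup>2 = 1" "\<epsilon>\<^sup>2 = 1"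
    and eq: "\<And>q p :: real. fibre_quartic U' (of_real q) (of_real p) =
      fibre_quartic U (of_real (\<alpha> * q - \<epsilon> * \<gamma> * p)) (of_real (\<gamma> * q + \<epsilon> * \<alpha> * p))"
    and root: "G_hat U' s' = 0" and U3: "U $ 3 \<noteq> 0"
  obtains s where "G_hat U s = 0" "riemann_invariant U s = riemann_invariant U' s'"
    "G_hat' U s / (1 + s\<^sup>2) = G_hat' U' s' / (1 + s'\<^sup>2)" "s \<in> \<real> \<longleftrightarrow> s' \<in> \<real>"
proof -
  define a c e where ace: "a = complex_of_real \<alpha>" "c = complex_of_real \<gamma>" "e = complex_of_real \<epsilon>"
  have ac: "a\<^sup>2 + c\<^sup>2 = 1" and e: "e\<^sup>2 = 1"
    using circ unfolding ace by (metis of_real_1 of_real_add of_real_power)+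
  have real: "a \<in> \<real>" "c \<in> \<real>" "e \<in> \<real>" by (simp_all add: ace)
  have quartic: "fibre_quartic U' q p = fibre_quartic U (a * q - e * c * p) (c * q + e * a * p)" for q p
    using fibre_quartic_complexify[of U' U a "- e * c" c "e * a" q p] eq by (simp add: ace)
  have deriv: "fibre_derivative U' q p = e * fibre_derivative U (a * q - e * c * p) (c * q + e * a * p)" for q p
  proof -
    let ?q = "fibre_q U (a * q - e * c * p) (c * q + e * a * p)"
    let ?p = "fibre_p U (a * q - e * c * p) (c * q + e * a * p)"
    have "((\<lambda>q. fibre_quartic U' q p) has_field_derivative a * ?q + c * ?p) (at q)"
      unfolding quartic by (rule DERIV_fibre_quartic) (auto intro!: derivative_eq_intros)
    moreover have "((\<lambda>p. fibre_quartic U' q p) has_field_derivative - e * c * ?q + e * a * ?p) (at p)"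
      unfolding quartic by (rule DERIV_fibre_quartic) (auto intro!: derivative_eq_intros)
    ultimately have "fibre_derivative U' q p = - p * (a * ?q + c * ?p) + q * (- e * c * ?q + e * a * ?p)"
      by (simp add: fibre_derivative_def DERIV_imp_deriv)
    also have "\<dots> = e * fibre_derivative U (a * q - e * c * p) (c * q + e * a * p)"
      unfolding fibre_derivative_eq' using e by algebra
    finally show ?thesis .
  qed
  \<comment> \<open>(m, n) is the image of the direction (1, s') under the orthogonal map; the new
    root is its slope.\<close>
  define m n where mn: "m = a - e * c * s'" "n = c + e * a * s'"
  have m2n2: "m\<^sup>2 + n\<^sup>2 = 1 + s'\<^sup>2" unfolding mn using ac e by algebra
  have amcn: "a * m + c * n = 1" unfolding mn using ac by algebra
  have "e \<noteq> 0" using e by auto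
  have G: "G_hat U' \<zeta> = e * fibre_derivative U (a - e * c * \<zeta>) (c + e * a * \<zeta>)" for \<zeta>
    using deriv[of 1 \<zeta>] by (simp add: G_hat_def)
  have fd0: "fibre_derivative U m n = 0"
    using root \<open>e \<noteq> 0\<close> unfolding G mn by simp
  \<comment> \<open>m = 0 would be a root at infinity, where G takes the value - U_3 n^4.\<close>
  have "m \<noteq> 0"
  proof
    assume "m = 0"
    then have "n * (U $ 3 * n ^ 3) = 0" using fd0 by (simp add: fibre_derivative_eq)
    then show False using U3 amcn \<open>m = 0\<close> by auto
  qed
  define s where "s = n / m"
  have sm: "s * m = n" using \<open>m \<noteq> 0\<close> by (simp add: s_def)
  have root_s: "G_hat U s = 0"
    using fibre_derivative_homogeneous[OF \<open>m \<noteq> 0\<close>, of U n] fd0 \<open>m \<noteq> 0\<close> by (simp add: s_def)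
  have s2: "1 + s'\<^sup>2 = m\<^sup>2 * (1 + s\<^sup>2)" using m2n2 sm by algebra
  have "F_hat U' s' = fibre_quartic U' 1 s'" by (simp add: fibre_quartic_eq F_hat_eq F_lin_def)
  also have "\<dots> = m ^ 4 * F_hat U s"
    unfolding quartic using fibre_quartic_homogeneous[OF \<open>m \<noteq> 0\<close>, of U n] by (simp add: s_def mn)
  finally have "riemann_invariant U' s' = m ^ 4 * F_hat U s / (m ^ 4 * (1 + s\<^sup>2)\<^sup>2)"
    unfolding riemann_invariant_def s2 by (simp add: power_mult_distrib flip: power_mult)
  then have inv: "riemann_invariant U s = riemann_invariant U' s'"
    using \<open>m \<noteq> 0\<close> by (simp add: riemann_invariant_def)
  \<comment> \<open>Near s', G for U' is e m^4 times G for U at the slope n/m. At a root only the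
    slope needs to be differentiated, and its derivative is e/m^2.\<close>
  have "G_hat' U' s' = m\<^sup>2 * G_hat' U s"
  proof -
    have "((\<lambda>\<zeta>. e * ((a - e * c * \<zeta>) ^ 4 * G_hat U ((c + e * a * \<zeta>) / (a - e * c * \<zeta>)))) has_field_derivative
      e * (m ^ 4 * (G_hat' U s * ((e * a * m + n * (e * c)) / (m * m))) + 4 * m ^ 3 * (- (e * c)) * G_hat U s)) (at s')"
    proof -
      have "((\<lambda>\<zeta>. (c + e * a * \<zeta>) / (a - e * c * \<zeta>)) has_field_derivative (e * a * m + n * (e * c)) / (m * m)) (at s')"
        using \<open>m \<noteq> 0\<close> unfolding mn by (auto intro!: derivative_eq_intros simp: algebra_simps)
      then have "((\<lambda>\<zeta>. G_hat U ((c + e * a * \<zeta>) / (a - e * c * \<zeta>))) has_field_derivative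
          G_hat' U s * ((e * a * m + n * (e * c)) / (m * m))) (at s')"
        using DERIV_chain2[OF DERIV_G_hat] unfolding s_def mn by blast
      then show ?thesis
        unfolding s_def mn
        by (auto intro!: derivative_eq_intros simp: mult_ac)
    qed
    moreover have "open {\<zeta>. a - e * c * \<zeta> \<noteq> 0}"
      by (intro open_Collect_neq continuous_intros)
    ultimately have "(G_hat U' has_field_derivative
      e * (m ^ 4 * (G_hat' U s * ((e * a * m + n * (e * c)) / (m * m))) + 4 * m ^ 3 * (- (e * c)) * G_hat U s)) (at s')"
      by (rule has_field_derivative_transform_within_open)
        (use \<open>m \<noteq> 0\<close> in \<open>auto simp: G mn fibre_derivative_homogeneous\<close>)
    then have "G_hat' U' s' = e * (m ^ 4 * (G_hat' U s * ((e * a * m + n * (e * c)) / (m * m))))"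
      using DERIV_unique[OF DERIV_G_hat] root_s by (simp add: root_s)
    also have "e * a * m + n * (e * c) = e" using amcn by algebra
    also have "e * (m ^ 4 * (G_hat' U s * (e / (m * m)))) = m\<^sup>2 * G_hat' U s"
      using \<open>m \<noteq> 0\<close> e by (simp add: field_simps power2_eq_square power4_eq_xxxx)
    finally show ?thesis .
  qed
  then have Q: "G_hat' U s / (1 + s\<^sup>2) = G_hat' U' s' / (1 + s'\<^sup>2)"
    unfolding s2 using \<open>m \<noteq> 0\<close> by simp
  have "s \<in> \<real> \<longleftrightarrow> s' \<in> \<real>"
  proof
    assume "s' \<in> \<real>"
    then show "s \<in> \<real>" unfolding s_def mn using real by (intro Reals_divide Reals_add Reals_diff Reals_mult)
  next
    assume s: "s \<in> \<real>"
    have "(a + c * s) * m = 1" using amcn sm by algebra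
    then have "a + c * s \<noteq> 0" by auto
    moreover have "s' * (a + c * s) = e * (s * a - c)"
      using sm e unfolding mn by algebra
    ultimately have "s' = e * (s * a - c) / (a + c * s)" by (simp add: eq_divide_eq)
    then show "s' \<in> \<real>" using real s by (auto intro!: Reals_divide Reals_add Reals_diff Reals_mult)
  qed
  then show thesis using that root_s inv Q by blast
qed

section \<open>Differential identity along a characteristic\<close>

text \<open>The last factor on the right vanishes exactly at linear degeneracy.\<close>

lemma characteristic_identity:
  assumes pde: "Ut $ 0 = - (Ux $ 3 * U $ 1)"
    "Ut $ 1 = - (U $ 3 * Ux $ 0 + Ux $ 3 * (2 * U $ 2 - 4 * U $ 0))"
    "Ut $ 2 = - (U $ 3 * Ux $ 1 + 3 * Ux $ 3 * (U $ 3 - U $ 1))"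
    "Ut $ 3 = - (U $ 3 * Ux $ 2 + Ux $ 3 * (4 - 2 * U $ 2))"
    and root: "G_hat U s = 0"
  shows "G_hat' U s * (G_lin' Ut s + U $ 3 * s * G_lin' Ux s) - G_hat'' U s * (G_lin Ut s + U $ 3 * s * G_lin Ux s)
      - 2 * G_hat' U s * (G_hat' U s * (Ux $ 3 * s) - U $ 3 * G_lin Ux s) =
    U $ 3 * F_lin Ux s * ((1 + s\<^sup>2) * G_hat'' U s - 6 * s * G_hat' U s)"
proof -
  \<comment> \<open>The transport equation \<open>F_lin_pde\<close> put through the operator (1 +
    s^2) d/ds - 4 s that sends F to G; the next identity comes from its s-derivative. The multiples
    of G make both valid for every s and drop out at the root.\<close>
  have 1: "G_lin Ut s + U $ 3 * s * G_lin Ux s =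
      - (1 + s\<^sup>2) * (U $ 3 * F_lin Ux s + Ux $ 3 * G_hat' U s) + 4 * s * Ux $ 3 * G_hat U s"
    unfolding G_lin_def F_lin_def F_lin'_def pde G_hat'_def G_lin'_def G_hat_expand by algebra
  have 2: "G_lin' Ut s + U $ 3 * s * G_lin' Ux s =
      - 2 * U $ 3 * (1 + s\<^sup>2) * F_lin' Ux s + 2 * U $ 3 * s * F_lin Ux s
      - (1 + s\<^sup>2) * Ux $ 3 * G_hat'' U s + 2 * s * Ux $ 3 * G_hat' U s + 4 * Ux $ 3 * G_hat U s"
    unfolding G_hat''_def F_lin_def F_lin'_def G_hat'_def G_lin'_def pde G_hat_expand by algebra
  show ?thesis
    using 1 2 root G_lin_def[of Ux s] by algebra
qed

lemma F_lin_pde: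
  assumes pde: "Ut $ 0 = - (Ux $ 3 * U $ 1)"
    "Ut $ 1 = - (U $ 3 * Ux $ 0 + Ux $ 3 * (2 * U $ 2 - 4 * U $ 0))"
    "Ut $ 2 = - (U $ 3 * Ux $ 1 + 3 * Ux $ 3 * (U $ 3 - U $ 1))"
    "Ut $ 3 = - (U $ 3 * Ux $ 2 + Ux $ 3 * (4 - 2 * U $ 2))"
  shows "F_lin Ut s = - (U $ 3 * s * F_lin Ux s + Ux $ 3 * G_hat U s)"
  unfolding F_lin_def G_hat_expand pde by algebra

section \<open>Derivatives of roots and Riemann invariants\<close>

text \<open>A product rule in which one factor is merely continuous, allowed because the other
  vanishes at the point. In \<open>root_has_derivative\<close> the first factor contains the other
  roots, known there only to be continuous.\<close>

lemma has_derivative_mult_vanishing: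
  fixes L q :: "'a::real_normed_vector \<Rightarrow> 'b::real_normed_algebra"
  assumes L: "(L has_derivative D) (at x)" and 0: "L x = 0" and q: "isCont q x"
  shows "((\<lambda>y. q y * L y) has_derivative (\<lambda>h. q x * D h)) (at x)"
proof -
  have D: "bounded_linear D" using L by (rule has_derivative_bounded_linear)
  then obtain K where K: "\<And>h. norm (D h) \<le> norm h * K"
    using bounded_linear.bounded by blast
  have q0: "((\<lambda>y. q y - q x) \<longlongrightarrow> 0) (at x)"
    using q by (simp add: isCont_def LIM_zero_iff)
  have rem: "((\<lambda>y. (L y - D (y - x)) /\<^sub>R norm (y - x)) \<longlongrightarrow> 0) (at x)"
    using L 0 by (simp add: has_derivative_at_within)
  have 1: "((\<lambda>y. q y * ((L y - D (y - x)) /\<^sub>R norm (y - x))) \<longlongrightarrow> q x * 0) (at x)"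
    by (intro tendsto_mult rem) (use q in \<open>simp add: isCont_def\<close>)
  have 2: "((\<lambda>y. (q y - q x) * (D (y - x) /\<^sub>R norm (y - x))) \<longlongrightarrow> 0) (at x)"
  proof (rule Lim_null_comparison)
    show "((\<lambda>y. norm (q y - q x) * K) \<longlongrightarrow> 0) (at x)"
      using tendsto_mult_right[OF tendsto_norm[OF q0], of K] by simp
    have "norm ((q y - q x) * (D (y - x) /\<^sub>R norm (y - x))) \<le> norm (q y - q x) * K" if "y \<noteq> x" for y
    proof -
      have "norm (D (y - x) /\<^sub>R norm (y - x)) \<le> K"
        using K[of "y - x"] that by (simp add: divide_simps mult.commute)
      then show ?thesis
        by (meson mult_left_mono norm_ge_zero norm_mult_ineq order_trans)
    qed
    then show "\<forall>\<^sub>F y in at x. norm ((q y - q x) * (D (y - x) /\<^sub>R norm (y - x))) \<le> norm (q y - q x) * K"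
      by (simp add: eventually_at_filter)
  qed
  have "(\<lambda>y. (q y * L y - q x * L x - q x * D (y - x)) /\<^sub>R norm (y - x)) =
     (\<lambda>y. q y * ((L y - D (y - x)) /\<^sub>R norm (y - x)) + (q y - q x) * (D (y - x) /\<^sub>R norm (y - x)))"
    by (simp add: 0 fun_eq_iff algebra_simps)
  then have "((\<lambda>y. (q y * L y - q x * L x - q x * D (y - x)) /\<^sub>R norm (y - x)) \<longlongrightarrow> 0) (at x)"
    using tendsto_add[OF 1 2] by simp
  then show ?thesis
    using bounded_linear_compose[OF bounded_linear_mult_right D] by (simp add: has_derivative_at_within)
qed

lemma four_indices:
  fixes i :: 4
  obtains j k l where "\<And>m. m = i \<or> m = j \<or> m = k \<or> m = l" "j \<noteq> i" "k \<noteq> i" "l \<noteq> i"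
proof -
  have e: "m = 1 \<or> m = 2 \<or> m = 3 \<or> m = 4" for m :: 4 by (rule exhaust_4)
  from e[of i] show thesis
  proof (elim disjE)
    assume "i = 1"
    then show thesis using e by (intro that[of 2 3 4]) auto
  next
    assume "i = 2"
    then show thesis using e by (intro that[of 1 3 4]) auto
  next
    assume "i = 3"
    then show thesis using e by (intro that[of 1 2 4]) auto
  next
    assume "i = 4"
    then show thesis using e by (intro that[of 1 2 3]) auto
  qed
qed

lemma four_indices_range:
  fixes s :: "'a^4"
  assumes "\<And>m. m = i \<or> m = j \<or> m = k \<or> m = l"
  shows "{s $ i, s $ j, s $ k, s $ l} = range (($) s)"
proof
  show "range (($) s) \<subseteq> {s $ i, s $ j, s $ k, s $ l}"
  proof
    fix x assume "x \<in> range (($) s)"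
    then obtain m where "x = s $ m" by auto
    then show "x \<in> {s $ i, s $ j, s $ k, s $ l}" using assms[of m] by auto
  qed
qed auto

lemma bounded_linear_G_lin: "bounded_linear (\<lambda>W. G_lin W s)"
  unfolding G_lin_def F_lin_def F_lin'_def
  by (intro bounded_linear_intros bounded_linear_vec_nth)

lemma G_lin_diff: "G_lin (U - V) s = G_hat U s - G_hat V s"
  by (simp add: G_hat_eq G_lin_def F_lin_def F_lin'_def algebra_simps)

lemma G_lin_zero [simp]: "G_lin 0 s = 0"
  by (simp add: G_lin_def F_lin_def F_lin'_def)

text \<open>The factorization of G replaces an implicit function argument: G for U(y), evaluated at
  the old root a, equals p(y) (s_i(y) - a) with p continuous and nonzero at x, while its dependence
  on U is affine.\<close>

lemma root_has_derivative:
  fixes U s :: "'a::real_normed_vector \<Rightarrow> complex^4"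
  assumes U: "(U has_derivative U') (at x)" and s: "isCont s x"
    and ev: "\<forall>\<^sub>F y in nhds x. distinct_roots (U y) (s y)"
  shows "((\<lambda>y. s y $ i) has_derivative (\<lambda>h. - G_lin (U' h) (s x $ i) / G_hat' (U x) (s x $ i))) (at x)"
proof -
  obtain j k l where ijkl: "\<And>m. m = i \<or> m = j \<or> m = k \<or> m = l" "j \<noteq> i" "k \<noteq> i" "l \<noteq> i"
    using four_indices by blast
  note rng = four_indices_range[OF ijkl(1)]
  have x: "distinct_roots (U x) (s x)" using ev by (rule eventually_nhds_x_imp_x)
  define a where "a = s x $ i"
  define p where "p y = U y $ 3 * ((a - s y $ j) * (a - s y $ k) * (a - s y $ l))" for y
  have p: "isCont p x"
    unfolding p_def using s has_derivative_continuous[OF U] by (intro continuous_intros)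
  have px: "p x = - G_hat' (U x) a"
    unfolding p_def a_def G_hat'_root(1)[OF x rng[of "s x"]] by simp
  then have px0: "p x \<noteq> 0" using G_hat'_nonzero[OF x, of i] by (simp add: a_def)
  then have "\<forall>\<^sub>F y in nhds x. p y \<noteq> 0"
    using p tendsto_imp_eventually_ne unfolding isCont_def tendsto_at_iff_tendsto_nhds by blast
  then have eq: "\<forall>\<^sub>F y in nhds x. inverse (p y) * G_lin (U y - U x) a = s y $ i - a"
    using ev
  proof eventually_elim
    case (elim y)
    have "G_lin (U y - U x) a = G_hat (U y) a"
      using distinct_roots_root[OF x] by (simp add: G_lin_diff a_def)
    also have "\<dots> = p y * (s y $ i - a)"
      unfolding G_hat_factor[OF elim(2) rng[of "s y"]] p_def by algebra
    finally show ?case using elim(1) by simp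
  qed
  have "((\<lambda>y. G_lin (U y - U x) a) has_derivative (\<lambda>h. G_lin (U' h) a)) (at x)"
    by (rule bounded_linear.has_derivative[OF bounded_linear_G_lin]) (auto intro!: derivative_eq_intros U)
  then have "((\<lambda>y. inverse (p y) * G_lin (U y - U x) a) has_derivative (\<lambda>h. inverse (p x) * G_lin (U' h) a)) (at x)"
    by (rule has_derivative_mult_vanishing) (use p px0 in \<open>auto intro!: continuous_intros\<close>)
  then have "((\<lambda>y. s y $ i - a) has_derivative (\<lambda>h. inverse (p x) * G_lin (U' h) a)) (at x)"
    by (rule has_derivative_transform_eventually)
      (use eq in \<open>auto simp: eventually_nhds_conv_at\<close>)
  then have "((\<lambda>y. (s y $ i - a) + a) has_derivative (\<lambda>h. inverse (p x) * G_lin (U' h) a + 0)) (at x)"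
    by (intro has_derivative_add has_derivative_const)
  then show ?thesis
    by (simp add: px a_def divide_inverse mult.commute)
qed

text \<open>The motion of the root does not contribute, because the derivative of F_hat/(1 + s^2)^2
  in s is G_hat/(1 + s^2)^3, which is zero there. Only the variation of the coefficients is
  left.\<close>

lemma riemann_invariant_has_derivative:
  fixes U s :: "'a::real_normed_vector \<Rightarrow> complex^4"
  assumes U: "(U has_derivative U') (at x)" and s: "isCont s x"
    and ev: "\<forall>\<^sub>F y in nhds x. distinct_roots (U y) (s y)"
    and nz: "1 + (s x $ i)\<^sup>2 \<noteq> 0"
  shows "((\<lambda>y. riemann_invariant (U y) (s y $ i)) has_derivative
    (\<lambda>h. F_lin (U' h) (s x $ i) / (1 + (s x $ i)\<^sup>2)\<^sup>2)) (at x)"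
proof -
  define a where "a = s x $ i"
  define da where "da h = - G_lin (U' h) a / G_hat' (U x) a" for h
  have x: "distinct_roots (U x) (s x)" using ev by (rule eventually_nhds_x_imp_x)
  have root: "(1 + a\<^sup>2) * (F_lin' (U x) a + 4 * a ^ 3) - 4 * a * F_hat (U x) a = 0"
    using distinct_roots_root[OF x, of i] unfolding G_hat_eq G_lin_def F_hat_eq a_def by algebra
  have a1: "1 + a\<^sup>2 \<noteq> 0" using nz by (simp add: a_def)
  have sd: "((\<lambda>y. s y $ i) has_derivative da) (at x)"
    using root_has_derivative[OF U s ev, of i] by (simp add: da_def[abs_def] a_def)
  have Uc: "((\<lambda>y. U y $ k) has_derivative (\<lambda>h. U' h $ k)) (at x)" for k
    by (rule bounded_linear.has_derivative[OF bounded_linear_vec_nth U])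
  have F: "((\<lambda>y. F_hat (U y) (s y $ i)) has_derivative
      (\<lambda>h. F_lin (U' h) a + (F_lin' (U x) a + 4 * a ^ 3) * da h)) (at x)"
    unfolding F_hat_eq F_lin_def F_lin'_def
    by (rule derivative_eq_intros Uc sd refl)+
      (simp add: a_def fun_eq_iff algebra_simps power2_eq_square power3_eq_cube)
  have Q: "((\<lambda>y. (1 + (s y $ i)\<^sup>2)\<^sup>2) has_derivative (\<lambda>h. 4 * a * (1 + a\<^sup>2) * da h)) (at x)"
    by (rule derivative_eq_intros sd refl)+
      (simp add: a_def fun_eq_iff algebra_simps power2_eq_square power3_eq_cube)
  have "((\<lambda>y. F_hat (U y) (s y $ i) / (1 + (s y $ i)\<^sup>2)\<^sup>2) has_derivative
     (\<lambda>h. ((F_lin (U' h) a + (F_lin' (U x) a + 4 * a ^ 3) * da h) * (1 + a\<^sup>2)\<^sup>2 -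
       F_hat (U x) a * (4 * a * (1 + a\<^sup>2) * da h)) / ((1 + a\<^sup>2)\<^sup>2 * (1 + a\<^sup>2)\<^sup>2))) (at x)"
    using has_derivative_divide'[OF F Q] a1 by (simp add: a_def)
  moreover have "((F_lin (U' h) a + (F_lin' (U x) a + 4 * a ^ 3) * da h) * (1 + a\<^sup>2)\<^sup>2 -
       F_hat (U x) a * (4 * a * (1 + a\<^sup>2) * da h)) / ((1 + a\<^sup>2)\<^sup>2 * (1 + a\<^sup>2)\<^sup>2) =
      F_lin (U' h) a / (1 + a\<^sup>2)\<^sup>2" for h
  proof -
    have "(F_lin (U' h) a + (F_lin' (U x) a + 4 * a ^ 3) * da h) * (1 + a\<^sup>2)\<^sup>2 -
       F_hat (U x) a * (4 * a * (1 + a\<^sup>2) * da h) = F_lin (U' h) a * (1 + a\<^sup>2)\<^sup>2"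
      using root by algebra
    then show ?thesis using a1 by (simp add: field_simps)
  qed
  ultimately show ?thesis
    unfolding riemann_invariant_def a_def[symmetric] by (simp only:)
qed

section \<open>Genuine nonlinearity\<close>

lemma prod_mset_norm_ge:
  fixes A :: "complex multiset"
  assumes "0 \<le> \<delta>" "\<And>x. x \<in># A \<Longrightarrow> \<delta> \<le> norm (\<zeta> - x)"
  shows "\<delta> ^ size A \<le> norm (\<Prod>x\<in>#A. \<zeta> - x)"
  using assms(2)
proof (induction A)
  case (add x A)
  then show ?case using assms(1) by (auto simp: norm_mult intro!: mult_mono)
qed simp

text \<open>|G(\<zeta>)| is |U_3| times the product of the distances to the four roots, so a small
  value forces a small distance. This gives both existence and continuity of the root
  branches.\<close>

lemma root_near:
  assumes U3: "U $ 3 \<noteq> 0" and small: "norm (G_hat U \<zeta>) < norm (U $ 3) * \<delta> ^ 4" and \<delta>: "\<delta> > 0"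
  obtains \<eta> where "G_hat U \<eta> = 0" "norm (\<zeta> - \<eta>) < \<delta>"
proof -
  define p where "p = [: U $ 1, 2 * U $ 2 - 4 * U $ 0, 3 * (U $ 3 - U $ 1), 4 - 2 * U $ 2, - U $ 3 :]"
  have p: "poly p \<eta> = G_hat U \<eta>" for \<eta>
    by (simp add: p_def G_hat_expand algebra_simps power2_eq_square power3_eq_cube power4_eq_xxxx)
  have deg: "degree p = 4" "lead_coeff p = - U $ 3" "p \<noteq> 0" using U3 by (simp_all add: p_def)
  obtain A where A: "size A = 4" "p = smult (- U $ 3) (\<Prod>x\<in>#A. [:- x, 1:])"
    using alg_closed_imp_factorization[OF deg(3)] deg by auto
  have "G_hat U \<eta> = - U $ 3 * (\<Prod>x\<in>#A. \<eta> - x)" for \<eta>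
    unfolding p[symmetric] A(2) by (simp add: poly_prod_mset image_mset.compositionality o_def)
  note G = this
  have "\<exists>\<eta>\<in>#A. norm (\<zeta> - \<eta>) < \<delta>"
  proof (rule ccontr)
    assume "\<not> ?thesis"
    then have "\<delta> ^ 4 \<le> norm (\<Prod>x\<in>#A. \<zeta> - x)"
      using prod_mset_norm_ge[of \<delta> A \<zeta>] \<delta> A(1) by (auto simp: not_less)
    then have "norm (U $ 3) * \<delta> ^ 4 \<le> norm (G_hat U \<zeta>)"
      unfolding G by (simp add: norm_mult mult_left_mono)
    then show False using small by simp
  qed
  then obtain \<eta> where \<eta>: "\<eta> \<in># A" "norm (\<zeta> - \<eta>) < \<delta>" by blast
  have "(\<Prod>x\<in>#A. \<eta> - x) = 0"
    using \<eta>(1) by (auto simp: prod_mset_zero_iff)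
  then have "G_hat U \<eta> = 0" using G by simp
  then show thesis using that \<eta>(2) by blast
qed

lemma card_roots_le:
  assumes "U $ 3 \<noteq> 0"
  shows "finite {\<zeta>. G_hat U \<zeta> = 0}" "card {\<zeta>. G_hat U \<zeta> = 0} \<le> 4"
proof -
  define p where "p = [: U $ 1, 2 * U $ 2 - 4 * U $ 0, 3 * (U $ 3 - U $ 1), 4 - 2 * U $ 2, - U $ 3 :]"
  have p: "poly p \<eta> = G_hat U \<eta>" for \<eta>
    by (simp add: p_def G_hat_expand algebra_simps power2_eq_square power3_eq_cube power4_eq_xxxx)
  have deg: "degree p = 4" "p \<noteq> 0" using assms by (simp_all add: p_def)
  show "finite {\<zeta>. G_hat U \<zeta> = 0}" "card {\<zeta>. G_hat U \<zeta> = 0} \<le> 4"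
    using poly_roots_finite[OF deg(2)] card_poly_roots_bound[OF deg(2)] by (simp_all add: p deg)
qed

lemma continuous_on_G_hat [continuous_intros]:
  fixes f :: "'a::topological_space \<Rightarrow> complex^4"
  shows "continuous_on N f \<Longrightarrow> continuous_on N g \<Longrightarrow> continuous_on N (\<lambda>x. G_hat (f x) (g x))"
  unfolding G_hat_expand by (intro continuous_intros)

lemma root_branches:
  assumes s0: "distinct_roots U\<^sub>0 s\<^sub>0"
  obtains N S where "open N" "U\<^sub>0 \<in> N" "continuous_on N S" "S U\<^sub>0 = s\<^sub>0" "\<And>U. U \<in> N \<Longrightarrow> distinct_roots U (S U)"
proof -
  let ?D = "(\<lambda>(i, j). norm (s\<^sub>0 $ i - s\<^sub>0 $ j)) ` {(i, j). i \<noteq> j}"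
  \<comment> \<open>Half the least distance: the \<delta>-discs about the entries of
    \<open>s\<^sub>0\<close> are disjoint, so for U in N each contains exactly one root.\<close>
  define \<delta> where "\<delta> = Min ?D / 2"
  have "(1, 2) \<in> {(i::4, j). i \<noteq> j}" by simp
  then have ne: "?D \<noteq> {}" "finite ?D" by blast auto
  have "d > 0" if "d \<in> ?D" for d
    using that distinct_roots_neq[OF s0] by auto
  then have \<delta>: "\<delta> > 0" using ne by (simp add: \<delta>_def)
  have sep: "2 * \<delta> \<le> norm (s\<^sub>0 $ i - s\<^sub>0 $ j)" if "i \<noteq> j" for i j
  proof -
    have "norm (s\<^sub>0 $ i - s\<^sub>0 $ j) \<in> ?D" using that by (intro image_eqI[of _ _ "(i, j)"]) auto
    then show ?thesis using Min_le[OF ne(2)] by (simp add: \<delta>_def)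
  qed
  define N where "N = {U. U $ 3 \<noteq> 0} \<inter> (\<Inter>i. {U. norm (G_hat U (s\<^sub>0 $ i)) < norm (U $ 3) * \<delta> ^ 4})"
  have N: "U $ 3 \<noteq> 0" "norm (G_hat U (s\<^sub>0 $ i)) < norm (U $ 3) * \<delta> ^ 4" if "U \<in> N" for U i
    using that by (auto simp: N_def)
  have "open N"
    unfolding N_def
    by (intro open_Int open_INT open_Collect_neq open_Collect_less continuous_intros ballI) auto
  have "U\<^sub>0 \<in> N"
    using \<delta> distinct_roots_U3[OF s0] distinct_roots_root[OF s0] by (auto simp: N_def)
  define S where "S U = (\<chi> i. SOME \<eta>. G_hat U \<eta> = 0 \<and> norm (s\<^sub>0 $ i - \<eta>) < \<delta>)" for U
  have S: "G_hat U (S U $ i) = 0 \<and> norm (s\<^sub>0 $ i - S U $ i) < \<delta>" if UN: "U \<in> N" for U i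
  proof -
    obtain \<eta> where "G_hat U \<eta> = 0 \<and> norm (s\<^sub>0 $ i - \<eta>) < \<delta>"
      using root_near[OF N[OF UN] \<delta>] by blast
    then show ?thesis unfolding S_def vec_lambda_beta by (rule someI)
  qed
  have far: "norm (s\<^sub>0 $ i - \<eta>) < \<delta> \<Longrightarrow> norm (s\<^sub>0 $ j - \<eta>) < \<delta> \<Longrightarrow> i = j" for i j \<eta>
    using norm_triangle_ineq4[of "s\<^sub>0 $ i - \<eta>" "s\<^sub>0 $ j - \<eta>"] sep[of i j] by fastforce
  have dist: "distinct_roots U (S U)" if "U \<in> N" for U
  proof -
    have inj: "inj (($) (S U))"
      using S[OF that] far by (metis injI)
    have "range (($) (S U)) \<subseteq> {\<zeta>. G_hat U \<zeta> = 0}" using S[OF that] by auto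
    moreover have "card (range (($) (S U))) = 4"
      using card_image[OF inj] by (simp del: card_image)
    ultimately have "range (($) (S U)) = {\<zeta>. G_hat U \<zeta> = 0}"
      using card_roots_le[OF N(1)[OF that]] by (intro card_seteq) auto
    then show ?thesis using inj by (simp add: distinct_roots_def)
  qed
  have uniq: "\<eta> = S U $ i" if U: "U \<in> N" "G_hat U \<eta> = 0" "norm (s\<^sub>0 $ i - \<eta>) < \<delta>" for U \<eta> i
  proof -
    obtain j where "\<eta> = S U $ j"
      using dist[OF U(1)] U(2) unfolding distinct_roots_def by blast
    then show ?thesis using far[of i \<eta> j] S[OF U(1), of j] U(3) by auto
  qed
  have "continuous_on N S"
  proof (subst continuous_on_eq_continuous_at[OF \<open>open N\<close>], intro ballI, unfold isCont_def, rule vec_tendstoI, rule tendstoI)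
    fix U\<^sub>1 i and e :: real assume U1: "U\<^sub>1 \<in> N" and "e > 0"
    define \<zeta> where "\<zeta> = S U\<^sub>1 $ i"
    \<comment> \<open>The second bound keeps the root found near \<zeta> inside the i-th disc, where
      it must be the chosen branch.\<close>
    define e' where "e' = min e (\<delta> - norm (s\<^sub>0 $ i - \<zeta>))"
    have e': "e' > 0" using \<open>e > 0\<close> S[OF U1, of i] by (simp add: e'_def \<zeta>_def)
    have "open {U. norm (G_hat U \<zeta>) < norm (U $ 3) * e' ^ 4}"
      by (intro open_Collect_less continuous_intros)
    moreover have "U\<^sub>1 \<in> {U. norm (G_hat U \<zeta>) < norm (U $ 3) * e' ^ 4}"
      using S[OF U1, of i] N(1)[OF U1] e' by (simp add: \<zeta>_def)
    ultimately have "\<forall>\<^sub>F U in at U\<^sub>1. norm (G_hat U \<zeta>) < norm (U $ 3) * e' ^ 4"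
      using eventually_at_topological by blast
    moreover have "\<forall>\<^sub>F U in at U\<^sub>1. U \<in> N"
      using \<open>open N\<close> U1 eventually_at_topological by blast
    ultimately show "\<forall>\<^sub>F U in at U\<^sub>1. dist (S U $ i) (S U\<^sub>1 $ i) < e"
    proof eventually_elim
      case (elim U)
      obtain \<eta> where \<eta>: "G_hat U \<eta> = 0" "norm (\<zeta> - \<eta>) < e'"
        using root_near[OF N(1)[OF elim(2)] elim(1) e'] by blast
      have "norm (s\<^sub>0 $ i - \<eta>) \<le> norm (s\<^sub>0 $ i - \<zeta>) + norm (\<zeta> - \<eta>)"
        using norm_triangle_ineq[of "s\<^sub>0 $ i - \<zeta>" "\<zeta> - \<eta>"] by simp
      also have "\<dots> < \<delta>" using \<eta>(2) by (simp add: e'_def)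
      finally have "\<eta> = S U $ i" by (rule uniq[OF elim(2) \<eta>(1)])
      then show ?case using \<eta>(2) by (simp add: dist_norm norm_minus_commute \<zeta>_def e'_def)
    qed
  qed
  moreover have "s\<^sub>0 $ i = S U\<^sub>0 $ i" for i
    by (rule uniq[OF \<open>U\<^sub>0 \<in> N\<close> distinct_roots_root[OF s0]]) (use \<delta> in simp)
  then have "S U\<^sub>0 = s\<^sub>0" by (simp add: vec_eq_iff)
  ultimately show thesis using that \<open>open N\<close> \<open>U\<^sub>0 \<in> N\<close> dist by blast
qed

section \<open>The Riemann map as a coordinate system\<close>

lemma has_derivative_vecI:
  fixes f :: "'a::euclidean_space \<Rightarrow> 'b::real_normed_vector^'n"
  assumes "\<And>i. ((\<lambda>x. f x $ i) has_derivative (\<lambda>h. f' h $ i)) (at x)"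
  shows "(f has_derivative f') (at x)"
proof -
  have l: "linear (\<lambda>h. f' h $ i)" for i
    using assms has_derivative_linear by blast
  have "linear f'"
    by (rule linearI) (simp_all add: vec_eq_iff linear_add[OF l] linear_scale[OF l])
  then have "bounded_linear f'" by (simp add: linear_conv_bounded_linear)
  moreover have "((\<lambda>y. (f y - f x - f' (y - x)) /\<^sub>R norm (y - x)) \<longlongrightarrow> 0) (at x)"
    by (rule vec_tendstoI) (use assms in \<open>simp add: has_derivative_at_within\<close>)
  ultimately show ?thesis by (simp add: has_derivative_at_within)
qed

lemma F_lin_scale: "F_lin (c *s W) s = c * F_lin W s"
  by (simp add: F_lin_def algebra_simps)

lemma G_lin_scale: "G_lin (c *s W) s = c * G_lin W s"
  by (simp add: G_lin_def F_lin_def F_lin'_def algebra_simps)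

text \<open>
  The variation of the field variables along the coordinate \<open>r\<^sub>i\<close>: its polynomial vanishes at the
  three other roots.
\<close>

lemma riemann_coordinate_variation:
  assumes s: "distinct_roots U s" and nz: "1 + (s $ i)\<^sup>2 \<noteq> 0"
  obtains W where "\<And>m. F_lin W (s $ m) / (1 + (s $ m)\<^sup>2)\<^sup>2 = (if m = i then 1 else 0)" "W $ 3 \<noteq> 0"
    "2 * G_hat' U (s $ i) * (W $ 3 * s $ i) - 2 * U $ 3 * G_lin W (s $ i) =
      W $ 3 * ((1 + (s $ i)\<^sup>2) * G_hat'' U (s $ i) - 6 * s $ i * G_hat' U (s $ i))"
proof -
  obtain j k l where ijkl: "\<And>m. m = i \<or> m = j \<or> m = k \<or> m = l" "j \<noteq> i" "k \<noteq> i" "l \<noteq> i"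
    using four_indices by blast
  define a b c d where abcd: "a = s $ i" "b = s $ j" "c = s $ k" "d = s $ l"
  have rng: "{a, b, c, d} = range (($) s)"
    unfolding abcd by (rule four_indices_range[OF ijkl(1)])
  have neq: "a - b \<noteq> 0" "a - c \<noteq> 0" "a - d \<noteq> 0"
    using distinct_roots_neq[OF s] ijkl unfolding abcd by auto
  \<comment> \<open>Normalizes the cubic \<kappa> (\<zeta> - b) (\<zeta> - c) (\<zeta> - d) to the
    value (1 + a^2)^2 at a, which makes the variation of r_i equal to 1.\<close>
  define \<kappa> where "\<kappa> = (1 + a\<^sup>2)\<^sup>2 / ((a - b) * (a - c) * (a - d))"
  define W :: "complex^4" where "W = (\<chi> m. if m = 0 then - \<kappa> * (b * c * d) else if m = 1 then \<kappa> * (b * c + b * d + c * d)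
    else if m = 2 then - \<kappa> * (b + c + d) else \<kappa>)"
  have W: "W $ 0 = - \<kappa> * (b * c * d)" "W $ 1 = \<kappa> * (b * c + b * d + c * d)" "W $ 2 = - \<kappa> * (b + c + d)" "W $ 3 = \<kappa>"
    by (simp_all add: W_def)
  have F: "F_lin W \<zeta> = \<kappa> * ((\<zeta> - b) * (\<zeta> - c) * (\<zeta> - d))" for \<zeta>
    unfolding F_lin_def W by algebra
  show thesis
  proof (rule that[of W])
    show "F_lin W (s $ m) / (1 + (s $ m)\<^sup>2)\<^sup>2 = (if m = i then 1 else 0)" for m
    proof (cases "m = i")
      case True
      then show ?thesis using nz neq by (simp add: F \<kappa>_def abcd)
    next
      case False
      then have "m = j \<or> m = k \<or> m = l" using ijkl(1) by blast
      then show ?thesis using False by (auto simp: F abcd)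
    qed
    show "W $ 3 \<noteq> 0" using nz neq by (simp add: W \<kappa>_def abcd)
    \<comment> \<open>The left side is 2 G' times the variation of the eigenvalue U_3 s along W, the
      root moving by - G_lin W / G'.\<close>
    show "2 * G_hat' U (s $ i) * (W $ 3 * s $ i) - 2 * U $ 3 * G_lin W (s $ i) =
      W $ 3 * ((1 + (s $ i)\<^sup>2) * G_hat'' U (s $ i) - 6 * s $ i * G_hat' U (s $ i))"
      unfolding abcd(1)[symmetric] G_hat'_root(2)[OF s rng] unfolding G_hat'_root(1)[OF s rng]
      unfolding G_lin_def F_lin_def F_lin'_def W by algebra
  qed
qed

text \<open>The inverse function theorem makes the Riemann map a chart: its differential reads off,
  up to nonzero factors, the cubic F_lin W at four distinct points, hence is injective. The
  eigenvalue then has derivative W_3 / (2 G') times the expression in the last hypothesis.\<close>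

lemma genuinely_nonlinearI:
  assumes s0: "distinct_roots U\<^sub>0 s\<^sub>0" and nz: "\<And>m. 1 + (s\<^sub>0 $ m)\<^sup>2 \<noteq> 0"
    and K: "(1 + (s\<^sub>0 $ i)\<^sup>2) * G_hat'' U\<^sub>0 (s\<^sub>0 $ i) - 6 * s\<^sub>0 $ i * G_hat' U\<^sub>0 (s\<^sub>0 $ i) \<noteq> 0"
  shows "genuinely_nonlinear U\<^sub>0 s\<^sub>0 i"
proof -
  obtain N\<^sub>0 S where N0: "open N\<^sub>0" "U\<^sub>0 \<in> N\<^sub>0" "continuous_on N\<^sub>0 S" and S0: "S U\<^sub>0 = s\<^sub>0"
    and dist0: "\<And>U. U \<in> N\<^sub>0 \<Longrightarrow> distinct_roots U (S U)"
    using root_branches[OF s0] by blast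
  \<comment> \<open>Shrunk so that no root is \<plusminus>i, where the invariants are
    singular.\<close>
  define N where "N = N\<^sub>0 \<inter> S -` (\<Inter>m. {v. 1 + (v $ m)\<^sup>2 \<noteq> 0})"
  have N: "open N" "U\<^sub>0 \<in> N"
    unfolding N_def using N0 nz S0
    by (auto intro!: continuous_open_preimage open_INT open_Collect_neq continuous_intros)
  have dist: "distinct_roots U (S U)" and nzN: "1 + (S U $ m)\<^sup>2 \<noteq> 0" if "U \<in> N" for U m
    using that dist0 by (auto simp: N_def)
  have contS: "continuous_on N S" using N0(3) by (rule continuous_on_subset) (auto simp: N_def)
  have isCont: "isCont S U" if "U \<in> N" for U
    using contS N(1) that by (simp add: continuous_on_eq_continuous_at)
  have ev: "\<forall>\<^sub>F V in nhds U. distinct_roots V (S V)" if "U \<in> N" for U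
    using eventually_nhds_in_open[OF N(1) that] by (rule eventually_mono) (rule dist)
  define R where "R = riemann_map S"
  define DR where "DR U = (\<lambda>W. \<chi> m. F_lin W (S U $ m) / (1 + (S U $ m)\<^sup>2)\<^sup>2)" for U
  have derR: "(R has_derivative DR U) (at U)" if "U \<in> N" for U
  proof (rule has_derivative_vecI)
    show "((\<lambda>U. R U $ m) has_derivative (\<lambda>h. DR U h $ m)) (at U)" for m
      using riemann_invariant_has_derivative[OF has_derivative_ident isCont[OF that] ev[OF that] nzN[OF that], of m]
      by (simp add: R_def riemann_map_def DR_def)
  qed
  have app: "blinfun_apply (Blinfun (DR U)) = DR U" if "U \<in> N" for U
    using derR[OF that] by (intro bounded_linear_Blinfun_apply has_derivative_bounded_linear)
  have contDR: "continuous_on N (\<lambda>U. Blinfun (DR U))"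
  proof (rule continuous_on_blinfun_componentwise)
    fix b :: "complex^4"
    have "continuous_on N (\<lambda>U. DR U b)"
      unfolding DR_def F_lin_def using contS nzN by (intro continuous_intros) auto
    then show "continuous_on N (\<lambda>U. blinfun_apply (Blinfun (DR U)) b)"
      by (rule continuous_on_eq) (simp add: app)
  qed
  have linear: "linear (DR U\<^sub>0)" using derR[OF N(2)] has_derivative_linear by blast
  have ker: "W = 0" if "DR U\<^sub>0 W = 0" for W
  proof (rule F_lin_eq_zero_imp[OF distinct_roots_card[OF s0]])
    fix \<zeta> assume "\<zeta> \<in> range (($) s\<^sub>0)"
    then obtain m where "\<zeta> = s\<^sub>0 $ m" by auto
    moreover have "DR U\<^sub>0 W $ m = 0" using that by simp
    ultimately show "F_lin W \<zeta> = 0" using nz[of m] by (simp add: DR_def S0)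
  qed
  then have inj: "inj (DR U\<^sub>0)" using linear by (simp add: linear_injective_0)
  then obtain I where I: "linear I" "I \<circ> DR U\<^sub>0 = id"
    using linear_injective_left_inverse[OF linear] by blast
  then have "Blinfun I o\<^sub>L Blinfun (DR U\<^sub>0) = id_blinfun"
    by (intro blinfun_eqI) (simp add: app[OF N(2)] bounded_linear_Blinfun_apply linear_conv_bounded_linear o_def id_def fun_eq_iff)
  then obtain N' V\<^sub>R V V' where N': "open N'" "N' \<subseteq> N" "U\<^sub>0 \<in> N'" and VR: "open V\<^sub>R" "R U\<^sub>0 \<in> V\<^sub>R"
    and hom: "homeomorphism N' V\<^sub>R R V"
    and derV: "\<And>y. y \<in> V\<^sub>R \<Longrightarrow> (V has_derivative V' y) (at y)"
    and V': "\<And>y. y \<in> V\<^sub>R \<Longrightarrow> V' y = inv (blinfun_apply (Blinfun (DR (V y))))"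
    using inverse_function_theorem[OF N(1) _ contDR N(2), of R] derR app by metis
  have RN': "R ` N' = V\<^sub>R" using hom by (simp add: homeomorphism_def)
  have "R differentiable_on N'"
    using derR N'(2) unfolding differentiable_on_def differentiable_def
    by (meson has_derivative_at_withinI subsetD)
  moreover have "V differentiable_on V\<^sub>R"
    using derV unfolding differentiable_on_def differentiable_def
    by (meson has_derivative_at_withinI)
  ultimately have coords: "riemann_coordinates U\<^sub>0 s\<^sub>0 N' S V"
    unfolding riemann_coordinates_def Let_def R_def[symmetric] RN'
    using N' VR hom S0 dist continuous_on_subset[OF contS N'(2)] by auto
  have VU: "V (R U\<^sub>0) = U\<^sub>0" using hom N'(3) by (simp add: homeomorphism_def)
  obtain W where W: "\<And>m. F_lin W (s\<^sub>0 $ m) / (1 + (s\<^sub>0 $ m)\<^sup>2)\<^sup>2 = (if m = i then 1 else 0)" "W $ 3 \<noteq> 0"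
    "2 * G_hat' U\<^sub>0 (s\<^sub>0 $ i) * (W $ 3 * s\<^sub>0 $ i) - 2 * U\<^sub>0 $ 3 * G_lin W (s\<^sub>0 $ i) =
      W $ 3 * ((1 + (s\<^sub>0 $ i)\<^sup>2) * G_hat'' U\<^sub>0 (s\<^sub>0 $ i) - 6 * s\<^sub>0 $ i * G_hat' U\<^sub>0 (s\<^sub>0 $ i))"
    using riemann_coordinate_variation[OF s0 nz] by blast
  \<comment> \<open>V' inverts the differential of the Riemann map, and W is the vector which that
    differential sends to the i-th unit vector.\<close>
  have V'_axis: "V' (R U\<^sub>0) (axis i \<tau>) = \<tau> *s W" for \<tau>
  proof -
    have "DR U\<^sub>0 (\<tau> *s W) = axis i \<tau>"
      unfolding vec_eq_iff using W(1) by (auto simp: DR_def S0 F_lin_scale axis_def simp flip: times_divide_eq_right)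
    then show ?thesis
      using inj by (simp add: V'[OF VR(2)] VU app[OF N(2)] inv_f_eq)
  qed
  define g where "g \<tau> = V (R U\<^sub>0 + axis i \<tau>)" for \<tau>
  have g0: "g 0 = U\<^sub>0" by (simp add: g_def VU axis_def zero_vec_def[symmetric])
  have lin_axis: "linear (axis i :: complex \<Rightarrow> complex^4)"
    by (rule linearI) (simp_all add: vec_eq_iff axis_def)
  have g: "(g has_derivative (\<lambda>\<tau>. \<tau> *s W)) (at 0)"
  proof -
    have "((\<lambda>\<tau>. R U\<^sub>0 + axis i \<tau>) has_derivative (\<lambda>\<tau>. 0 + axis i \<tau>)) (at 0)"
      using lin_axis
      by (intro has_derivative_add has_derivative_const linear_imp_has_derivative)
    moreover have "(V has_derivative V' (R U\<^sub>0)) (at (R U\<^sub>0 + axis i 0))"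
      using derV[OF VR(2)] by (simp add: axis_def zero_vec_def[symmetric])
    ultimately have "((\<lambda>\<tau>. V (R U\<^sub>0 + axis i \<tau>)) has_derivative (\<lambda>\<tau>. V' (R U\<^sub>0) (0 + axis i \<tau>))) (at 0)"
      by (rule has_derivative_compose)
    then show ?thesis by (simp add: g_def[abs_def] V'_axis)
  qed
  have Sg: "isCont (\<lambda>\<tau>. S (g \<tau>)) 0"
    using isCont_o2[OF has_derivative_continuous[OF g], of S] isCont[OF N(2)] by (simp add: g0)
  have evg: "\<forall>\<^sub>F \<tau> in nhds 0. distinct_roots (g \<tau>) (S (g \<tau>))"
  proof -
    have "(g \<longlongrightarrow> g 0) (nhds 0)"
      using has_derivative_continuous[OF g] unfolding isCont_def tendsto_at_iff_tendsto_nhds .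
    then have "(g \<longlongrightarrow> U\<^sub>0) (nhds 0)" by (simp only: g0)
    then show ?thesis
      using ev[OF N(2)] by (rule eventually_compose_filterlim[rotated])
  qed
  define D where "D = W $ 3 * s\<^sub>0 $ i - U\<^sub>0 $ 3 * (G_lin W (s\<^sub>0 $ i) / G_hat' U\<^sub>0 (s\<^sub>0 $ i))"
  have "((\<lambda>\<tau>. g \<tau> $ 3 * S (g \<tau>) $ i) has_derivative
      (\<lambda>\<tau>. g 0 $ 3 * (- G_lin (\<tau> *s W) (S (g 0) $ i) / G_hat' (g 0) (S (g 0) $ i)) + (\<tau> *s W) $ 3 * S (g 0) $ i)) (at 0)"
    by (intro has_derivative_mult root_has_derivative[OF g Sg evg] bounded_linear.has_derivative[OF bounded_linear_vec_nth g])
  moreover have "(\<lambda>\<tau>. g 0 $ 3 * (- G_lin (\<tau> *s W) (S (g 0) $ i) / G_hat' (g 0) (S (g 0) $ i)) + (\<tau> *s W) $ 3 * S (g 0) $ i) = (*) D"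
    by (simp add: fun_eq_iff g0 S0 G_lin_scale D_def algebra_simps)
  ultimately have "((\<lambda>\<tau>. let U = V (riemann_map S U\<^sub>0 + axis i \<tau>) in eigenvalue U (S U $ i)) has_field_derivative D) (at 0)"
    by (simp add: has_field_derivative_def eigenvalue_def Let_def R_def[symmetric] g_def)
  then have "has_riemann_derivative U\<^sub>0 s\<^sub>0 i D"
    unfolding has_riemann_derivative_def using coords by blast
  moreover have "D \<noteq> 0"
  proof
    assume "D = 0"
    moreover have "2 * G_hat' U\<^sub>0 (s\<^sub>0 $ i) * D = 2 * G_hat' U\<^sub>0 (s\<^sub>0 $ i) * (W $ 3 * s\<^sub>0 $ i) - 2 * U\<^sub>0 $ 3 * G_lin W (s\<^sub>0 $ i)"
      using G_hat'_nonzero[OF s0, of i] by (simp add: D_def field_simps)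
    ultimately show False using W(2,3) K by simp
  qed
  ultimately show ?thesis unfolding genuinely_nonlinear_def by blast
qed

section \<open>The quasi-linear system\<close>

lemma inner_matrix_symmetric:
  fixes M :: "real^2^2"
  assumes "transpose M = M"
  shows "v \<bullet> (M *v w) = w \<bullet> (M *v v)"
  by (metis assms dot_lmul_matrix inner_commute transpose_matrix_vector)

section \<open>Orthonormal frames and the dual metric\<close>

locale orthonormal_frame =
  fixes M :: "real^2^2" and e1 e2 :: "real^2"
  assumes sym: "transpose M = M" and pos: "\<And>v. v \<noteq> 0 \<Longrightarrow> v \<bullet> (M *v v) > 0"
    and e: "e1 \<bullet> (M *v e1) = 1" "e1 \<bullet> (M *v e2) = 0" "e2 \<bullet> (M *v e2) = 1"
begin

lemma e21: "e2 \<bullet> (M *v e1) = 0"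
  using e(2) inner_matrix_symmetric[OF sym] by metis

lemma expansion: "v = (e1 \<bullet> (M *v v)) *\<^sub>R e1 + (e2 \<bullet> (M *v v)) *\<^sub>R e2"
proof -
  have e20: "e2 \<noteq> 0" using e(3) by auto
  have "e1 \<notin> span {e2}"
  proof
    assume "e1 \<in> span {e2}"
    then obtain c where c: "e1 = c *\<^sub>R e2" by (auto simp: span_singleton)
    then have "c = 0" using e(2,3) by simp
    then show False using c e(1) by simp
  qed
  moreover from this have "e1 \<noteq> e2" using span_base[of e2 "{e2}"] by auto
  ultimately have "independent {e1, e2}" "e1 \<noteq> e2"
    using e20 by (simp_all add: independent_insert)
  then obtain \<alpha> \<beta> where v: "v = \<alpha> *\<^sub>R e1 + \<beta> *\<^sub>R e2"
    using plane_lattice_span by blast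
  have "e1 \<bullet> (M *v v) = \<alpha>" "e2 \<bullet> (M *v v) = \<beta>"
    unfolding v by (simp_all add: matrix_vector_right_distrib inner_add_right matrix_vector_mult_scaleR e e21)
  then show ?thesis using v by simp
qed

text \<open>The dual norm is Euclidean in the components along an orthonormal frame. This removes
  the matrix inverse from the Hamiltonian.\<close>

lemma inverse_form: "P \<bullet> (matrix_inv M *v P) = (P \<bullet> e1)\<^sup>2 + (P \<bullet> e2)\<^sup>2"
proof -
  have "\<forall>v. M *v v = 0 \<longrightarrow> v = 0"
    using pos by (metis inner_zero_right less_irrefl)
  then have "invertible M"
    using matrix_left_invertible_ker[of M] invertible_left_inverse by blast
  then have "M ** matrix_inv M = mat 1"
    unfolding invertible_def matrix_inv_def by (rule someI_ex[THEN conjunct1])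
  then have P: "M *v (matrix_inv M *v P) = P"
    by (simp add: matrix_vector_mul_assoc)
  define v where "v = matrix_inv M *v P"
  have "P \<bullet> v = P \<bullet> ((e1 \<bullet> P) *\<^sub>R e1 + (e2 \<bullet> P) *\<^sub>R e2)"
    using expansion[of v] P by (simp add: v_def)
  then show ?thesis
    by (simp add: inner_add_right v_def power2_eq_square inner_commute)
qed

lemma covector_with_components:
  obtains P where "P \<bullet> e1 = q" "P \<bullet> e2 = p"
    "\<And>v. P \<bullet> v = q * (e1 \<bullet> (M *v v)) + p * (e2 \<bullet> (M *v v))"
proof (rule that[of "M *v (q *\<^sub>R e1 + p *\<^sub>R e2)"])
  show *: "(M *v (q *\<^sub>R e1 + p *\<^sub>R e2)) \<bullet> v = q * (e1 \<bullet> (M *v v)) + p * (e2 \<bullet> (M *v v))" for v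
    unfolding inner_commute[of _ v] inner_matrix_symmetric[OF sym, of v] by (simp add: inner_add_left)
  show "(M *v (q *\<^sub>R e1 + p *\<^sub>R e2)) \<bullet> e1 = q" "(M *v (q *\<^sub>R e1 + p *\<^sub>R e2)) \<bullet> e2 = p"
    unfolding * by (simp_all add: e e21)
qed

lemma orthonormal_frame_change:
  assumes "orthonormal_frame M f1 f2"
  obtains \<alpha> \<gamma> \<epsilon> where "\<alpha>\<^sup>2 + \<gamma>\<^sup>2 = 1" "\<epsilon>\<^sup>2 = 1"
    "f1 = \<alpha> *\<^sub>R e1 + \<gamma> *\<^sub>R e2" "f2 = (- \<epsilon> * \<gamma>) *\<^sub>R e1 + (\<epsilon> * \<alpha>) *\<^sub>R e2"
proof -
  interpret f: orthonormal_frame M f1 f2 by fact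
  define a b c d where abcd: "a = e1 \<bullet> (M *v f1)" "b = e1 \<bullet> (M *v f2)" "c = e2 \<bullet> (M *v f1)" "d = e2 \<bullet> (M *v f2)"
  have f1: "f1 = a *\<^sub>R e1 + c *\<^sub>R e2" and f2: "f2 = b *\<^sub>R e1 + d *\<^sub>R e2"
    unfolding abcd by (rule expansion)+
  have ip: "(x *\<^sub>R e1 + y *\<^sub>R e2) \<bullet> (M *v (x' *\<^sub>R e1 + y' *\<^sub>R e2)) = x * x' + y * y'" for x y x' y'
    by (simp add: matrix_vector_right_distrib inner_add_right inner_add_left matrix_vector_mult_scaleR e e21)
  have 1: "a * a + c * c = 1" "a * b + c * d = 0" "b * b + d * d = 1"
    using f.e unfolding f1 f2 ip by auto
  define \<epsilon> where "\<epsilon> = a * d - b * c"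
  have "\<epsilon>\<^sup>2 = 1" "b = - \<epsilon> * c" "d = \<epsilon> * a"
    using 1 unfolding \<epsilon>_def by algebra+
  then show thesis
    using 1(1) f1 f2 by (intro that[of a c \<epsilon>]) (simp_all add: power2_eq_square)
qed

end

lemma field_vars_nth [simp]:
  "field_vars a z $ 0 = complex_of_real (a 0 z)" "field_vars a z $ 1 = complex_of_real (a 1 z)"
  "field_vars a z $ 2 = complex_of_real (a 2 z)" "field_vars a z $ 3 = complex_of_real (a 3 z)"
  by (simp_all add: field_vars_def)

lemma field_vars_real: "field_vars a z $ k \<in> \<real>"
  by (simp add: field_vars_def)

lemma smooth_on_d:
  assumes "smooth_on UNIV (f :: real \<times> real \<Rightarrow> 'b::real_normed_vector)"
  shows "frechet_derivative f (at z) (\<xi>, \<eta>) = \<xi> *\<^sub>R d_t f z + \<eta> *\<^sub>R d_x f z"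
proof -
  note l = has_derivative_linear[OF smooth_on_has_derivative[OF assms, of z]]
  have "(\<xi>, \<eta>) = \<xi> *\<^sub>R (1, 0) + \<eta> *\<^sub>R (0, 1::real)" by simp
  then show ?thesis
    unfolding d_t_def d_x_def by (metis linear_add[OF l] linear_scale[OF l])
qed

text \<open>The coefficients are free, the top one included, so that it also applies to the
  derivatives of the \<open>a k\<close>, whose top coefficient is 0 instead of 1.\<close>

definition fibre_poly :: "(nat \<Rightarrow> real) \<Rightarrow> real \<Rightarrow> real \<Rightarrow> real" where
  "fibre_poly c q p = (\<Sum>k\<le>4. c k * q ^ (4 - k) * p ^ k)"

lemma fibre_poly_eq:
  "fibre_poly c q p = c 0 * q ^ 4 + c 1 * q ^ 3 * p + c 2 * q ^ 2 * p ^ 2 + c 3 * q * p ^ 3 + c 4 * p ^ 4"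
  by (simp add: fibre_poly_def sum_atMost_4)

section \<open>The bracket condition in semi-geodesic coordinates\<close>

locale quartic_integral =
  fixes \<Gamma> :: "(real^2) set" and \<rho> :: "real^2 \<Rightarrow> real^2^2" and F :: "(real^2) \<times> (real^2) \<Rightarrow> real"
    and L :: "((real^2) \<times> (real^2)) set" and \<Phi> :: "real \<times> real \<Rightarrow> real^2"
    and g :: "real \<times> real \<Rightarrow> real" and a :: "nat \<Rightarrow> real \<times> real \<Rightarrow> real"
  assumes metric: "torus_metric \<Gamma> \<rho>" and integral: "quartic_first_integral \<Gamma> \<rho> F"
    and coords: "semi_geodesic_coordinates \<rho> L \<Phi> g" and coeffs: "normalized_coefficients F \<Phi> g a"
begin

lemma smooth_Phi: "smooth_on UNIV \<Phi>" "smooth_on UNIV (inv \<Phi>)" and bij_Phi: "bij \<Phi>"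
  and smooth_g: "smooth_on UNIV g" and g_pos: "g z > 0"
  using coords unfolding semi_geodesic_coordinates_def by blast+

lemma metric_coords: "metric_inner \<rho> (\<Phi> z) (d_t \<Phi> z) (d_t \<Phi> z) = (g z)\<^sup>2"
  "metric_inner \<rho> (\<Phi> z) (d_t \<Phi> z) (d_x \<Phi> z) = 0" "metric_inner \<rho> (\<Phi> z) (d_x \<Phi> z) (d_x \<Phi> z) = 1"
  using coords unfolding semi_geodesic_coordinates_def by blast+

lemma smooth_a: "k \<le> 4 \<Longrightarrow> smooth_on UNIV (a k)" and a3: "a 3 z = g z" and a4: "a 4 z = 1"
  using coeffs unfolding normalized_coefficients_def by blast+

lemma frame: "orthonormal_frame (\<rho> (\<Phi> z)) (d_t \<Phi> z /\<^sub>R g z) (d_x \<Phi> z)"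
proof
  show "transpose (\<rho> (\<Phi> z)) = \<rho> (\<Phi> z)" "\<And>v. v \<noteq> 0 \<Longrightarrow> 0 < v \<bullet> (\<rho> (\<Phi> z) *v v)"
    using metric unfolding torus_metric_def by blast+
qed (use metric_coords[of z] g_pos[of z] in \<open>simp_all add: metric_inner_def
    matrix_vector_mult_scaleR power2_eq_square field_simps\<close>)

text \<open>Corresponds to p_1 / g. The covector P is fixed in the original plane, so its components
  along the frame vary with z.\<close>

definition mom_q :: "real^2 \<Rightarrow> real \<times> real \<Rightarrow> real" where
  "mom_q P z = P \<bullet> d_t \<Phi> z / g z"

definition mom_p :: "real^2 \<Rightarrow> real \<times> real \<Rightarrow> real" where
  "mom_p P z = P \<bullet> d_x \<Phi> z"

lemma F_eq: "F (\<Phi> z, P) = fibre_poly (\<lambda>k. a k z) (mom_q P z) (mom_p P z)"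
proof -
  have "F (\<Phi> z, P) = (\<Sum>k\<le>4. a k z * (P \<bullet> d_t \<Phi> z) ^ (4 - k) / g z ^ (4 - k) * (P \<bullet> d_x \<Phi> z) ^ k)"
    using coeffs unfolding normalized_coefficients_def by blast
  then show ?thesis
    by (simp add: fibre_poly_def mom_q_def mom_p_def power_divide)
qed

lemma inner_frame: "P \<bullet> (d_t \<Phi> z /\<^sub>R g z) = mom_q P z" "P \<bullet> d_x \<Phi> z = mom_p P z"
  by (simp_all add: mom_q_def mom_p_def divide_inverse mult.commute)

lemma H_eq: "geodesic_hamiltonian \<rho> (\<Phi> z, P) = ((mom_q P z)\<^sup>2 + (mom_p P z)\<^sup>2) / 2"
  unfolding geodesic_hamiltonian_def case_prod_conv orthonormal_frame.inverse_form[OF frame] inner_frame ..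

lemma smooth_mom: "smooth_on UNIV (mom_q P)" "smooth_on UNIV (mom_p P)"
  unfolding mom_q_def[abs_def] mom_p_def[abs_def] using g_pos
  by (intro smooth_intros smooth_Phi smooth_g; simp add: less_imp_neq[symmetric])+

lemma smooth_F: "smooth_on UNIV F"
proof -
  obtain c where c: "\<And>k. k \<le> 4 \<Longrightarrow> smooth_on UNIV (c k)"
    and F: "\<And>y p. F (y, p) = (\<Sum>k\<le>4. c k y * (p $ 1) ^ (4 - k) * (p $ 2) ^ k)"
    using integral unfolding quartic_first_integral_def quartic_in_momenta_def by blast
  have "F = (\<lambda>w. \<Sum>k\<le>4. c k (fst w) * (snd w $ 1) ^ (4 - k) * (snd w $ 2) ^ k)"
    by (simp add: fun_eq_iff F)
  moreover have c': "smooth_on UNIV (\<lambda>w :: (real^2) \<times> (real^2). c k (fst w))" if "k \<le> 4" for k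
    by (intro smooth_on_compose[OF c[OF that]] smooth_on_linear bounded_linear_fst)
  moreover have snd: "smooth_on UNIV (\<lambda>w :: (real^2) \<times> (real^2). snd w $ i)" for i
    by (intro smooth_on_linear bounded_linear_compose[OF bounded_linear_vec_nth] bounded_linear_snd)
  have "smooth_on UNIV (\<lambda>w :: (real^2) \<times> (real^2). \<Sum>k\<le>4. c k (fst w) * (snd w $ 1) ^ (4 - k) * (snd w $ 2) ^ k)"
    by (intro smooth_on_sum smooth_on_mult smooth_on_power snd c') simp
  ultimately show ?thesis by simp
qed

text \<open>Through the chart H becomes a sum of two squares, so smoothness of the matrix inverse is
  not at issue.\<close>

lemma smooth_H: "smooth_on UNIV (geodesic_hamiltonian \<rho>)"
proof -
  define \<Psi> where "\<Psi> = inv \<Phi>"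
  have surj: "\<Phi> (\<Psi> y) = y" for y
    using bij_Phi by (simp add: \<Psi>_def bij_is_surj surj_f_inv_f)
  have "geodesic_hamiltonian \<rho> = (\<lambda>w. ((snd w \<bullet> d_t \<Phi> (\<Psi> (fst w)) / g (\<Psi> (fst w)))\<^sup>2 +
      (snd w \<bullet> d_x \<Phi> (\<Psi> (fst w)))\<^sup>2) / 2)"
  proof
    fix w show "geodesic_hamiltonian \<rho> w = ((snd w \<bullet> d_t \<Phi> (\<Psi> (fst w)) / g (\<Psi> (fst w)))\<^sup>2 +
      (snd w \<bullet> d_x \<Phi> (\<Psi> (fst w)))\<^sup>2) / 2"
      using H_eq[of "\<Psi> (fst w)" "snd w"] by (simp add: surj mom_q_def mom_p_def)
  qed
  moreover have \<Psi>: "smooth_on UNIV (\<lambda>w :: (real^2) \<times> (real^2). \<Psi> (fst w))"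
    unfolding \<Psi>_def by (intro smooth_on_compose[OF smooth_Phi(2)] smooth_on_linear bounded_linear_fst)
  have snd: "smooth_on UNIV (\<lambda>w :: (real^2) \<times> (real^2). snd w)"
    by (intro smooth_on_linear bounded_linear_snd)
  have "smooth_on UNIV (\<lambda>w :: (real^2) \<times> (real^2). ((snd w \<bullet> d_t \<Phi> (\<Psi> (fst w)) / g (\<Psi> (fst w)))\<^sup>2 +
      (snd w \<bullet> d_x \<Phi> (\<Psi> (fst w)))\<^sup>2) / 2)"
    using g_pos
    by (intro smooth_on_divide smooth_on_add smooth_on_power smooth_on_inner snd smooth_on_const
        smooth_on_compose[OF smooth_on_d_t[OF smooth_Phi(1)] \<Psi>]
        smooth_on_compose[OF smooth_on_d_x[OF smooth_Phi(1)] \<Psi>] smooth_on_compose[OF smooth_g \<Psi>])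
      (simp_all add: less_imp_neq[symmetric])
  ultimately show ?thesis by simp
qed

definition poly_q :: "real \<times> real \<Rightarrow> real \<Rightarrow> real \<Rightarrow> real" where
  "poly_q z q p = 4 * a 0 z * q ^ 3 + 3 * a 1 z * q ^ 2 * p + 2 * a 2 z * q * p ^ 2 + a 3 z * p ^ 3"

definition poly_p :: "real \<times> real \<Rightarrow> real \<Rightarrow> real \<Rightarrow> real" where
  "poly_p z q p = a 1 z * q ^ 3 + 2 * a 2 z * q ^ 2 * p + 3 * a 3 z * q * p ^ 2 + 4 * a 4 z * p ^ 3"

lemma exists_covector:
  obtains P where "mom_q P z = q" "mom_p P z = p"
proof -
  obtain P where "P \<bullet> (d_t \<Phi> z /\<^sub>R g z) = q" "P \<bullet> d_x \<Phi> z = p"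
    using orthonormal_frame.covector_with_components[OF frame] by metis
  then show thesis
    by (intro that[of P]) (simp_all only: inner_frame)
qed

lemma mom_q_d_x: "d_x (mom_q P) z = P \<bullet> d_x (d_t \<Phi>) z / g z - mom_q P z * d_x g z / g z"
proof -
  have g0: "g z \<noteq> 0" using g_pos[of z] by simp
  have "((\<lambda>z. P \<bullet> d_t \<Phi> z) has_derivative (\<lambda>v. P \<bullet> frechet_derivative (d_t \<Phi>) (at z) v)) (at z)"
    by (intro bounded_linear.has_derivative[OF bounded_linear_inner_right] smooth_on_has_derivative smooth_intros smooth_Phi)
  then have "(mom_q P has_derivative (\<lambda>v. (P \<bullet> frechet_derivative (d_t \<Phi>) (at z) v * g z -
      P \<bullet> d_t \<Phi> z * frechet_derivative g (at z) v) / (g z * g z))) (at z)"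
    unfolding mom_q_def[abs_def] using g0
    by (intro has_derivative_divide' smooth_on_has_derivative smooth_g)
  then show ?thesis
    using g0 unfolding d_x_def by (simp add: frechet_derivative_eqI mom_q_def field_simps)
qed

lemma mom_p_d_t: "d_t (mom_p P) z = P \<bullet> d_x (d_t \<Phi>) z"
proof -
  have "d_t (mom_p P) z = P \<bullet> d_t (d_x \<Phi>) z"
    unfolding mom_p_def[abs_def] d_t_def
    by (intro frechet_derivative_bounded_linear bounded_linear_inner_right smooth_intros smooth_Phi)
  then show ?thesis by (simp add: d_t_d_x_commute[OF smooth_Phi(1)])
qed

text \<open>The bracket is computed in the original plane at a fixed covector P. Position
  derivatives are taken along D\<Phi>; besides the derivatives of the \<open>a k\<close> they see
  only how the components of P in the frame vary with z, and this variation yields the term with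
  g_x.\<close>

lemma fibre_identity:
  "q / g z * fibre_poly (\<lambda>k. d_t (a k) z) q p + p * fibre_poly (\<lambda>k. d_x (a k) z) q p +
    q * d_x g z / g z * (q * poly_p z q p - p * poly_q z q p) = 0"
proof -
  obtain P where P: "mom_q P z = q" "mom_p P z = p"
    using exists_covector by blast
  define w where "w = (\<Phi> z, P)"
  define DF where "DF = frechet_derivative F (at w)"
  define DH where "DH = frechet_derivative (geodesic_hamiltonian \<rho>) (at w)"
  let ?Fq = "poly_q z q p" and ?Fp = "poly_p z q p"
  have DF: "(F has_derivative DF) (at w)" and DH: "(geodesic_hamiltonian \<rho> has_derivative DH) (at w)"
    unfolding DF_def DH_def by (intro smooth_on_has_derivative smooth_F smooth_H)+
  have pos: "((\<lambda>z. (\<Phi> z, P)) has_derivative (\<lambda>v. (frechet_derivative \<Phi> (at z) v, 0))) (at z)"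
    by (intro has_derivative_Pair has_derivative_const smooth_on_has_derivative smooth_Phi)
  have mom: "((\<lambda>\<eta>. (\<Phi> z, \<eta>)) has_derivative (\<lambda>\<eta>. (0, \<eta>))) (at P)"
    by (intro has_derivative_Pair has_derivative_const has_derivative_ident)
  have dq: "(mom_q P has_derivative frechet_derivative (mom_q P) (at z)) (at z)"
    and dp: "(mom_p P has_derivative frechet_derivative (mom_p P) (at z)) (at z)"
    by (intro smooth_on_has_derivative smooth_mom)+
  have lq: "((\<lambda>\<eta>. mom_q \<eta> z) has_derivative (\<lambda>\<eta>. mom_q \<eta> z)) (at P)"
    and lp: "((\<lambda>\<eta>. mom_p \<eta> z) has_derivative (\<lambda>\<eta>. mom_p \<eta> z)) (at P)"
    unfolding mom_q_def mom_p_def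
    by (intro bounded_linear_imp_has_derivative bounded_linear_compose[OF bounded_linear_divide] bounded_linear_inner_left)+
  have da: "(a k has_derivative frechet_derivative (a k) (at z)) (at z)" if "k \<le> 4" for k
    by (intro smooth_on_has_derivative smooth_a that)
  have F_pos: "DF (frechet_derivative \<Phi> (at z) v, 0) = fibre_poly (\<lambda>k. frechet_derivative (a k) (at z) v) q p +
      ?Fq * frechet_derivative (mom_q P) (at z) v + ?Fp * frechet_derivative (mom_p P) (at z) v" for v
  proof -
    have "((\<lambda>z. F (\<Phi> z, P)) has_derivative (\<lambda>v. DF (frechet_derivative \<Phi> (at z) v, 0))) (at z)"
      using has_derivative_compose[OF pos DF[unfolded w_def]] .
    moreover have "((\<lambda>z. F (\<Phi> z, P)) has_derivative (\<lambda>v. fibre_poly (\<lambda>k. frechet_derivative (a k) (at z) v) q p +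
      ?Fq * frechet_derivative (mom_q P) (at z) v + ?Fp * frechet_derivative (mom_p P) (at z) v)) (at z)"
      unfolding F_eq fibre_poly_eq
      by (rule derivative_eq_intros da dq dp refl | simp)+
        (simp add: P fun_eq_iff poly_q_def poly_p_def algebra_simps power3_eq_cube power2_eq_square)
    ultimately show ?thesis by (rule has_derivative_unique[THEN fun_cong])
  qed
  have H_pos: "DH (frechet_derivative \<Phi> (at z) v, 0) =
      q * frechet_derivative (mom_q P) (at z) v + p * frechet_derivative (mom_p P) (at z) v" for v
  proof -
    have "((\<lambda>z. geodesic_hamiltonian \<rho> (\<Phi> z, P)) has_derivative (\<lambda>v. DH (frechet_derivative \<Phi> (at z) v, 0))) (at z)"
      using has_derivative_compose[OF pos DH[unfolded w_def]] .
    moreover have "((\<lambda>z. geodesic_hamiltonian \<rho> (\<Phi> z, P)) has_derivative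
      (\<lambda>v. q * frechet_derivative (mom_q P) (at z) v + p * frechet_derivative (mom_p P) (at z) v)) (at z)"
      unfolding H_eq
      by (rule derivative_eq_intros dq dp refl | simp)+ (simp add: P fun_eq_iff)
    ultimately show ?thesis by (rule has_derivative_unique[THEN fun_cong])
  qed
  have F_mom: "DF (0, \<eta>) = ?Fq * mom_q \<eta> z + ?Fp * mom_p \<eta> z" for \<eta>
  proof -
    have "((\<lambda>\<eta>. F (\<Phi> z, \<eta>)) has_derivative (\<lambda>\<eta>. DF (0, \<eta>))) (at P)"
      using has_derivative_compose[OF mom DF[unfolded w_def]] .
    moreover have "((\<lambda>\<eta>. F (\<Phi> z, \<eta>)) has_derivative (\<lambda>\<eta>. ?Fq * mom_q \<eta> z + ?Fp * mom_p \<eta> z)) (at P)"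
      unfolding F_eq fibre_poly_eq
      by (rule derivative_eq_intros lq lp refl | simp)+
        (simp add: P fun_eq_iff poly_q_def poly_p_def algebra_simps power3_eq_cube power2_eq_square)
    ultimately show ?thesis by (rule has_derivative_unique[THEN fun_cong])
  qed
  have H_mom: "DH (0, \<eta>) = q * mom_q \<eta> z + p * mom_p \<eta> z" for \<eta>
  proof -
    have "((\<lambda>\<eta>. geodesic_hamiltonian \<rho> (\<Phi> z, \<eta>)) has_derivative (\<lambda>\<eta>. DH (0, \<eta>))) (at P)"
      using has_derivative_compose[OF mom DH[unfolded w_def]] .
    moreover have "((\<lambda>\<eta>. geodesic_hamiltonian \<rho> (\<Phi> z, \<eta>)) has_derivative (\<lambda>\<eta>. q * mom_q \<eta> z + p * mom_p \<eta> z)) (at P)"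
      unfolding H_eq
      by (rule derivative_eq_intros lq lp refl | simp)+ (simp add: P fun_eq_iff)
    ultimately show ?thesis by (rule has_derivative_unique[THEN fun_cong])
  qed
  have base: "D (y, 0) = y $ 1 * D (axis 1 1, 0) + y $ 2 * D (axis 2 1, 0)"
    if "linear D" for D :: "(real^2) \<times> (real^2) \<Rightarrow> real" and y
  proof -
    have "(y, 0) = y $ 1 *\<^sub>R (axis 1 1, 0) + y $ 2 *\<^sub>R (axis 2 1, 0 :: real^2)"
      by (simp add: vec_eq_iff forall_2 axis_def)
    then have "D (y, 0) = D (y $ 1 *\<^sub>R (axis 1 1, 0) + y $ 2 *\<^sub>R (axis 2 1, 0))"
      by (rule arg_cong)
    then show ?thesis by (simp only: linear_add[OF that] linear_scale[OF that] real_scaleR_def)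
  qed
  \<comment> \<open>A function with partials (\<xi>, \<eta>) in the frame components has momentum
    gradient D\<Phi>(\<xi> / g, \<eta>); so the bracket becomes a difference of two position
    derivatives.\<close>
  have axis: "\<xi> * mom_q (axis i 1) z + \<eta> * mom_p (axis i 1) z = frechet_derivative \<Phi> (at z) (\<xi> / g z, \<eta>) $ i" for \<xi> \<eta> i
    by (simp add: mom_q_def mom_p_def inner_axis' smooth_on_d[OF smooth_Phi(1)])
  have "poisson_bracket F (geodesic_hamiltonian \<rho>) w = 0"
    using integral unfolding quartic_first_integral_def by blast
  then have "0 = poisson_bracket F (geodesic_hamiltonian \<rho>) w" ..
  also have "\<dots> = DF (frechet_derivative \<Phi> (at z) (q / g z, p), 0) - DH (frechet_derivative \<Phi> (at z) (?Fq / g z, ?Fp), 0)"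
    unfolding base[OF has_derivative_linear[OF DF], of "frechet_derivative \<Phi> (at z) (q / g z, p)"]
      base[OF has_derivative_linear[OF DH], of "frechet_derivative \<Phi> (at z) (?Fq / g z, ?Fp)"]
      axis[symmetric] F_mom[symmetric] H_mom[symmetric]
    by (simp add: poisson_bracket_def sum_2 d_pos_def d_mom_def DF_def DH_def)
  finally have "DF (frechet_derivative \<Phi> (at z) (q / g z, p), 0) = DH (frechet_derivative \<Phi> (at z) (?Fq / g z, ?Fp), 0)"
    by simp
  then have "fibre_poly (\<lambda>k. frechet_derivative (a k) (at z) (q / g z, p)) q p =
      (?Fp * q - ?Fq * p) * (d_x (mom_q P) z - d_t (mom_p P) z / g z)"
    unfolding F_pos H_pos by (simp add: smooth_on_d smooth_mom algebra_simps)
  moreover have "fibre_poly (\<lambda>k. frechet_derivative (a k) (at z) (q / g z, p)) q p =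
      q / g z * fibre_poly (\<lambda>k. d_t (a k) z) q p + p * fibre_poly (\<lambda>k. d_x (a k) z) q p"
    by (simp add: fibre_poly_eq smooth_on_d[OF smooth_a] algebra_simps)
  \<comment> \<open>The mixed second derivatives of \<Phi> cancel, leaving only the derivative of
    g.\<close>
  moreover have "d_x (mom_q P) z - d_t (mom_p P) z / g z = - q * d_x g z / g z"
    by (simp add: mom_q_d_x mom_p_d_t P)
  ultimately show ?thesis by (simp add: algebra_simps)
qed

lemma pde_real:
  "d_t (a 0) z = - (d_x g z * a 1 z)"
  "d_t (a 1) z = - (g z * d_x (a 0) z + d_x g z * (2 * a 2 z - 4 * a 0 z))"
  "d_t (a 2) z = - (g z * d_x (a 1) z + 3 * d_x g z * (g z - a 1 z))"
  "d_t (a 3) z = - (g z * d_x (a 2) z + d_x g z * (4 - 2 * a 2 z))"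
proof -
  have fun_eq: "a 3 = g" "a 4 = (\<lambda>z. 1)" using a3 a4 by auto
  have a4': "d_t (a 4) z = 0" "d_x (a 4) z = 0"
    by (simp_all add: fun_eq d_t_def d_x_def)
  have g0: "g z \<noteq> 0" using g_pos[of z] by simp
  define c0 c1 c2 c3 where c: "c0 = d_t (a 0) z + d_x g z * a 1 z"
    "c1 = d_t (a 1) z + g z * d_x (a 0) z + d_x g z * (2 * a 2 z - 4 * a 0 z)"
    "c2 = d_t (a 2) z + g z * d_x (a 1) z + 3 * d_x g z * (g z - a 1 z)"
    "c3 = d_t (a 3) z + g z * d_x (a 2) z + d_x g z * (4 - 2 * a 2 z)"
  \<comment> \<open>The normalization enters here: the p^4 terms g d_x a_3 and - g_x a_3 cancel
    because a_3 = g, and there is no p^5 term because a_4 is constant.\<close>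
  have "c0 + c1 * p + c2 * p ^ 2 + c3 * p ^ 3 = 0" for p
  proof -
    have "fibre_poly (\<lambda>k. d_t (a k) z) 1 p + g z * p * fibre_poly (\<lambda>k. d_x (a k) z) 1 p +
      d_x g z * (poly_p z 1 p - p * poly_q z 1 p) = 0" (is "?L = 0")
    proof -
      have "?L = g z * (1 / g z * fibre_poly (\<lambda>k. d_t (a k) z) 1 p + p * fibre_poly (\<lambda>k. d_x (a k) z) 1 p +
          1 * d_x g z / g z * (1 * poly_p z 1 p - p * poly_q z 1 p))"
        using g0 by (simp add: distrib_left)
      then show ?thesis by (simp only: fibre_identity mult_zero_right)
    qed
    then show ?thesis
      unfolding c fibre_poly_eq poly_p_def poly_q_def a4' a3 a4 fun_eq(1) power_one mult_1_right by algebra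
  qed
  from this[of 0] this[of 1] this[of "-1"] this[of 2] have "c0 = 0" "c1 = 0" "c2 = 0" "c3 = 0"
    by simp_all
  then show "d_t (a 0) z = - (d_x g z * a 1 z)"
    "d_t (a 1) z = - (g z * d_x (a 0) z + d_x g z * (2 * a 2 z - 4 * a 0 z))"
    "d_t (a 2) z = - (g z * d_x (a 1) z + 3 * d_x g z * (g z - a 1 z))"
    "d_t (a 3) z = - (g z * d_x (a 2) z + d_x g z * (4 - 2 * a 2 z))"
    unfolding c by linarith+
qed

definition Ut :: "real \<times> real \<Rightarrow> complex^4" where "Ut z = field_vars (\<lambda>k. d_t (a k)) z"
definition Ux :: "real \<times> real \<Rightarrow> complex^4" where "Ux z = field_vars (\<lambda>k. d_x (a k)) z"

lemma pde:
  "Ut z $ 0 = - (Ux z $ 3 * field_vars a z $ 1)"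
  "Ut z $ 1 = - (field_vars a z $ 3 * Ux z $ 0 + Ux z $ 3 * (2 * field_vars a z $ 2 - 4 * field_vars a z $ 0))"
  "Ut z $ 2 = - (field_vars a z $ 3 * Ux z $ 1 + 3 * Ux z $ 3 * (field_vars a z $ 3 - field_vars a z $ 1))"
  "Ut z $ 3 = - (field_vars a z $ 3 * Ux z $ 2 + Ux z $ 3 * (4 - 2 * field_vars a z $ 2))"
proof -
  have "a 3 = g" using a3 by auto
  note pde_real[of z, unfolded One_nat_def this]
  with \<open>a 3 = g\<close> show "Ut z $ 0 = - (Ux z $ 3 * field_vars a z $ 1)"
    "Ut z $ 1 = - (field_vars a z $ 3 * Ux z $ 0 + Ux z $ 3 * (2 * field_vars a z $ 2 - 4 * field_vars a z $ 0))"
    "Ut z $ 2 = - (field_vars a z $ 3 * Ux z $ 1 + 3 * Ux z $ 3 * (field_vars a z $ 3 - field_vars a z $ 1))"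
    "Ut z $ 3 = - (field_vars a z $ 3 * Ux z $ 2 + Ux z $ 3 * (4 - 2 * field_vars a z $ 2))"
    by (simp_all add: Ut_def Ux_def)
qed

text \<open>The metric and the integral agree at y and y + \<gamma>, so the two coordinate frames
  are orthonormal for one and the same matrix and express one and the same quartic in P.\<close>

lemma frame_change:
  assumes "\<gamma> \<in> \<Gamma>" and z': "\<Phi> z' = \<Phi> z + \<gamma>"
  obtains \<alpha> \<beta> \<epsilon> where "\<alpha>\<^sup>2 + \<beta>\<^sup>2 = 1" "\<epsilon>\<^sup>2 = 1"
    "d_t \<Phi> z' /\<^sub>R g z' = \<alpha> *\<^sub>R (d_t \<Phi> z /\<^sub>R g z) + \<beta> *\<^sub>R d_x \<Phi> z"
    "d_x \<Phi> z' = (- \<epsilon> * \<beta>) *\<^sub>R (d_t \<Phi> z /\<^sub>R g z) + (\<epsilon> * \<alpha>) *\<^sub>R d_x \<Phi> z"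
    "\<And>q p :: real. fibre_quartic (field_vars a z') (of_real q) (of_real p) =
      fibre_quartic (field_vars a z) (of_real (\<alpha> * q - \<epsilon> * \<beta> * p)) (of_real (\<beta> * q + \<epsilon> * \<alpha> * p))"
proof -
  have "\<rho> (\<Phi> z') = \<rho> (\<Phi> z)"
    using metric assms unfolding torus_metric_def periodic_def by metis
  then have frame': "orthonormal_frame (\<rho> (\<Phi> z)) (d_t \<Phi> z' /\<^sub>R g z') (d_x \<Phi> z')"
    using frame[of z'] by simp
  obtain \<alpha> \<beta> \<epsilon> where o: "\<alpha>\<^sup>2 + \<beta>\<^sup>2 = 1" "\<epsilon>\<^sup>2 = 1"
    "d_t \<Phi> z' /\<^sub>R g z' = \<alpha> *\<^sub>R (d_t \<Phi> z /\<^sub>R g z) + \<beta> *\<^sub>R d_x \<Phi> z"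
    "d_x \<Phi> z' = (- \<epsilon> * \<beta>) *\<^sub>R (d_t \<Phi> z /\<^sub>R g z) + (\<epsilon> * \<alpha>) *\<^sub>R d_x \<Phi> z"
    using orthonormal_frame.orthonormal_frame_change[OF frame frame'] by blast
  have quartic: "fibre_quartic (field_vars a z) (of_real (mom_q P z)) (of_real (mom_p P z)) = complex_of_real (F (\<Phi> z, P))" for P z
    by (simp add: F_eq fibre_quartic_eq fibre_poly_eq a4)
  have per: "F (\<Phi> z', P) = F (\<Phi> z, P)" for P
  proof -
    obtain c where c: "\<And>k. k \<le> 4 \<Longrightarrow> periodic \<Gamma> (c k)"
      and F: "\<And>y p. F (y, p) = (\<Sum>k\<le>4. c k y * (p $ 1) ^ (4 - k) * (p $ 2) ^ k)"
      using integral unfolding quartic_first_integral_def quartic_in_momenta_def by blast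
    show ?thesis
      unfolding F z' using c assms(1) unfolding periodic_def by (intro sum.cong) auto
  qed
  have "fibre_quartic (field_vars a z') (of_real q) (of_real p) =
      fibre_quartic (field_vars a z) (of_real (\<alpha> * q - \<epsilon> * \<beta> * p)) (of_real (\<beta> * q + \<epsilon> * \<alpha> * p))" for q p :: real
  proof -
    obtain P where P: "mom_q P z' = q" "mom_p P z' = p"
      using exists_covector by blast
    have qp: "q = \<alpha> * mom_q P z + \<beta> * mom_p P z" "p = - \<epsilon> * \<beta> * mom_q P z + \<epsilon> * \<alpha> * mom_p P z"
      unfolding P[symmetric] inner_frame(1)[symmetric, of P z'] inner_frame(2)[symmetric, of P z'] o(3,4)
      by (simp_all only: inner_add_right inner_scaleR_right[of _ _ "d_x \<Phi> z"]
        inner_scaleR_right[of _ _ "d_t \<Phi> z /\<^sub>R g z"] inner_frame)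
    have "mom_q P z = \<alpha> * q - \<epsilon> * \<beta> * p" "mom_p P z = \<beta> * q + \<epsilon> * \<alpha> * p"
      using o(1,2) unfolding qp by algebra+
    then show ?thesis
      using quartic[of z' P] quartic[of z P] P per by simp
  qed
  then show thesis using that o by blast
qed

end

lemma zero_derivative_imp_constant:
  fixes f :: "real \<times> real \<Rightarrow> 'b::real_normed_vector"
  assumes f: "smooth_on UNIV f" and "\<And>z. d_t f z = 0" "\<And>z. d_x f z = 0"
  shows "\<exists>c. \<forall>z. f z = c"
proof -
  have "(f has_derivative (\<lambda>h. 0)) (at z)" for z
  proof -
    have "frechet_derivative f (at z) = (\<lambda>h. 0)"
    proof
      fix h :: "real \<times> real"
      obtain \<xi> \<eta> where "h = (\<xi>, \<eta>)" by fastforce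
      then show "frechet_derivative f (at z) h = 0" by (simp add: smooth_on_d[OF f] assms)
    qed
    then show ?thesis using smooth_on_has_derivative[OF f, of z] by simp
  qed
  then have "f x = f y" for x y
    using has_derivative_zero_unique[of UNIV f x y] by auto
  then show ?thesis by blast
qed

section \<open>Roots and invariants in the elliptic case\<close>

locale elliptic_quartic_integral = quartic_integral +
  fixes s :: "real \<times> real \<Rightarrow> complex^4"
  assumes lattice: "plane_lattice \<Gamma>"
    and cont_s: "continuous_on UNIV s"
    and dist: "\<And>z. distinct_roots (field_vars a z) (s z)"
    and conj: "\<And>z. \<exists>\<alpha> \<beta>. \<beta> \<noteq> 0 \<and> s z $ 1 = Complex \<alpha> \<beta> \<and> s z $ 2 = Complex \<alpha> (- \<beta>)"
    and reals: "\<And>z. s z $ 3 \<in> \<real> \<and> s z $ 4 \<in> \<real>"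
    and Im_inv: "\<And>z i. i \<in> {1, 2} \<Longrightarrow> Im (riemann_invariant (field_vars a z) (s z $ i)) \<noteq> 0"
begin

definition U :: "real \<times> real \<Rightarrow> complex^4" where "U = field_vars a"

definition r :: "4 \<Rightarrow> real \<times> real \<Rightarrow> complex" where "r i z = riemann_invariant (U z) (s z $ i)"

lemma dist_U: "distinct_roots (U z) (s z)"
  by (simp add: U_def dist)

lemma s_nonreal: "Im (s z $ 1) \<noteq> 0" "s z $ 1 \<notin> \<real>" "s z $ 2 \<notin> \<real>" and s_cnj: "s z $ 2 = cnj (s z $ 1)"
  using conj[of z] by (auto simp: complex_is_Real_iff complex_eq_iff)

lemma r_cnj: "r 2 z = cnj (r 1 z)"
  unfolding r_def s_cnj by (rule riemann_invariant_cnj) (simp add: U_def field_vars_real)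

lemma Im_r: "Im (r 1 z) \<noteq> 0"
  using Im_inv[of 1 z] by (simp add: r_def U_def)

lemma one_plus_square_nonzero: "1 + (s z $ m)\<^sup>2 \<noteq> 0"
proof
  assume 0: "1 + (s z $ m)\<^sup>2 = 0"
  \<comment> \<open>A quotient with zero denominator has the value 0, which contradicts
    \<open>Im_r\<close> at the labels 1 and 2; a real root is never \<plusminus>i anyway.\<close>
  then have r0: "r m z = 0" by (simp add: r_def riemann_invariant_def)
  have real: "1 + w\<^sup>2 \<noteq> 0" if "w \<in> \<real>" for w :: complex
  proof
    assume w: "1 + w\<^sup>2 = 0"
    define x where "x = Re w"
    have "w = complex_of_real x" using that by (simp add: x_def of_real_Re)
    then have "complex_of_real (1 + x\<^sup>2) = 0" using w by simp
    then have "1 + x\<^sup>2 = 0" by (simp only: of_real_eq_0_iff)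
    then show False using zero_le_power2[of x] by linarith
  qed
  have "m = 1 \<or> m = 2 \<or> m = 3 \<or> m = 4" by (rule exhaust_4)
  then show False
    using r0 Im_r[of z] r_cnj[of z] real reals[of z] 0 by auto
qed

lemma not_linearly_degenerate:
  assumes "i = 3 \<or> i = 4"
  shows "(1 + (s z $ i)\<^sup>2) * G_hat'' (U z) (s z $ i) - 6 * s z $ i * G_hat' (U z) (s z $ i) \<noteq> 0"
proof
  assume deg: "(1 + (s z $ i)\<^sup>2) * G_hat'' (U z) (s z $ i) - 6 * s z $ i * G_hat' (U z) (s z $ i) = 0"
  define j where "j = (if i = 3 then 4 else 3 :: 4)"
  have "{s z $ i, s z $ j, s z $ 1, s z $ 2} = range (($) (s z))"
    using assms by (auto simp: j_def distinct_roots_range)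
  moreover have "s z $ i \<in> \<real>" using assms reals by blast
  ultimately have "r 1 z = r 2 z"
    unfolding r_def using deg s_nonreal
    by (intro riemann_invariant_eq_if_linearly_degenerate[OF dist_U]) auto
  then have "r 1 z = cnj (r 1 z)" by (simp add: r_cnj)
  then have "Im (r 1 z) = Im (cnj (r 1 z))" by (rule arg_cong)
  then show False using Im_r[of z] by simp
qed

lemma genuinely_nonlinear_real: "i = 3 \<or> i = 4 \<Longrightarrow> genuinely_nonlinear (field_vars a z) (s z) i"
  using genuinely_nonlinearI[OF dist_U one_plus_square_nonzero not_linearly_degenerate] by (simp add: U_def)

definition dU :: "real \<times> real \<Rightarrow> real \<times> real \<Rightarrow> complex^4" where
  "dU z h = field_vars (\<lambda>k z. frechet_derivative (a k) (at z) h) z"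

lemma field_vars_index: "field_vars b z $ k = complex_of_real (b (if k = 0 then 0 else if k = 1 then 1 else if k = 2 then 2 else 3) z)"
  by (simp add: field_vars_def)

lemma U_has_derivative: "(U has_derivative dU z) (at z)"
proof (rule has_derivative_vecI)
  fix k :: 4
  define n :: nat where "n = (if k = 0 then 0 else if k = 1 then 1 else if k = 2 then 2 else 3)"
  have "((\<lambda>z. complex_of_real (a n z)) has_derivative (\<lambda>h. complex_of_real (frechet_derivative (a n) (at z) h))) (at z)"
    by (intro bounded_linear.has_derivative[OF bounded_linear_of_real] smooth_on_has_derivative smooth_a) (simp add: n_def)
  then show "((\<lambda>z. U z $ k) has_derivative (\<lambda>h. dU z h $ k)) (at z)"
    by (simp add: U_def dU_def field_vars_index n_def)
qed

lemma smooth_U: "smooth_on UNIV (\<lambda>z. U z $ k)" and smooth_dU: "smooth_on UNIV (\<lambda>z. dU z h $ k)"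
  unfolding U_def dU_def field_vars_index by (intro smooth_intros smooth_a; simp)+

lemma dU_coords: "dU z (1, 0) = Ut z" "dU z (0, 1) = Ux z"
  by (simp_all add: vec_eq_iff dU_def Ut_def Ux_def field_vars_index d_t_def d_x_def)

lemma isCont_s: "isCont s z"
  using cont_s continuous_on_eq_continuous_at open_UNIV by blast

lemma s_has_derivative:
  "((\<lambda>z. s z $ i) has_derivative (\<lambda>h. - G_lin (dU z h) (s z $ i) / G_hat' (U z) (s z $ i))) (at z)"
  by (rule root_has_derivative[OF U_has_derivative isCont_s]) (simp add: dist_U)

text \<open>Bootstrap from continuity: by \<open>s_has_derivative\<close> the derivative of a root
  is a rational function of that root and of smooth data, so each order of differentiability gives
  the next.\<close>

lemma smooth_s: "smooth_on UNIV (\<lambda>z. s z $ i)"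
proof -
  have "Ck_on k (\<lambda>z. s z $ i) UNIV" for k
  proof (induction k)
    case 0
    show ?case by (simp add: continuous_on_component cont_s)
  next
    case (Suc k)
    note U = smooth_on_imp_Ck_on[OF smooth_U] and dU = smooth_on_imp_Ck_on[OF smooth_dU]
    show ?case
    proof (rule Ck_on_SucI[OF s_has_derivative])
      fix h
      have "Ck_on k (\<lambda>z. G_lin (dU z h) (s z $ i)) UNIV"
        unfolding G_lin_def F_lin_def F_lin'_def
        by (intro Ck_on_add Ck_on_diff Ck_on_mult Ck_on_power Ck_on_const dU Suc)
      moreover have "Ck_on k (\<lambda>z. G_hat' (U z) (s z $ i)) UNIV"
        unfolding G_hat'_def G_lin'_def
        by (intro Ck_on_add Ck_on_diff Ck_on_mult Ck_on_power Ck_on_const U Suc)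
      ultimately show "Ck_on k (\<lambda>z. - G_lin (dU z h) (s z $ i) / G_hat' (U z) (s z $ i)) UNIV"
        by (intro Ck_on_divide Ck_on_bounded_linear_compose[OF bounded_linear_minus[OF bounded_linear_ident]]
            G_hat'_nonzero[OF dist_U])
    qed
  qed
  then show ?thesis by (simp add: smooth_on_def)
qed

lemma smooth_r: "smooth_on UNIV (r i)"
  unfolding r_def[abs_def] riemann_invariant_def F_hat_eq F_lin_def
  by (intro smooth_intros smooth_U smooth_s) (simp add: one_plus_square_nonzero)

lemma r_has_derivative:
  "(r i has_derivative (\<lambda>h. F_lin (dU z h) (s z $ i) / (1 + (s z $ i)\<^sup>2)\<^sup>2)) (at z)"
  unfolding r_def[abs_def]
  by (rule riemann_invariant_has_derivative[OF U_has_derivative isCont_s])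
    (simp_all add: dist_U one_plus_square_nonzero)

lemma r_d_x: "d_x (r i) z = F_lin (Ux z) (s z $ i) / (1 + (s z $ i)\<^sup>2)\<^sup>2"
  unfolding d_x_def by (simp add: frechet_derivative_eqI[OF r_has_derivative] dU_coords)

lemma U3: "U z $ 3 = complex_of_real (g z)"
  by (simp add: U_def a3)

lemma r_d_t: "d_t (r i) z = - (complex_of_real (g z) * s z $ i * d_x (r i) z)"
proof -
  have "F_lin (Ut z) (s z $ i) = - (U z $ 3 * s z $ i * F_lin (Ux z) (s z $ i))"
    using F_lin_pde[OF pde, of z "s z $ i"] distinct_roots_root[OF dist_U, of z i] by (simp add: U_def)
  then show ?thesis
    unfolding d_t_def r_d_x by (simp add: frechet_derivative_eqI[OF r_has_derivative] dU_coords U3)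
qed

section \<open>Periodicity of the Riemann invariants\<close>

text \<open>A translation carries critical points to critical points but might relabel them, hence
  the unspecified j; only reality of the root is known to be kept.\<close>

lemma root_match:
  assumes "\<gamma> \<in> \<Gamma>" "\<Phi> z' = \<Phi> z + \<gamma>"
  obtains j where "r i z' = r j z"
    "G_hat' (U z') (s z' $ i) / (1 + (s z' $ i)\<^sup>2) = G_hat' (U z) (s z $ j) / (1 + (s z $ j)\<^sup>2)"
    "s z $ j \<in> \<real> \<longleftrightarrow> s z' $ i \<in> \<real>"
proof -
  obtain \<alpha> \<beta> \<epsilon> where o: "\<alpha>\<^sup>2 + \<beta>\<^sup>2 = 1" "\<epsilon>\<^sup>2 = 1"
    "\<And>q p :: real. fibre_quartic (field_vars a z') (of_real q) (of_real p) =
      fibre_quartic (field_vars a z) (of_real (\<alpha> * q - \<epsilon> * \<beta> * p)) (of_real (\<beta> * q + \<epsilon> * \<alpha> * p))"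
    using frame_change[OF assms] by metis
  obtain \<zeta> where \<zeta>: "G_hat (U z) \<zeta> = 0" "riemann_invariant (U z) \<zeta> = riemann_invariant (U z') (s z' $ i)"
    "G_hat' (U z) \<zeta> / (1 + \<zeta>\<^sup>2) = G_hat' (U z') (s z' $ i) / (1 + (s z' $ i)\<^sup>2)"
    "\<zeta> \<in> \<real> \<longleftrightarrow> s z' $ i \<in> \<real>"
    using critical_point_transfer[OF o(1,2), of "U z'" "U z" "s z' $ i"] o(3)
      distinct_roots_root[OF dist_U] distinct_roots_U3[OF dist_U] unfolding U_def by blast
  obtain j where "\<zeta> = s z $ j"
    using \<zeta>(1) dist_U[of z] unfolding distinct_roots_def by blast
  then show thesis using that[of j] \<zeta> by (simp add: r_def)
qed

lemma real_index: "s z $ j \<in> \<real> \<longleftrightarrow> j = 3 \<or> j = 4"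
proof -
  have "j = 1 \<or> j = 2 \<or> j = 3 \<or> j = 4" by (rule exhaust_4)
  then show ?thesis using s_nonreal[of z] reals[of z] by auto
qed

lemma r_real: "j = 3 \<or> j = 4 \<Longrightarrow> cnj (r j z) = r j z"
proof -
  assume "j = 3 \<or> j = 4"
  then have "cnj (s z $ j) = s z $ j" using reals[of z] by (auto simp: Reals_cnj_iff)
  then show ?thesis
    unfolding r_def by (metis U_def field_vars_real riemann_invariant_cnj)
qed

lemma r_sign: "(\<forall>z. Re (r 3 z) > Re (r 4 z)) \<or> (\<forall>z. Re (r 3 z) < Re (r 4 z))"
proof -
  have neq: "r 3 z \<noteq> r 4 z" for z
    unfolding r_def using reals s_nonreal
    by (intro real_riemann_invariants_distinct[OF dist_U]) (auto simp: U_def field_vars_real)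
  have "Re (r 3 z) - Re (r 4 z) \<noteq> 0" for z
    using neq[of z] r_real[of 3 z] r_real[of 4 z] by (auto simp: complex_eq_iff)
  moreover have "continuous_on UNIV (\<lambda>z. Re (r 3 z) - Re (r 4 z))"
    by (intro continuous_intros smooth_on_imp_continuous_on[OF smooth_r])
  ultimately show ?thesis
    using continuous_nonzero_same_sign[of "\<lambda>z. Re (r 3 z) - Re (r 4 z)"] by auto
qed

text \<open>Any relabelling of 3 and 4 other than the identity would break the strict order of the
  two real invariants, which \<open>r_sign\<close> shows to be the same everywhere.\<close>

lemma real_match:
  assumes "\<gamma> \<in> \<Gamma>" "\<Phi> z' = \<Phi> z + \<gamma>" and i: "i = 3 \<or> i = 4"
  shows "r i z' = r i z"
    "G_hat' (U z') (s z' $ i) / (1 + (s z' $ i)\<^sup>2) = G_hat' (U z) (s z $ i) / (1 + (s z $ i)\<^sup>2)"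
proof -
  have ex: "\<exists>j. (j = 3 \<or> j = 4) \<and> r i z' = r j z \<and>
    G_hat' (U z') (s z' $ i) / (1 + (s z' $ i)\<^sup>2) = G_hat' (U z) (s z $ j) / (1 + (s z $ j)\<^sup>2)"
    if "i = 3 \<or> i = 4" for i
    using root_match[OF assms(1,2), of i] that unfolding real_index by metis
  obtain j k where j: "j = 3 \<or> j = 4" "r 3 z' = r j z"
    "G_hat' (U z') (s z' $ 3) / (1 + (s z' $ 3)\<^sup>2) = G_hat' (U z) (s z $ j) / (1 + (s z $ j)\<^sup>2)"
    and k: "k = 3 \<or> k = 4" "r 4 z' = r k z"
    "G_hat' (U z') (s z' $ 4) / (1 + (s z' $ 4)\<^sup>2) = G_hat' (U z) (s z $ k) / (1 + (s z $ k)\<^sup>2)"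
    using ex[of 3] ex[of 4] by auto
  have "j = 3 \<and> k = 4"
    using r_sign
  proof
    assume "\<forall>z. Re (r 4 z) < Re (r 3 z)"
    then have "Re (r 4 z) < Re (r 3 z)" "Re (r k z) < Re (r j z)"
      using j(2) k(2) by metis+
    then show ?thesis using j(1) k(1) by auto
  next
    assume "\<forall>z. Re (r 3 z) < Re (r 4 z)"
    then have "Re (r 3 z) < Re (r 4 z)" "Re (r j z) < Re (r k z)"
      using j(2) k(2) by metis+
    then show ?thesis using j(1) k(1) by auto
  qed
  then show "r i z' = r i z"
    "G_hat' (U z') (s z' $ i) / (1 + (s z' $ i)\<^sup>2) = G_hat' (U z) (s z $ i) / (1 + (s z $ i)\<^sup>2)"
    using i j k by auto
qed

text \<open>Exchanging the nonreal labels conjugates the invariant, but its imaginary part has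
  constant sign.\<close>

lemma complex_match:
  assumes "\<gamma> \<in> \<Gamma>" "\<Phi> z' = \<Phi> z + \<gamma>"
  shows "r 1 z' = r 1 z"
proof -
  obtain j where j: "r 1 z' = r j z" "s z $ j \<in> \<real> \<longleftrightarrow> s z' $ 1 \<in> \<real>"
    using root_match[OF assms, of 1] by metis
  then have "j = 1 \<or> j = 2"
    using exhaust_4[of j] s_nonreal(2)[of z'] real_index by blast
  moreover have "(\<forall>z. Im (r 1 z) > 0) \<or> (\<forall>z. Im (r 1 z) < 0)"
    by (intro continuous_nonzero_same_sign continuous_intros smooth_on_imp_continuous_on[OF smooth_r] Im_r)
  then have "Im (r 1 z) > 0 \<and> Im (r 1 z') > 0 \<or> Im (r 1 z) < 0 \<and> Im (r 1 z') < 0" by blast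
  then have "j \<noteq> 2"
    using j(1) r_cnj[of z] by auto
  ultimately show ?thesis using j(1) by simp
qed

section \<open>Constancy of the Riemann invariants\<close>

lemma Phi_inv: "\<Phi> (inv \<Phi> y) = y" "inv \<Phi> (\<Phi> z) = z"
  using bij_Phi by (simp_all add: bij_is_surj surj_f_inv_f bij_is_inj)

text \<open>Both sides are the squared gradient of r_i, whose components in the orthonormal frame
  are d_t r / g = - s d_x r and d_x r. As r_i is periodic, the two frames are applied to the same
  differential D.\<close>

lemma gradient_match:
  assumes i: "i = 3 \<or> i = 4" and \<gamma>: "\<gamma> \<in> \<Gamma>" "\<Phi> z' = \<Phi> z + \<gamma>"
  shows "(1 + (s z' $ i)\<^sup>2) * (d_x (r i) z')\<^sup>2 = (1 + (s z $ i)\<^sup>2) * (d_x (r i) z)\<^sup>2"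
proof -
  define R where "R y = r i (inv \<Phi> y)" for y
  have R: "smooth_on UNIV R"
    unfolding R_def[abs_def] by (rule smooth_on_compose[OF smooth_r smooth_Phi(2)])
  have per: "R (y + \<gamma>) = R y" for y
    unfolding R_def using \<gamma>(1) by (rule real_match(1)[OF _ _ i]) (simp add: Phi_inv)
  define D where "D = frechet_derivative R (at (\<Phi> z))"
  have D: "(R has_derivative D) (at (\<Phi> z))"
    unfolding D_def by (rule smooth_on_has_derivative[OF R])
  have D': "(R has_derivative D) (at (\<Phi> z'))"
  proof -
    have "((\<lambda>y. R (y - \<gamma>)) has_derivative D) (at (\<Phi> z'))"
      by (rule has_derivative_compose[of "\<lambda>y. y - \<gamma>" "\<lambda>h. h"])
        (use D in \<open>auto intro!: derivative_eq_intros simp: \<gamma>\<close>)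
    moreover have "(\<lambda>y. R (y - \<gamma>)) = R" using per[of "_ - \<gamma>"] by auto
    ultimately show ?thesis by simp
  qed
  have chain: "frechet_derivative (r i) (at w) v = D (frechet_derivative \<Phi> (at w) v)"
    if "(R has_derivative D) (at (\<Phi> w))" for w v
  proof -
    have "((\<lambda>w. R (\<Phi> w)) has_derivative (\<lambda>v. D (frechet_derivative \<Phi> (at w) v))) (at w)"
      by (rule has_derivative_compose[OF smooth_on_has_derivative[OF smooth_Phi(1)] that])
    moreover have "(\<lambda>w. R (\<Phi> w)) = r i" by (simp add: R_def Phi_inv)
    ultimately show ?thesis by (simp add: frechet_derivative_eqI)
  qed
  have l: "linear D" using D by (rule has_derivative_linear)
  have norm2: "(1 + (s w $ i)\<^sup>2) * (d_x (r i) w)\<^sup>2 = (D (d_t \<Phi> w /\<^sub>R g w))\<^sup>2 + (D (d_x \<Phi> w))\<^sup>2"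
    if "(R has_derivative D) (at (\<Phi> w))" for w
  proof -
    have g0: "complex_of_real (g w) \<noteq> 0" using g_pos[of w] by simp
    have "D (d_x \<Phi> w) = d_x (r i) w"
      using chain[OF that] by (simp add: d_x_def)
    moreover have "D (d_t \<Phi> w) = d_t (r i) w"
      using chain[OF that] by (simp add: d_t_def)
    then have "D (d_t \<Phi> w /\<^sub>R g w) = d_t (r i) w /\<^sub>R g w"
      by (simp only: linear_scale[OF l])
    then have "D (d_t \<Phi> w /\<^sub>R g w) = - (s w $ i * d_x (r i) w)"
      using g0 by (simp add: r_d_t scaleR_conv_of_real)
    ultimately show ?thesis by (simp add: power_mult_distrib algebra_simps)
  qed
  obtain \<alpha> \<beta> \<epsilon> where o: "\<alpha>\<^sup>2 + \<beta>\<^sup>2 = 1" "\<epsilon>\<^sup>2 = 1"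
    "d_t \<Phi> z' /\<^sub>R g z' = \<alpha> *\<^sub>R (d_t \<Phi> z /\<^sub>R g z) + \<beta> *\<^sub>R d_x \<Phi> z"
    "d_x \<Phi> z' = (- \<epsilon> * \<beta>) *\<^sub>R (d_t \<Phi> z /\<^sub>R g z) + (\<epsilon> * \<alpha>) *\<^sub>R d_x \<Phi> z"
    using frame_change[OF \<gamma>] by metis
  define A B where AB: "A = D (d_t \<Phi> z /\<^sub>R g z)" "B = D (d_x \<Phi> z)"
  have AB': "D (d_t \<Phi> z' /\<^sub>R g z') = \<alpha> *\<^sub>R A + \<beta> *\<^sub>R B"
    "D (d_x \<Phi> z') = (- \<epsilon> * \<beta>) *\<^sub>R A + (\<epsilon> * \<alpha>) *\<^sub>R B"
    by (simp_all only: o(3,4) linear_add[OF l] linear_scale[OF l] AB)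
  have c: "(complex_of_real \<alpha>)\<^sup>2 + (complex_of_real \<beta>)\<^sup>2 = 1" "(complex_of_real \<epsilon>)\<^sup>2 = 1"
    using o(1,2) by (metis of_real_1 of_real_add of_real_power)+
  show ?thesis
    unfolding norm2[OF D] norm2[OF D'] AB' AB[symmetric]
    unfolding scaleR_conv_of_real of_real_mult of_real_minus
    using c by algebra
qed

text \<open>
  \<open>\<eta> i\<close> is the second derivative of the integral along the unit circle times the squared
  gradient of \<open>r i\<close>, hence independent of the choice of the orthonormal frame.
\<close>

definition \<eta> :: "4 \<Rightarrow> real \<times> real \<Rightarrow> complex" where
  "\<eta> i z = G_hat' (U z) (s z $ i) * (d_x (r i) z)\<^sup>2"

lemma eta_periodic:
  assumes "i = 3 \<or> i = 4" and "\<gamma> \<in> \<Gamma>" "\<Phi> z' = \<Phi> z + \<gamma>"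
  shows "\<eta> i z' = \<eta> i z"
proof -
  have e: "\<eta> i z = (G_hat' (U z) (s z $ i) / (1 + (s z $ i)\<^sup>2)) * ((1 + (s z $ i)\<^sup>2) * (d_x (r i) z)\<^sup>2)" for z
    using one_plus_square_nonzero[of z i] by (simp add: \<eta>_def)
  show ?thesis
    by (simp only: e gradient_match[OF assms] real_match(2)[OF assms(2,3,1)])
qed

lemma smooth_G_hat': "smooth_on UNIV (\<lambda>z. G_hat' (U z) (s z $ i))"
  unfolding G_hat'_def G_lin'_def by (intro smooth_intros smooth_U smooth_s)

lemma smooth_eta: "smooth_on UNIV (\<eta> i)"
  unfolding \<eta>_def[abs_def] by (intro smooth_intros smooth_G_hat' smooth_r)

lemma G_hat'_has_derivative:
  "((\<lambda>z. G_hat' (U z) (s z $ i)) has_derivative (\<lambda>h. G_lin' (dU z h) (s z $ i) +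
    G_hat'' (U z) (s z $ i) * (- G_lin (dU z h) (s z $ i) / G_hat' (U z) (s z $ i)))) (at z)"
proof -
  define ds where "ds h = - G_lin (dU z h) (s z $ i) / G_hat' (U z) (s z $ i)" for h
  have sd: "((\<lambda>z. s z $ i) has_derivative ds) (at z)"
    unfolding ds_def by (rule s_has_derivative)
  have Ud: "((\<lambda>z. U z $ k) has_derivative (\<lambda>h. dU z h $ k)) (at z)" for k
    by (rule bounded_linear.has_derivative[OF bounded_linear_vec_nth U_has_derivative])
  have "((\<lambda>z. G_hat' (U z) (s z $ i)) has_derivative
      (\<lambda>h. G_lin' (dU z h) (s z $ i) + G_hat'' (U z) (s z $ i) * ds h)) (at z)"
    unfolding G_hat'_def G_lin'_def
    by (rule derivative_eq_intros Ud sd refl)+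
      (simp add: fun_eq_iff G_hat''_def algebra_simps power2_eq_square)
  then show ?thesis by (simp add: ds_def)
qed

text \<open>The x-derivative of the transport equation replaces d_t d_x r; the second derivatives of
  r cancel and \<open>characteristic_identity\<close> evaluates the rest. The factor G' clears
  denominators. As F_lin Ux is (1 + s^2)^2 d_x r, the right side is, for the real labels, a nowhere
  vanishing multiple of (d_x r)^3.\<close>

lemma eta_characteristic_derivative:
  "G_hat' (U z) (s z $ i) * (d_t (\<eta> i) z + of_real (g z) * s z $ i * d_x (\<eta> i) z) =
    (d_x (r i) z)\<^sup>2 * (of_real (g z) * F_lin (Ux z) (s z $ i) *
      ((1 + (s z $ i)\<^sup>2) * G_hat'' (U z) (s z $ i) - 6 * s z $ i * G_hat' (U z) (s z $ i)))"
proof -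
  define \<sigma> where "\<sigma> = s z $ i"
  define G where "G = G_hat' (U z) \<sigma>"
  define G' where "G' h = G_lin' (dU z h) \<sigma> + G_hat'' (U z) \<sigma> * (- G_lin (dU z h) \<sigma> / G)" for h
  have G0: "G \<noteq> 0" unfolding G_def \<sigma>_def by (rule G_hat'_nonzero[OF dist_U])
  have dG: "((\<lambda>z. G_hat' (U z) (s z $ i)) has_derivative G') (at z)"
    unfolding G'_def[abs_def] G_def \<sigma>_def by (rule G_hat'_has_derivative)
  define w where "w = d_x (r i) z"
  define dw where "dw = frechet_derivative (d_x (r i)) (at z)"
  have dw: "(d_x (r i) has_derivative dw) (at z)"
    unfolding dw_def by (intro smooth_on_has_derivative smooth_intros smooth_r)
  have "(\<eta> i has_derivative (\<lambda>h. G * (2 * w * dw h) + G' h * w\<^sup>2)) (at z)"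
    unfolding \<eta>_def[abs_def]
    by (rule derivative_eq_intros dG dw refl)+ (simp add: fun_eq_iff G_def \<sigma>_def w_def algebra_simps)
  then have "frechet_derivative (\<eta> i) (at z) = (\<lambda>h. G * (2 * w * dw h) + G' h * w\<^sup>2)"
    by (rule frechet_derivative_eqI)
  then have \<eta>': "d_t (\<eta> i) z = G * (2 * w * d_t (d_x (r i)) z) + G' (1, 0) * w\<^sup>2"
    "d_x (\<eta> i) z = G * (2 * w * d_x (d_x (r i)) z) + G' (0, 1) * w\<^sup>2"
    by (simp_all add: d_t_def d_x_def dw_def)
  define wx where "wx = d_x (d_x (r i)) z"
  have wt: "d_t (d_x (r i)) z = - (of_real (d_x g z) * \<sigma> * w + of_real (g z) * (- G_lin (Ux z) \<sigma> / G) * w +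
      of_real (g z) * \<sigma> * wx)"
  proof -
    have "d_t (d_x (r i)) z = d_x (d_t (r i)) z" by (rule d_t_d_x_commute[OF smooth_r])
    also have "d_t (r i) = (\<lambda>z. - (complex_of_real (g z) * s z $ i * d_x (r i) z))"
      by (simp add: fun_eq_iff r_d_t)
    also have "d_x \<dots> z = - (of_real (d_x g z) * \<sigma> * w + of_real (g z) * (- G_lin (Ux z) \<sigma> / G) * w +
      of_real (g z) * \<sigma> * wx)"
    proof -
      have gd: "((\<lambda>z. complex_of_real (g z)) has_derivative (\<lambda>h. of_real (frechet_derivative g (at z) h))) (at z)"
        by (intro bounded_linear.has_derivative[OF bounded_linear_of_real] smooth_on_has_derivative smooth_g)
      define ds where "ds h = - G_lin (dU z h) \<sigma> / G" for h
      have sd: "((\<lambda>z. s z $ i) has_derivative ds) (at z)"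
        unfolding ds_def G_def \<sigma>_def by (rule s_has_derivative)
      have "((\<lambda>z. - (complex_of_real (g z) * s z $ i * d_x (r i) z)) has_derivative
        (\<lambda>h. - (of_real (frechet_derivative g (at z) h) * \<sigma> * w + of_real (g z) * ds h * w +
          of_real (g z) * \<sigma> * dw h))) (at z)"
        by (rule derivative_eq_intros gd sd dw refl)+ (simp add: fun_eq_iff \<sigma>_def w_def algebra_simps)
      from frechet_derivative_eqI[OF this] show ?thesis
        unfolding d_x_def[of "\<lambda>z. - (complex_of_real (g z) * s z $ i * d_x (r i) z)"]
        by (simp add: ds_def dU_coords) (simp add: d_x_def dw_def wx_def)
    qed
    finally show ?thesis .
  qed
  have "U z $ 3 = of_real (g z)" "Ux z $ 3 = of_real (d_x g z)"
    using a3 by (auto simp: U3 Ux_def intro!: arg_cong[of _ _ "\<lambda>f. d_x f z"])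
  note id = characteristic_identity[OF pde distinct_roots_root[OF dist], of z i, folded U_def,
      unfolded this, folded \<sigma>_def, folded G_def]
  have "G * G' h = G * G_lin' (dU z h) \<sigma> - G_hat'' (U z) \<sigma> * G_lin (dU z h) \<sigma>" for h
    using G0 by (simp add: G'_def algebra_simps)
  then have GG': "G * G' (1, 0) = G * G_lin' (Ut z) \<sigma> - G_hat'' (U z) \<sigma> * G_lin (Ut z) \<sigma>"
    "G * G' (0, 1) = G * G_lin' (Ux z) \<sigma> - G_hat'' (U z) \<sigma> * G_lin (Ux z) \<sigma>"
    by (simp_all add: dU_coords)
  have Gwt: "G * d_t (d_x (r i)) z = - (G * of_real (d_x g z) * \<sigma> * w - of_real (g z) * G_lin (Ux z) \<sigma> * w +
      G * of_real (g z) * \<sigma> * wx)"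
    unfolding wt using G0 by (simp add: field_simps)
  have "G * (d_t (\<eta> i) z + of_real (g z) * \<sigma> * d_x (\<eta> i) z) =
      G * 2 * w * (G * d_t (d_x (r i)) z) + G * G' (1, 0) * w\<^sup>2 +
      of_real (g z) * \<sigma> * (G * G * 2 * w * wx + G * G' (0, 1) * w\<^sup>2)"
    unfolding \<eta>' wx_def by algebra
  also have "\<dots> = w\<^sup>2 * (G * (G_lin' (Ut z) \<sigma> + of_real (g z) * \<sigma> * G_lin' (Ux z) \<sigma>)
      - G_hat'' (U z) \<sigma> * (G_lin (Ut z) \<sigma> + of_real (g z) * \<sigma> * G_lin (Ux z) \<sigma>)
      - 2 * G * (G * (of_real (d_x g z) * \<sigma>) - of_real (g z) * G_lin (Ux z) \<sigma>))"
    unfolding GG' Gwt by algebra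
  finally show ?thesis
    unfolding id by (simp only: \<sigma>_def G_def w_def)
qed

lemma eta_real: "i = 3 \<or> i = 4 \<Longrightarrow> \<eta> i z \<in> \<real>"
proof -
  assume i: "i = 3 \<or> i = 4"
  then have s: "s z $ i \<in> \<real>" using reals by blast
  have U: "U z $ k \<in> \<real>" "Ux z $ k \<in> \<real>" for k
    by (simp_all add: U_def Ux_def field_vars_real)
  show ?thesis
    unfolding \<eta>_def r_d_x G_hat'_def G_lin'_def F_lin_def
    by (intro Reals_mult Reals_power Reals_add Reals_diff Reals_minus Reals_divide s U Reals_numeral Reals_1)
qed

lemma real_invariant_d_x_zero:
  assumes i: "i = 3 \<or> i = 4"
  shows "d_x (r i) z = 0"
proof -
  have eta0: "\<eta> i z = 0 \<longleftrightarrow> d_x (r i) z = 0" for z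
    using G_hat'_nonzero[OF dist_U, of z i] by (simp add: \<eta>_def)
  have "periodic \<Gamma> (\<lambda>y. norm (\<eta> i (inv \<Phi> y)))"
    unfolding periodic_def using eta_periodic[OF i] by (metis Phi_inv(1))
  moreover have "continuous_on UNIV (\<lambda>y. norm (\<eta> i (inv \<Phi> y)))"
    by (intro continuous_on_norm smooth_on_imp_continuous_on smooth_on_compose[OF smooth_eta smooth_Phi(2)])
  ultimately obtain y\<^sub>0 where y0: "\<And>y. norm (\<eta> i (inv \<Phi> y)) \<le> norm (\<eta> i (inv \<Phi> y\<^sub>0))"
    using periodic_attains_max[OF lattice] by metis
  define z\<^sub>0 where "z\<^sub>0 = inv \<Phi> y\<^sub>0"
  have max: "norm (\<eta> i z) \<le> norm (\<eta> i z\<^sub>0)" for z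
    using y0[of "\<Phi> z"] by (simp add: Phi_inv z\<^sub>0_def)
  have "\<eta> i z\<^sub>0 = 0"
  proof (rule ccontr)
    assume ne: "\<eta> i z\<^sub>0 \<noteq> 0"
    \<comment> \<open>\<eta> is real, and its square is a smooth quantity whose maximum can be
      differentiated.\<close>
    define e where "e z = Re (\<eta> i z)" for z
    have \<eta>e: "\<eta> i z = of_real (e z)" for z
      using eta_real[OF i] by (simp add: e_def of_real_Re)
    have se: "smooth_on UNIV e"
      unfolding e_def[abs_def] by (rule smooth_on_bounded_linear[OF bounded_linear_Re smooth_eta])
    have "((\<lambda>z. (e z)\<^sup>2) has_derivative (\<lambda>h. 2 * e z\<^sub>0 * frechet_derivative e (at z\<^sub>0) h)) (at z\<^sub>0)"
      by (rule derivative_eq_intros smooth_on_has_derivative[OF se] refl)+ (simp add: fun_eq_iff)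
    moreover have "\<forall>z\<in>UNIV. (e z)\<^sup>2 \<le> (e z\<^sub>0)\<^sup>2"
      using max by (simp add: \<eta>e abs_le_square_iff)
    ultimately have "(\<lambda>h. 2 * e z\<^sub>0 * frechet_derivative e (at z\<^sub>0) h) = (\<lambda>h. 0)"
      by (intro differential_zero_maxmin[of z\<^sub>0 UNIV "\<lambda>z. (e z)\<^sup>2"]) auto
    then have "2 * e z\<^sub>0 * frechet_derivative e (at z\<^sub>0) h = 0" for h by meson
    then have de: "frechet_derivative e (at z\<^sub>0) h = 0" for h using ne \<eta>e by simp
    have "frechet_derivative (\<eta> i) (at z\<^sub>0) h = 0" for h
    proof -
      have "\<eta> i = (\<lambda>z. of_real (e z))" by (simp add: fun_eq_iff \<eta>e)
      then show ?thesis
        by (simp add: frechet_derivative_bounded_linear[OF bounded_linear_of_real se] de)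
    qed
    then have "d_t (\<eta> i) z\<^sub>0 = 0" "d_x (\<eta> i) z\<^sub>0 = 0" by (simp_all add: d_t_def d_x_def)
    then have "(d_x (r i) z\<^sub>0)\<^sup>2 * (of_real (g z\<^sub>0) * F_lin (Ux z\<^sub>0) (s z\<^sub>0 $ i)) = 0"
      using eta_characteristic_derivative[of z\<^sub>0 i] not_linearly_degenerate[OF i, of z\<^sub>0] by auto
    then have "d_x (r i) z\<^sub>0 = 0" using g_pos[of z\<^sub>0] by (auto simp: r_d_x)
    then show False using ne eta0 by blast
  qed
  then have "\<eta> i z = 0" using max[of z] by simp
  then show ?thesis using eta0 by blast
qed

lemma complex_invariant_d_x_zero: "d_x (r 1) z = 0"
proof -
  obtain u v where uv: "u \<noteq> v" "independent {u, v}"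
    and \<Gamma>: "\<Gamma> = {of_int m *\<^sub>R u + of_int n *\<^sub>R v | m n. True}"
    using lattice unfolding plane_lattice_def by blast
  have "of_int 1 *\<^sub>R u + of_int 0 *\<^sub>R v \<in> \<Gamma>" "of_int 0 *\<^sub>R u + of_int 1 *\<^sub>R v \<in> \<Gamma>"
    unfolding \<Gamma> by blast+
  then have uv\<Gamma>: "u \<in> \<Gamma>" "v \<in> \<Gamma>" by simp_all
  have indep: "\<xi> = 0 \<and> \<zeta> = 0" if "\<xi> *\<^sub>R u + \<zeta> *\<^sub>R v = 0" for \<xi> \<zeta>
  proof -
    have "u \<notin> span {v}" "v \<noteq> 0"
      using uv dependent_zero by (auto simp: independent_insert)
    moreover have "u = (- \<zeta> / \<xi>) *\<^sub>R v" if "\<xi> \<noteq> 0"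
    proof -
      have "\<xi> *\<^sub>R u = \<xi> *\<^sub>R ((- \<zeta> / \<xi>) *\<^sub>R v)"
        using \<open>\<xi> *\<^sub>R u + \<zeta> *\<^sub>R v = 0\<close> that by (simp add: eq_neg_iff_add_eq_0)
      then show ?thesis using that by (simp only: scaleR_cancel_left) simp
    qed
    ultimately have "\<xi> = 0" by (metis span_base span_scale singletonI)
    then show ?thesis using that \<open>v \<noteq> 0\<close> by simp
  qed
  \<comment> \<open>Coordinates adapted to the lattice, in which the basic translations are unit
    shifts. Composed with \<Phi>, T is a linear isomorphism, so DT is injective.\<close>
  define T where "T \<omega> = inv \<Phi> (fst \<omega> *\<^sub>R u + snd \<omega> *\<^sub>R v)" for \<omega> :: "real \<times> real"
  have lin: "bounded_linear (\<lambda>\<omega> :: real \<times> real. fst \<omega> *\<^sub>R u + snd \<omega> *\<^sub>R v)"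
    by (intro bounded_linear_add bounded_linear_compose[OF bounded_linear_scaleR_left]
        bounded_linear_fst bounded_linear_snd)
  have smooth_T: "smooth_on UNIV T"
    unfolding T_def[abs_def] by (intro smooth_on_compose[OF smooth_Phi(2)] smooth_on_linear lin)
  have \<Phi>T: "\<Phi> (T \<omega>) = fst \<omega> *\<^sub>R u + snd \<omega> *\<^sub>R v" for \<omega>
    by (simp add: T_def Phi_inv)
  define DT where "DT \<omega> = frechet_derivative T (at \<omega>)" for \<omega>
  have DT: "(T has_derivative DT \<omega>) (at \<omega>)" for \<omega>
    unfolding DT_def by (rule smooth_on_has_derivative[OF smooth_T])
  have inj_DT: "h = 0" if "DT \<omega> h = 0" for \<omega> h
  proof -
    have "((\<lambda>\<omega>. \<Phi> (T \<omega>)) has_derivative (\<lambda>h. frechet_derivative \<Phi> (at (T \<omega>)) (DT \<omega> h))) (at \<omega>)"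
      by (rule has_derivative_compose[OF DT smooth_on_has_derivative[OF smooth_Phi(1)]])
    moreover have "((\<lambda>\<omega>. \<Phi> (T \<omega>)) has_derivative (\<lambda>h. fst h *\<^sub>R u + snd h *\<^sub>R v)) (at \<omega>)"
      unfolding \<Phi>T by (rule bounded_linear_imp_has_derivative[OF lin])
    ultimately have "(\<lambda>h. frechet_derivative \<Phi> (at (T \<omega>)) (DT \<omega> h)) = (\<lambda>h. fst h *\<^sub>R u + snd h *\<^sub>R v)"
      by (rule has_derivative_unique)
    then have "frechet_derivative \<Phi> (at (T \<omega>)) (DT \<omega> h) = fst h *\<^sub>R u + snd h *\<^sub>R v"
      by (rule fun_cong)
    then have "fst h *\<^sub>R u + snd h *\<^sub>R v = 0"
      using that linear_0[OF has_derivative_linear[OF smooth_on_has_derivative[OF smooth_Phi(1)]]] by simp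
    then show ?thesis using indep by (simp add: prod_eq_iff)
  qed
  define R where "R \<omega> = r 1 (T \<omega>)" for \<omega>
  have smooth_R: "smooth_on UNIV R"
    unfolding R_def[abs_def] by (rule smooth_on_compose[OF smooth_r smooth_T])
  have per: "R (\<sigma> + 1, \<tau>) = R (\<sigma>, \<tau>)" "R (\<sigma>, \<tau> + 1) = R (\<sigma>, \<tau>)" for \<sigma> \<tau>
    unfolding R_def
    by (rule complex_match[OF uv\<Gamma>(1)] complex_match[OF uv\<Gamma>(2)], simp add: \<Phi>T algebra_simps)+
  define \<mu> where "\<mu> \<omega> = complex_of_real (g (T \<omega>)) * s (T \<omega>) $ 1" for \<omega>
  have DR: "frechet_derivative R (at \<omega>) h = (of_real (snd (DT \<omega> h)) - \<mu> \<omega> * of_real (fst (DT \<omega> h))) * d_x (r 1) (T \<omega>)" for \<omega> h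
  proof -
    have "(R has_derivative (\<lambda>h. frechet_derivative (r 1) (at (T \<omega>)) (DT \<omega> h))) (at \<omega>)"
      unfolding R_def[abs_def] by (rule has_derivative_compose[OF DT smooth_on_has_derivative[OF smooth_r]])
    then have "frechet_derivative R (at \<omega>) h = frechet_derivative (r 1) (at (T \<omega>)) (fst (DT \<omega> h), snd (DT \<omega> h))"
      by (simp add: frechet_derivative_eqI)
    then show ?thesis
      unfolding smooth_on_d[OF smooth_r] r_d_t \<mu>_def by (simp add: scaleR_conv_of_real algebra_simps)
  qed
  \<comment> \<open>Im \<lambda> times det DT. Since d_t r = - \<lambda> d_x r, the Jacobian of R is
    |d_x r|^2 times this factor, which never vanishes.\<close>
  define \<kappa> where "\<kappa> \<omega> = Im (\<mu> \<omega>) * (fst (DT \<omega> (1, 0)) * snd (DT \<omega> (0, 1)) - snd (DT \<omega> (1, 0)) * fst (DT \<omega> (0, 1)))" for \<omega>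
  have J: "Im (cnj (d_t R \<omega>) * d_x R \<omega>) = (norm (d_x (r 1) (T \<omega>)))\<^sup>2 * \<kappa> \<omega>" for \<omega>
    unfolding d_t_def d_x_def[of R] DR \<kappa>_def cmod_power2
    by (simp add: algebra_simps power2_eq_square)
  have "\<kappa> \<omega> \<noteq> 0" for \<omega>
  proof -
    define t1 x1 t2 x2 where tx: "t1 = fst (DT \<omega> (1, 0))" "x1 = snd (DT \<omega> (1, 0))"
      "t2 = fst (DT \<omega> (0, 1))" "x2 = snd (DT \<omega> (0, 1))"
    have DTl: "DT \<omega> (\<xi>, \<zeta>) = (\<xi> * t1 + \<zeta> * t2, \<xi> * x1 + \<zeta> * x2)" for \<xi> \<zeta>
      using smooth_on_d[OF smooth_T, of \<omega> \<xi> \<zeta>] unfolding tx d_t_def d_x_def DT_def[symmetric]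
      by (simp add: prod_eq_iff)
    have "t1 * x2 - x1 * t2 \<noteq> 0"
    proof
      assume det: "t1 * x2 - x1 * t2 = 0"
      \<comment> \<open>Rows of the adjugate matrix, up to sign: kernel vectors as soon as the
        determinant is zero.\<close>
      have "DT \<omega> (x2, - x1) = 0" "DT \<omega> (t2, - t1) = 0"
        using det by (simp_all add: DTl prod_eq_iff algebra_simps)
      then have "(x2, - x1) = 0" "(t2, - t1) = 0" by (blast dest: inj_DT)+
      then have "x1 = 0" "t1 = 0" by (simp_all add: prod_eq_iff)
      then have "DT \<omega> (1, 0) = 0" by (simp add: DTl prod_eq_iff)
      then have "(1, 0) = (0 :: real \<times> real)" by (rule inj_DT)
      then show False by (simp add: prod_eq_iff)
    qed
    moreover have "Im (\<mu> \<omega>) \<noteq> 0"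
      using g_pos[of "T \<omega>"] s_nonreal(1)[of "T \<omega>"] by (simp add: \<mu>_def)
    ultimately show ?thesis by (simp add: \<kappa>_def tx)
  qed
  moreover have "continuous_on UNIV \<kappa>"
  proof -
    have "continuous_on UNIV (\<lambda>\<omega>. DT \<omega> h)" for h
      unfolding DT_def by (intro smooth_on_imp_continuous_on smooth_intros smooth_T)
    moreover have "continuous_on UNIV \<mu>"
      unfolding \<mu>_def[abs_def]
      by (intro smooth_on_imp_continuous_on smooth_intros smooth_on_compose[OF smooth_g smooth_T]
          smooth_on_compose[OF smooth_s smooth_T])
    ultimately show ?thesis
      unfolding \<kappa>_def[abs_def] by (intro continuous_intros)
  qed
  ultimately have sign: "(\<forall>\<omega>. \<kappa> \<omega> > 0) \<or> (\<forall>\<omega>. \<kappa> \<omega> < 0)"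
    by (intro continuous_nonzero_same_sign)
  then have "(\<forall>\<omega>. 0 \<le> Im (cnj (d_t R \<omega>) * d_x R \<omega>)) \<or> (\<forall>\<omega>. Im (cnj (d_t R \<omega>) * d_x R \<omega>) \<le> 0)"
    unfolding J by (metis less_imp_le mult_nonneg_nonneg mult_nonneg_nonpos zero_le_power2)
  then have J0: "Im (cnj (d_t R \<omega>) * d_x R \<omega>) = 0" for \<omega>
    by (rule periodic_Jacobian_zero[OF smooth_R per])
  obtain \<alpha> \<beta> where "\<Phi> z = \<alpha> *\<^sub>R u + \<beta> *\<^sub>R v"
    using plane_lattice_span[OF uv(2,1)] by blast
  then have "T (\<alpha>, \<beta>) = z" by (simp add: T_def Phi_inv flip: \<open>\<Phi> z = \<alpha> *\<^sub>R u + \<beta> *\<^sub>R v\<close>)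
  moreover have "\<kappa> (\<alpha>, \<beta>) \<noteq> 0" using sign by (metis less_irrefl)
  ultimately show ?thesis using J0[of "(\<alpha>, \<beta>)"] unfolding J by simp
qed

section \<open>Constant coefficients and flatness\<close>

lemma r_d_x_zero: "d_x (r i) z = 0"
proof -
  have "d_x (r 2) z = cnj (d_x (r 1) z)"
  proof -
    have "r 2 = (\<lambda>z. cnj (r 1 z))" by (simp add: fun_eq_iff r_cnj)
    then show ?thesis
      unfolding d_x_def by (simp add: frechet_derivative_bounded_linear[OF bounded_linear_cnj smooth_r])
  qed
  moreover have "i = 1 \<or> i = 2 \<or> i = 3 \<or> i = 4" by (rule exhaust_4)
  ultimately show ?thesis
    using complex_invariant_d_x_zero[of z] real_invariant_d_x_zero[of i z] by auto
qed

lemma r_constant: "\<exists>c. \<forall>z. riemann_invariant (field_vars a z) (s z $ i) = c"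
  using zero_derivative_imp_constant[OF smooth_r[of i]] r_d_x_zero
  by (simp add: r_d_t r_def U_def)

lemma a_constant:
  assumes "k \<le> 4"
  shows "\<exists>c. \<forall>z. a k z = c"
proof (cases "k = 4")
  case True
  then show ?thesis using a4 by auto
next
  case False
  have "Ux z = 0" for z
  proof (rule F_lin_eq_zero_imp[OF distinct_roots_card[OF dist_U]])
    fix \<zeta> assume "\<zeta> \<in> range (($) (s z))"
    then obtain i where "\<zeta> = s z $ i" by auto
    then show "F_lin (Ux z) \<zeta> = 0"
      using r_d_x_zero[of i z] one_plus_square_nonzero[of z i] by (simp add: r_d_x)
  qed
  then have Ux: "Ux z $ j = 0" for z j by simp
  \<comment> \<open>Every term on the right of the quasi-linear system contains an
    x-derivative.\<close>
  have Ut: "Ut z $ 0 = 0 \<and> Ut z $ 1 = 0 \<and> Ut z $ 2 = 0 \<and> Ut z $ 3 = 0" for z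
    using pde[of z] by (simp add: Ux)
  have "k = 0 \<or> k = 1 \<or> k = 2 \<or> k = 3" using assms False by auto
  then have "d_t (a k) z = 0" "d_x (a k) z = 0" for z
    using Ut[of z] Ux[of z 0] Ux[of z 1] Ux[of z 2] Ux[of z 3] by (auto simp: Ut_def Ux_def)
  then show ?thesis
    using zero_derivative_imp_constant[OF smooth_a[OF assms]] by blast
qed

text \<open>With g = c the metric is c^2 dt^2 + dx^2, so (c t, x) is a single isometric chart for
  the whole plane.\<close>

lemma flat: "flat_metric \<rho>"
proof -
  obtain c where c: "\<And>z. g z = c" using a_constant[of 3] a3 by auto
  define \<Lambda> where "\<Lambda> \<omega> = (c * fst \<omega>) *\<^sub>R axis 1 1 + snd \<omega> *\<^sub>R (axis 2 1 :: real^2)" for \<omega>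
  have c0: "c > 0" using g_pos c by metis
  have lin: "bounded_linear \<Lambda>"
    unfolding \<Lambda>_def[abs_def]
    by (intro bounded_linear_add bounded_linear_compose[OF bounded_linear_scaleR_left]
        bounded_linear_const_mult bounded_linear_fst bounded_linear_snd)
  have inner: "\<Lambda> h \<bullet> \<Lambda> k = c\<^sup>2 * fst h * fst k + snd h * snd k" for h k
    by (simp add: \<Lambda>_def inner_add_left inner_add_right inner_axis_axis power2_eq_square)
  define \<psi> where "\<psi> y = \<Lambda> (inv \<Phi> y)" for y
  have "smooth_on UNIV \<psi>"
    unfolding \<psi>_def[abs_def] by (rule smooth_on_bounded_linear[OF lin smooth_Phi(2)])
  moreover have "inj \<psi>"
  proof (rule injI)
    fix y y' assume "\<psi> y = \<psi> y'"
    then have "\<Lambda> (inv \<Phi> y) $ i = \<Lambda> (inv \<Phi> y') $ i" for i by (simp add: \<psi>_def)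
    from this[of 1] this[of 2] have "inv \<Phi> y = inv \<Phi> y'"
      using c0 by (simp add: \<Lambda>_def axis_def prod_eq_iff)
    then show "y = y'" by (metis Phi_inv(1))
  qed
  moreover have "metric_inner \<rho> y v w = frechet_derivative \<psi> (at y) v \<bullet> frechet_derivative \<psi> (at y) w" for y v w
  proof -
    define z where "z = inv \<Phi> y"
    define D where "D = frechet_derivative (inv \<Phi>) (at y)"
    have \<psi>': "frechet_derivative \<psi> (at y) v = \<Lambda> (D v)" for v
      unfolding \<psi>_def[abs_def] D_def by (rule frechet_derivative_bounded_linear[OF lin smooth_Phi(2)])
    \<comment> \<open>D inverts D\<Phi>, so D v lists the components of v in the coordinate
      frame.\<close>
    have expand: "v = fst (D v) *\<^sub>R d_t \<Phi> z + snd (D v) *\<^sub>R d_x \<Phi> z" for v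
    proof -
      have "((\<lambda>y. \<Phi> (inv \<Phi> y)) has_derivative (\<lambda>v. frechet_derivative \<Phi> (at z) (D v))) (at y)"
        unfolding z_def D_def
        by (rule has_derivative_compose) (intro smooth_on_has_derivative smooth_Phi)+
      then have "((\<lambda>y. y) has_derivative (\<lambda>v. frechet_derivative \<Phi> (at z) (D v))) (at y)"
        by (simp add: Phi_inv)
      then have "(\<lambda>v. frechet_derivative \<Phi> (at z) (D v)) = (\<lambda>v. v)"
        using has_derivative_unique has_derivative_ident by blast
      then have "v = frechet_derivative \<Phi> (at z) (fst (D v), snd (D v))"
        by (simp add: fun_eq_iff)
      then show ?thesis by (simp only: smooth_on_d[OF smooth_Phi(1)])
    qed
    have \<Phi>z: "\<Phi> z = y" by (simp add: z_def Phi_inv)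
    have "d_x \<Phi> z \<bullet> (\<rho> y *v d_t \<Phi> z) = 0"
      using orthonormal_frame.e21[OF frame, of z] c0 by (simp add: \<Phi>z c matrix_vector_mult_scaleR)
    then have "(\<xi> *\<^sub>R d_t \<Phi> z + \<zeta> *\<^sub>R d_x \<Phi> z) \<bullet> (\<rho> y *v (\<xi>' *\<^sub>R d_t \<Phi> z + \<zeta>' *\<^sub>R d_x \<Phi> z)) =
        c\<^sup>2 * \<xi> * \<xi>' + \<zeta> * \<zeta>'" for \<xi> \<zeta> \<xi>' \<zeta>'
      using metric_coords[of z] unfolding metric_inner_def \<Phi>z c
      by (simp add: matrix_vector_right_distrib matrix_vector_mult_scaleR inner_add_left inner_add_right)
    then show ?thesis
      unfolding metric_inner_def \<psi>' inner using expand by metis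
  qed
  ultimately show ?thesis
    unfolding flat_metric_def by (intro allI exI[of _ UNIV] exI[of _ \<psi>]) simp
qed

end

theorem theorem6:
  fixes \<Gamma> :: "(real^2) set"
    and \<rho> :: "real^2 \<Rightarrow> real^2^2"
    and F :: "(real^2) \<times> (real^2) \<Rightarrow> real"
    and L :: "((real^2) \<times> (real^2)) set"
    and \<Phi> :: "real \<times> real \<Rightarrow> real^2"
    and g :: "real \<times> real \<Rightarrow> real"
    and a :: "nat \<Rightarrow> real \<times> real \<Rightarrow> real"
    and s :: "real \<times> real \<Rightarrow> complex^4"
  assumes "plane_lattice \<Gamma>"
    and "torus_metric \<Gamma> \<rho>"
    and "quartic_first_integral \<Gamma> \<rho> F"
    and "regular_liouville_torus \<Gamma> \<rho> F L"
    and "semi_geodesic_coordinates \<rho> L \<Phi> g"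
    and "normalized_coefficients F \<Phi> g a"
    and "continuous_on UNIV s"
    and "\<And>z. distinct_roots (field_vars a z) (s z)"
    and "\<And>z. \<exists>\<alpha> \<beta>. \<beta> \<noteq> 0 \<and> s z $ 1 = Complex \<alpha> \<beta> \<and> s z $ 2 = Complex \<alpha> (- \<beta>)"
    and "\<And>z. s z $ 3 \<in> \<real> \<and> s z $ 4 \<in> \<real>"
    and "\<And>z i. i \<in> {1, 2} \<Longrightarrow> Im (riemann_invariant (field_vars a z) (s z $ i)) \<noteq> 0"
  shows "(\<forall>z. genuinely_nonlinear (field_vars a z) (s z) 3 \<and>
              genuinely_nonlinear (field_vars a z) (s z) 4) \<and>
         (\<exists>c. \<forall>z. riemann_invariant (field_vars a z) (s z $ 3) = c) \<and>
         (\<exists>c. \<forall>z. riemann_invariant (field_vars a z) (s z $ 4) = c) \<and>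
         (\<forall>k\<le>4. \<exists>c. \<forall>z. a k z = c) \<and>
         flat_metric \<rho>"
proof -
  interpret elliptic_quartic_integral \<Gamma> \<rho> F L \<Phi> g a s
    using assms by unfold_locales
  show ?thesis
    using genuinely_nonlinear_real r_constant a_constant flat by blast
qed

end
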